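(* Suppose that $E$ is a directed graph. Then the graph $C^*$-algebra $C^*(E)$, with the $\mathbb{Z}$-grading given by the gauge action, is a strongly $\mathbb{Z}$-graded $C^*$-algebra if and only if $E$ is row-finite, has no sources, and has property (Y).
   Context: A directed graph $E=(E^0,E^1,r,s)$ consists of sets $E^0$ (vertices), $E^1$ (edges) and maps $r,s:E^1\to E^0$ (range and source). Raeburn's path convention is used: a finite path of length $n\geq 1$ is a word $\alpha=\alpha_1\alpha_2\cdots\alpha_n$ of edges with $s(\alpha_i)=r(\alpha_{i+1})$ for $1\le i<n$; $|\alpha|=n$, $r(\alpha)=r(\alpha_1)$, $s(\alpha)=s(\alpha_n)$. Vertices are paths of length $0$ with $r(v)=s(v)=v$. $E^*$ is the set of all finite paths. An infinite path is a sequence $x=x_1x_2\cdots$ of edges with $s(x_i)=r(x_{i+1})$ for all $i$; $E^\infty$ is the set of infinite paths; the initial segments of $x$ are the paths $x_1\cdots x_n$ and the vertex $r(x_1)$. $E$ is row-finite if $r^{-1}(v)$ is finite for every $v\in E^0$; $E$ has no sources if $r^{-1}(v)\neq\emptyset$ for every $v\in E^0$. $E$ has property (Y) if for every $x\in E^\infty$ and every $k\in\mathbb{N}$ there are an initial segment $\alpha$ of $x$ and a finite path $\beta\in E^*$ such that $s(\alpha)=s(\beta)$ and $|\beta|-|\alpha|=k$. $C^*(E)$ is the universal $C^*$-algebra generated by a Cuntz–Krieger $E$-family: mutually orthogonal projections $\{p_v:v\in E^0\}$ and partial isometries $\{s_e:e\in E^1\}$ with mutually orthogonal ranges such that $s_e^*s_e=p_{s(e)}$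 and $s_es_e^*\le p_{r(e)}$ for all $e\in E^1$, and $p_v=\sum_{r(e)=v}s_es_e^*$ whenever $0<|r^{-1}(v)|<\infty$. The gauge action $\gamma:\mathbb{T}\to\operatorname{Aut}C^*(E)$ is determined by $\gamma_z(s_e)=zs_e$ and $\gamma_z(p_v)=p_v$. The $\mathbb{Z}$-grading is given by $C^*(E)_n:=\{a\in C^*(E):\gamma_z(a)=z^na\text{ for all }z\in\mathbb{T}\}$, $n\in\mathbb{Z}$. For a group $\Gamma$, a $C^*$-algebra $A$ is $\Gamma$-graded if there are linearly independent closed subspaces $\{A_\gamma:\gamma\in\Gamma\}$ of $A$ such that for all $\alpha,\beta\in\Gamma$: (1) $A_\alpha\cdot A_\beta:=\operatorname{span}\{ab:a\in A_\alpha,b\in A_\beta\}\subseteq A_{\alpha\beta}$; (2) $\{a^*:a\in A_\alpha\}\subseteq A_{\alpha^{-1}}$; and (3) $\bigoplus_{\gamma\in\Gamma}A_\gamma$ is dense in $A$. It is strongly $\Gamma$-graded if in addition $A_\alpha\cdot A_\beta$ is dense in $A_{\alpha\beta}$ for all $\alpha,\beta\in\Gamma$. *)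

theory Defs
  imports
    "HOL-Analysis.Analysis"
    "HOL-Library.Poly_Mapping"
    "HOL-Algebra.Elementary_Groups"
    "HOL-Algebra.Module"
    "Graph_Theory.Digraph"
begin

section \<open>Complex star-algebras and C*-algebras with explicit carriers\<close>

text \<open>
  The records extend the \<open>module\<close> record of HOL-Algebra. Algebras are not assumed to be
  unital, so the inherited field \<open>one\<close> is never used.
\<close>

record 'a star_alg = "(complex, 'a) module" +
  star :: "'a \<Rightarrow> 'a"

record 'a cstar_alg = "'a star_alg" +
  cnorm :: "'a \<Rightarrow> real"

locale star_algebra = abelian_group A for A :: "('a, 'm) star_alg_scheme" (structure) +
  assumes smult_closed: "x \<in> carrier A \<Longrightarrow> c \<odot> x \<in> carrier A"
    and smult_l_distr: "x \<in> carrier A \<Longrightarrow> (c + d) \<odot> x = c \<odot> x \<oplus> d \<odot> x"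
    and smult_r_distr: "\<lbrakk>x \<in> carrier A; y \<in> carrier A\<rbrakk> \<Longrightarrow> c \<odot> (x \<oplus> y) = c \<odot> x \<oplus> c \<odot> y"
    and smult_assoc: "x \<in> carrier A \<Longrightarrow> (c * d) \<odot> x = c \<odot> (d \<odot> x)"
    and smult_one: "x \<in> carrier A \<Longrightarrow> 1 \<odot> x = x"
    and mult_closed: "\<lbrakk>x \<in> carrier A; y \<in> carrier A\<rbrakk> \<Longrightarrow> x \<otimes> y \<in> carrier A"
    and mult_assoc: "\<lbrakk>x \<in> carrier A; y \<in> carrier A; z \<in> carrier A\<rbrakk> \<Longrightarrow> x \<otimes> y \<otimes> z = x \<otimes> (y \<otimes> z)"
    and mult_l_distr: "\<lbrakk>x \<in> carrier A; y \<in> carrier A; z \<in> carrier A\<rbrakk> \<Longrightarrow> (x \<oplus> y) \<otimes> z = x \<otimes> z \<oplus> y \<otimes> z"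
    and mult_r_distr: "\<lbrakk>x \<in> carrier A; y \<in> carrier A; z \<in> carrier A\<rbrakk> \<Longrightarrow> z \<otimes> (x \<oplus> y) = z \<otimes> x \<oplus> z \<otimes> y"
    and smult_mult_left: "\<lbrakk>x \<in> carrier A; y \<in> carrier A\<rbrakk> \<Longrightarrow> (c \<odot> x) \<otimes> y = c \<odot> (x \<otimes> y)"
    and smult_mult_right: "\<lbrakk>x \<in> carrier A; y \<in> carrier A\<rbrakk> \<Longrightarrow> x \<otimes> (c \<odot> y) = c \<odot> (x \<otimes> y)"
    and star_closed: "x \<in> carrier A \<Longrightarrow> star A x \<in> carrier A"
    and star_star: "x \<in> carrier A \<Longrightarrow> star A (star A x) = x"
    and star_add: "\<lbrakk>x \<in> carrier A; y \<in> carrier A\<rbrakk> \<Longrightarrow> star A (x \<oplus> y) = star A x \<oplus> star A y"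
    and star_smult: "x \<in> carrier A \<Longrightarrow> star A (c \<odot> x) = cnj c \<odot> star A x"
    and star_mult: "\<lbrakk>x \<in> carrier A; y \<in> carrier A\<rbrakk> \<Longrightarrow> star A (x \<otimes> y) = star A y \<otimes> star A x"

locale cstar_seminorm = star_algebra A for A :: "('a, 'm) star_alg_scheme" (structure) +
  fixes N :: "'a \<Rightarrow> real"
  assumes seminorm_nonneg: "x \<in> carrier A \<Longrightarrow> 0 \<le> N x"
    and seminorm_add: "\<lbrakk>x \<in> carrier A; y \<in> carrier A\<rbrakk> \<Longrightarrow> N (x \<oplus> y) \<le> N x + N y"
    and seminorm_smult: "x \<in> carrier A \<Longrightarrow> N (c \<odot> x) = cmod c * N x"
    and seminorm_mult: "\<lbrakk>x \<in> carrier A; y \<in> carrier A\<rbrakk> \<Longrightarrow> N (x \<otimes> y) \<le> N x * N y"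
    and seminorm_star: "x \<in> carrier A \<Longrightarrow> N (star A x \<otimes> x) = (N x)\<^sup>2"

text \<open>
  The value outside the carrier is irrelevant; it is fixed because the locale \<open>Metric_space\<close>
  requires non-negativity and symmetry for all arguments.
\<close>

definition cdist :: "('a, 'm) cstar_alg_scheme \<Rightarrow> 'a \<Rightarrow> 'a \<Rightarrow> real" where
  "cdist A x y = (if x \<in> carrier A \<and> y \<in> carrier A then cnorm A (x \<ominus>\<^bsub>A\<^esub> y) else 0)"

abbreviation ctopology :: "('a, 'm) cstar_alg_scheme \<Rightarrow> 'a topology" where
  "ctopology A \<equiv> Metric_space.mtopology (carrier A) (cdist A)"

abbreviation cclosure :: "('a, 'm) cstar_alg_scheme \<Rightarrow> 'a set \<Rightarrow> 'a set" where
  "cclosure A S \<equiv> Abstract_Topology.closure_of (ctopology A) S"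

locale cstar_algebra = cstar_seminorm A "cnorm A" for A :: "('a, 'm) cstar_alg_scheme" (structure) +
  assumes norm_eq_0: "\<lbrakk>x \<in> carrier A; cnorm A x = 0\<rbrakk> \<Longrightarrow> x = \<zero>"
    and complete: "Metric_space.mcomplete (carrier A) (cdist A)"

definition star_hom :: "('a, 'm) star_alg_scheme \<Rightarrow> ('b, 'n) star_alg_scheme \<Rightarrow> ('a \<Rightarrow> 'b) set" where
  "star_hom A B = {\<phi>. \<phi> \<in> carrier A \<rightarrow> carrier B \<and>
     (\<forall>x\<in>carrier A. \<forall>y\<in>carrier A. \<phi> (x \<oplus>\<^bsub>A\<^esub> y) = \<phi> x \<oplus>\<^bsub>B\<^esub> \<phi> y) \<and>
     (\<forall>c. \<forall>x\<in>carrier A. \<phi> (c \<odot>\<^bsub>A\<^esub> x) = c \<odot>\<^bsub>B\<^esub> \<phi> x) \<and>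
     (\<forall>x\<in>carrier A. \<forall>y\<in>carrier A. \<phi> (x \<otimes>\<^bsub>A\<^esub> y) = \<phi> x \<otimes>\<^bsub>B\<^esub> \<phi> y) \<and>
     (\<forall>x\<in>carrier A. \<phi> (star A x) = star B (\<phi> x))}"

definition star_aut :: "('a, 'm) star_alg_scheme \<Rightarrow> ('a \<Rightarrow> 'a) set" where
  "star_aut A = {\<phi> \<in> star_hom A A. bij_betw \<phi> (carrier A) (carrier A)}"


section \<open>Gradings\<close>

definition csubspace :: "('a, 'm) star_alg_scheme \<Rightarrow> 'a set \<Rightarrow> bool" where
  "csubspace A V \<longleftrightarrow> V \<subseteq> carrier A \<and> \<zero>\<^bsub>A\<^esub> \<in> V \<and>
     (\<forall>x\<in>V. \<forall>y\<in>V. x \<oplus>\<^bsub>A\<^esub> y \<in> V) \<and> (\<forall>c. \<forall>x\<in>V. c \<odot>\<^bsub>A\<^esub> x \<in> V)"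

definition prod_span :: "('a, 'm) star_alg_scheme \<Rightarrow> 'a set \<Rightarrow> 'a set \<Rightarrow> 'a set" where
  "prod_span A S T = csubspace A hull {x \<otimes>\<^bsub>A\<^esub> y | x y. x \<in> S \<and> y \<in> T}"

text \<open>
  Linear independence of a family of subspaces means that their sum is direct; the zero
  subspace is allowed. The algebraic direct sum is then the linear span of the union.
\<close>

definition independent_subspaces ::
    "('a, 'm) star_alg_scheme \<Rightarrow> 'g set \<Rightarrow> ('g \<Rightarrow> 'a set) \<Rightarrow> bool" where
  "independent_subspaces A I V \<longleftrightarrow>
     (\<forall>F x. finite F \<and> F \<subseteq> I \<and> x \<in> Pi F V \<and> finsum A x F = \<zero>\<^bsub>A\<^esub> \<longrightarrow> (\<forall>i\<in>F. x i = \<zero>\<^bsub>A\<^esub>))"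

definition graded_cstar_algebra ::
    "('g, 'n) monoid_scheme \<Rightarrow> ('a, 'm) cstar_alg_scheme \<Rightarrow> ('g \<Rightarrow> 'a set) \<Rightarrow> bool" where
  "graded_cstar_algebra G A V \<longleftrightarrow> group G \<and> cstar_algebra A \<and>
     (\<forall>g\<in>carrier G. csubspace A (V g) \<and> closedin (ctopology A) (V g)) \<and>
     independent_subspaces A (carrier G) V \<and>
     (\<forall>g\<in>carrier G. \<forall>h\<in>carrier G. prod_span A (V g) (V h) \<subseteq> V (g \<otimes>\<^bsub>G\<^esub> h)) \<and>
     (\<forall>g\<in>carrier G. star A ` V g \<subseteq> V (inv\<^bsub>G\<^esub> g)) \<and>
     cclosure A (csubspace A hull (\<Union>g\<in>carrier G. V g)) = carrier A"

definition strongly_graded_cstar_algebra ::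
    "('g, 'n) monoid_scheme \<Rightarrow> ('a, 'm) cstar_alg_scheme \<Rightarrow> ('g \<Rightarrow> 'a set) \<Rightarrow> bool" where
  "strongly_graded_cstar_algebra G A V \<longleftrightarrow> graded_cstar_algebra G A V \<and>
     (\<forall>g\<in>carrier G. \<forall>h\<in>carrier G.
        V (g \<otimes>\<^bsub>G\<^esub> h) \<subseteq> cclosure A (prod_span A (V g) (V h)))"


section \<open>Paths in directed graphs\<close>

text \<open>
  The source map of the graph is \<open>tail\<close> and the range map is \<open>head\<close>. Paths are read in
  Raeburn's convention, so that each edge of a word starts where the next one ends.
\<close>

definition row_finite :: "('v, 'e) pre_digraph \<Rightarrow> bool" where
  "row_finite E \<longleftrightarrow> (\<forall>v\<in>verts E. finite {e \<in> arcs E. head E e = v})"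

definition no_sources :: "('v, 'e) pre_digraph \<Rightarrow> bool" where
  "no_sources E \<longleftrightarrow> (\<forall>v\<in>verts E. {e \<in> arcs E. head E e = v} \<noteq> {})"

datatype ('v, 'e) fpath = Vertex_Path 'v | Edge_Path "'e list"

definition finite_paths :: "('v, 'e) pre_digraph \<Rightarrow> ('v, 'e) fpath set" where
  "finite_paths E = Vertex_Path ` verts E \<union>
     Edge_Path ` {es. es \<noteq> [] \<and> set es \<subseteq> arcs E \<and>
       (\<forall>i. Suc i < length es \<longrightarrow> tail E (es ! i) = head E (es ! Suc i))}"

fun path_length :: "('v, 'e) fpath \<Rightarrow> nat" where
  "path_length (Vertex_Path v) = 0"
| "path_length (Edge_Path es) = length es"

fun path_source :: "('v, 'e) pre_digraph \<Rightarrow> ('v, 'e) fpath \<Rightarrow> 'v" where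
  "path_source E (Vertex_Path v) = v"
| "path_source E (Edge_Path es) = tail E (last es)"

definition infinite_paths :: "('v, 'e) pre_digraph \<Rightarrow> (nat \<Rightarrow> 'e) set" where
  "infinite_paths E = {x. (\<forall>i. x i \<in> arcs E) \<and> (\<forall>i. tail E (x i) = head E (x (Suc i)))}"

definition initial_segments ::
    "('v, 'e) pre_digraph \<Rightarrow> (nat \<Rightarrow> 'e) \<Rightarrow> ('v, 'e) fpath set" where
  "initial_segments E x =
     insert (Vertex_Path (head E (x 0))) {Edge_Path (map x [0..<n]) | n. n \<ge> 1}"

definition property_Y :: "('v, 'e) pre_digraph \<Rightarrow> bool" where
  "property_Y E \<longleftrightarrow> (\<forall>x\<in>infinite_paths E. \<forall>k::nat.
     \<exists>\<alpha>\<in>initial_segments E x. \<exists>\<beta>\<in>finite_paths E.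
       path_source E \<alpha> = path_source E \<beta> \<and>
       int (path_length \<beta>) - int (path_length \<alpha>) = int k)"


section \<open>Cuntz--Krieger families\<close>

text \<open>
  The defining relations are collected as a set of pairs of elements that have to be
  identified, so that the same relations can be imposed in a C*-algebra (where the two sides
  are equal) and on a free star-algebra (where the difference has seminorm zero).
  For projections, the relation \<open>q \<le> p\<close> means \<open>p q = q\<close>.
\<close>

inductive_set ck_equations ::
    "('v, 'e) pre_digraph \<Rightarrow> ('a, 'm) star_alg_scheme \<Rightarrow> ('v \<Rightarrow> 'a) \<Rightarrow> ('e \<Rightarrow> 'a) \<Rightarrow> ('a \<times> 'a) set"
  for E :: "('v, 'e) pre_digraph" and A :: "('a, 'm) star_alg_scheme"
    and p :: "'v \<Rightarrow> 'a" and s :: "'e \<Rightarrow> 'a" where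
  proj_adjoint: "v \<in> verts E \<Longrightarrow> (star A (p v), p v) \<in> ck_equations E A p s"
| proj_idem: "v \<in> verts E \<Longrightarrow> (p v \<otimes>\<^bsub>A\<^esub> p v, p v) \<in> ck_equations E A p s"
| proj_orth: "\<lbrakk>v \<in> verts E; w \<in> verts E; v \<noteq> w\<rbrakk> \<Longrightarrow>
    (p v \<otimes>\<^bsub>A\<^esub> p w, \<zero>\<^bsub>A\<^esub>) \<in> ck_equations E A p s"
| partial_isom: "e \<in> arcs E \<Longrightarrow>
    (s e \<otimes>\<^bsub>A\<^esub> star A (s e) \<otimes>\<^bsub>A\<^esub> s e, s e) \<in> ck_equations E A p s"
| range_orth: "\<lbrakk>e \<in> arcs E; f \<in> arcs E; e \<noteq> f\<rbrakk> \<Longrightarrow>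
    ((s e \<otimes>\<^bsub>A\<^esub> star A (s e)) \<otimes>\<^bsub>A\<^esub> (s f \<otimes>\<^bsub>A\<^esub> star A (s f)), \<zero>\<^bsub>A\<^esub>) \<in> ck_equations E A p s"
| source_proj: "e \<in> arcs E \<Longrightarrow>
    (star A (s e) \<otimes>\<^bsub>A\<^esub> s e, p (tail E e)) \<in> ck_equations E A p s"
| range_proj: "e \<in> arcs E \<Longrightarrow>
    (p (head E e) \<otimes>\<^bsub>A\<^esub> (s e \<otimes>\<^bsub>A\<^esub> star A (s e)), s e \<otimes>\<^bsub>A\<^esub> star A (s e)) \<in> ck_equations E A p s"
| ck_sum: "\<lbrakk>v \<in> verts E; finite {e \<in> arcs E. head E e = v}; {e \<in> arcs E. head E e = v} \<noteq> {}\<rbrakk> \<Longrightarrow>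
    (p v, finsum A (\<lambda>e. s e \<otimes>\<^bsub>A\<^esub> star A (s e)) {e \<in> arcs E. head E e = v}) \<in> ck_equations E A p s"

definition ck_family ::
    "('v, 'e) pre_digraph \<Rightarrow> ('a, 'm) star_alg_scheme \<Rightarrow> ('v \<Rightarrow> 'a) \<Rightarrow> ('e \<Rightarrow> 'a) \<Rightarrow> bool" where
  "ck_family E A p s \<longleftrightarrow> p \<in> verts E \<rightarrow> carrier A \<and> s \<in> arcs E \<rightarrow> carrier A \<and>
     (\<forall>(a, b) \<in> ck_equations E A p s. a = b)"


section \<open>Universal C*-algebras\<close>

text \<open>Words in letters \<open>g\<close>, encoded as \<open>(g, False)\<close>, and \<open>g*\<close>, encoded as \<open>(g, True)\<close>.\<close>

datatype 'g star_word = Star_Word (letters: "('g \<times> bool) list")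

instantiation star_word :: (type) monoid_add
begin

definition zero_star_word :: "'a star_word" where
  "0 = Star_Word []"

definition plus_star_word :: "'a star_word \<Rightarrow> 'a star_word \<Rightarrow> 'a star_word" where
  "v + w = Star_Word (letters v @ letters w)"

instance
  by standard (auto simp: zero_star_word_def plus_star_word_def)

end

definition adj_word :: "'g star_word \<Rightarrow> 'g star_word" where
  "adj_word w = Star_Word (rev (map (\<lambda>(g, b). (g, \<not> b)) (letters w)))"

text \<open>
  The free star-algebra on \<open>X\<close> consists of the finitely supported functions on words;
  \<open>(*)\<close> on this type is convolution with respect to concatenation. The empty word is
  excluded because the algebra is not unital.
\<close>

definition free_star_algebra :: "'g set \<Rightarrow> ('g star_word \<Rightarrow>\<^sub>0 complex) star_alg" where
  "free_star_algebra X =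
     \<lparr>carrier = {f. \<forall>w\<in>Poly_Mapping.keys f. letters w \<noteq> [] \<and> fst ` set (letters w) \<subseteq> X},
      mult = (*), one = undefined, zero = 0, add = (+),
      smult = (\<lambda>c. Poly_Mapping.map ((*) c)),
      star = (\<lambda>f. Poly_Mapping.map_key adj_word (Poly_Mapping.map cnj f))\<rparr>"

definition free_gen :: "'g \<Rightarrow> 'g star_word \<Rightarrow>\<^sub>0 complex" where
  "free_gen g = Poly_Mapping.single (Star_Word [(g, False)]) 1"

text \<open>
  The largest C*-seminorm that identifies the two sides of every relation in \<open>R\<close>. Its
  Hausdorff completion is the universal C*-algebra for these relations, provided that the
  supremum is finite on every element; for the Cuntz--Krieger relations this is
  \<open>ck_seminorm_bounded\<close> below.
\<close>

definition universal_seminorm :: "('a, 'm) star_alg_scheme \<Rightarrow> ('a \<times> 'a) set \<Rightarrow> 'a \<Rightarrow> real" where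
  "universal_seminorm A R x =
     (SUP N \<in> {N. cstar_seminorm A N \<and> (\<forall>(a, b)\<in>R. N (a \<ominus>\<^bsub>A\<^esub> b) = 0)}. N x)"

text \<open>Cauchy sequences modulo null sequences.\<close>

definition cauchy_seqs :: "('a, 'm) star_alg_scheme \<Rightarrow> ('a \<Rightarrow> real) \<Rightarrow> (nat \<Rightarrow> 'a) set" where
  "cauchy_seqs A N = {x. range x \<subseteq> carrier A \<and>
     (\<forall>\<epsilon>>0. \<exists>M. \<forall>m\<ge>M. \<forall>n\<ge>M. N (x m \<ominus>\<^bsub>A\<^esub> x n) < \<epsilon>)}"

definition null_rel ::
    "('a, 'm) star_alg_scheme \<Rightarrow> ('a \<Rightarrow> real) \<Rightarrow> ((nat \<Rightarrow> 'a) \<times> (nat \<Rightarrow> 'a)) set" where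
  "null_rel A N = {(x, y). x \<in> cauchy_seqs A N \<and> y \<in> cauchy_seqs A N \<and>
     (\<lambda>n. N (x n \<ominus>\<^bsub>A\<^esub> y n)) \<longlonglongrightarrow> 0}"

definition hausdorff_completion ::
    "('a, 'm) star_alg_scheme \<Rightarrow> ('a \<Rightarrow> real) \<Rightarrow> (nat \<Rightarrow> 'a) set cstar_alg" where
  "hausdorff_completion A N =
     \<lparr>carrier = cauchy_seqs A N // null_rel A N,
      mult = (\<lambda>X Y. \<Union>x\<in>X. \<Union>y\<in>Y. null_rel A N `` {\<lambda>n. x n \<otimes>\<^bsub>A\<^esub> y n}),
      one = undefined,
      zero = null_rel A N `` {\<lambda>n. \<zero>\<^bsub>A\<^esub>},
      add = (\<lambda>X Y. \<Union>x\<in>X. \<Union>y\<in>Y. null_rel A N `` {\<lambda>n. x n \<oplus>\<^bsub>A\<^esub> y n}),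
      smult = (\<lambda>c X. \<Union>x\<in>X. null_rel A N `` {\<lambda>n. c \<odot>\<^bsub>A\<^esub> x n}),
      star = (\<lambda>X. \<Union>x\<in>X. null_rel A N `` {\<lambda>n. star A (x n)}),
      cnorm = (\<lambda>X. THE r. \<forall>x\<in>X. (\<lambda>n. N (x n)) \<longlonglongrightarrow> r)\<rparr>"

definition completion_embed ::
    "('a, 'm) star_alg_scheme \<Rightarrow> ('a \<Rightarrow> real) \<Rightarrow> 'a \<Rightarrow> (nat \<Rightarrow> 'a) set" where
  "completion_embed A N a = null_rel A N `` {\<lambda>n. a}"


section \<open>Graph C*-algebras and their gauge actions\<close>

text \<open>
  That \<open>graph_cstar E\<close> is a C*-algebra generated by a universal Cuntz--Krieger family
  (among all C*-algebras, of arbitrary type) is proved in \<open>cstar_algebra_graph_cstar\<close>,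
  \<open>ck_family_graph_cstar\<close> and \<open>graph_cstar_universal\<close>. The automorphism described in
  \<open>gauge_action\<close> exists and is unique by \<open>gauge_action_unique_existence\<close>; it is
  made extensional so that \<open>THE\<close> applies.
\<close>

datatype ('v, 'e) ck_gen = Proj_Gen 'v | Isom_Gen 'e

definition ck_free_algebra ::
    "('v, 'e) pre_digraph \<Rightarrow> (('v, 'e) ck_gen star_word \<Rightarrow>\<^sub>0 complex) star_alg" where
  "ck_free_algebra E = free_star_algebra (Proj_Gen ` verts E \<union> Isom_Gen ` arcs E)"

definition ck_seminorm ::
    "('v, 'e) pre_digraph \<Rightarrow> (('v, 'e) ck_gen star_word \<Rightarrow>\<^sub>0 complex) \<Rightarrow> real" where
  "ck_seminorm E = universal_seminorm (ck_free_algebra E)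
     (ck_equations E (ck_free_algebra E)
       (\<lambda>v. free_gen (Proj_Gen v)) (\<lambda>e. free_gen (Isom_Gen e)))"

definition graph_cstar ::
    "('v, 'e) pre_digraph \<Rightarrow> (nat \<Rightarrow> ('v, 'e) ck_gen star_word \<Rightarrow>\<^sub>0 complex) set cstar_alg" where
  "graph_cstar E = hausdorff_completion (ck_free_algebra E) (ck_seminorm E)"

definition graph_proj ::
    "('v, 'e) pre_digraph \<Rightarrow> 'v \<Rightarrow> (nat \<Rightarrow> ('v, 'e) ck_gen star_word \<Rightarrow>\<^sub>0 complex) set" where
  "graph_proj E v = completion_embed (ck_free_algebra E) (ck_seminorm E) (free_gen (Proj_Gen v))"

definition graph_isom ::
    "('v, 'e) pre_digraph \<Rightarrow> 'e \<Rightarrow> (nat \<Rightarrow> ('v, 'e) ck_gen star_word \<Rightarrow>\<^sub>0 complex) set" where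
  "graph_isom E e = completion_embed (ck_free_algebra E) (ck_seminorm E) (free_gen (Isom_Gen e))"

definition gauge_action ::
    "('v, 'e) pre_digraph \<Rightarrow> complex \<Rightarrow>
     (nat \<Rightarrow> ('v, 'e) ck_gen star_word \<Rightarrow>\<^sub>0 complex) set \<Rightarrow>
     (nat \<Rightarrow> ('v, 'e) ck_gen star_word \<Rightarrow>\<^sub>0 complex) set" where
  "gauge_action E z = (THE \<phi>. \<phi> \<in> star_aut (graph_cstar E) \<and>
     \<phi> \<in> extensional (carrier (graph_cstar E)) \<and>
     (\<forall>e\<in>arcs E. \<phi> (graph_isom E e) = z \<odot>\<^bsub>graph_cstar E\<^esub> graph_isom E e) \<and>
     (\<forall>v\<in>verts E. \<phi> (graph_proj E v) = graph_proj E v))"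

definition gauge_component ::
    "('v, 'e) pre_digraph \<Rightarrow> int \<Rightarrow> (nat \<Rightarrow> ('v, 'e) ck_gen star_word \<Rightarrow>\<^sub>0 complex) set set" where
  "gauge_component E n = {a \<in> carrier (graph_cstar E).
     \<forall>z. cmod z = 1 \<longrightarrow> gauge_action E z a = (z powi n) \<odot>\<^bsub>graph_cstar E\<^esub> a}"


section \<open>Basic facts on star-algebras\<close>

context star_algebra
begin

lemma smult_zero_right: "c \<odot> \<zero> = \<zero>"
proof -
  have "c \<odot> \<zero> = c \<odot> \<zero> \<oplus> c \<odot> \<zero>"
    using smult_r_distr[of \<zero> \<zero> c] by simp
  then show ?thesis
    using smult_closed[of \<zero> c] by (metis zero_closed add.l_cancel_one')
qed

lemma smult_zero_left: "x \<in> carrier A \<Longrightarrow> 0 \<odot> x = \<zero>"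
  using smult_l_distr[of x 0 0] smult_closed[of x 0] by (metis add.l_cancel_one' add_0)

lemma minus_eq_smult: "x \<in> carrier A \<Longrightarrow> \<ominus> x = (-1) \<odot> x"
proof (rule minus_equality)
  assume x: "x \<in> carrier A"
  have "(-1) \<odot> x \<oplus> x = (-1) \<odot> x \<oplus> 1 \<odot> x" using x by (simp add: smult_one)
  also have "\<dots> = (-1 + 1) \<odot> x" using x by (simp only: smult_l_distr)
  finally show "(-1) \<odot> x \<oplus> x = \<zero>" using x by (simp add: smult_zero_left)
qed (auto simp: smult_closed)

lemma diff_eq_smult: "\<lbrakk>x \<in> carrier A; y \<in> carrier A\<rbrakk> \<Longrightarrow> x \<ominus> y = x \<oplus> (-1) \<odot> y"
  by (simp add: a_minus_def minus_eq_smult)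

lemma mult_zero_left: "x \<in> carrier A \<Longrightarrow> \<zero> \<otimes> x = \<zero>"
  using smult_mult_left[of \<zero> x 0] by (simp add: smult_zero_left mult_closed)

lemma mult_zero_right: "x \<in> carrier A \<Longrightarrow> x \<otimes> \<zero> = \<zero>"
  using smult_mult_right[of x \<zero> 0] by (simp add: smult_zero_left mult_closed)

lemma star_zero: "star A \<zero> = \<zero>"
  using star_smult[of \<zero> 0] by (simp add: smult_zero_left star_closed)

lemma star_diff: "\<lbrakk>x \<in> carrier A; y \<in> carrier A\<rbrakk> \<Longrightarrow> star A (x \<ominus> y) = star A x \<ominus> star A y"
  by (simp add: diff_eq_smult star_add star_smult smult_closed star_closed)

lemma smult_diff: "\<lbrakk>x \<in> carrier A; y \<in> carrier A\<rbrakk> \<Longrightarrow> c \<odot> (x \<ominus> y) = c \<odot> x \<ominus> c \<odot> y"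
  by (simp add: diff_eq_smult smult_r_distr smult_closed smult_assoc[symmetric])

lemma mult_diff_left: "\<lbrakk>x \<in> carrier A; y \<in> carrier A; z \<in> carrier A\<rbrakk> \<Longrightarrow> (x \<ominus> y) \<otimes> z = x \<otimes> z \<ominus> y \<otimes> z"
  by (simp add: diff_eq_smult mult_l_distr smult_mult_left smult_closed mult_closed)

lemma mult_diff_right: "\<lbrakk>x \<in> carrier A; y \<in> carrier A; z \<in> carrier A\<rbrakk> \<Longrightarrow> z \<otimes> (x \<ominus> y) = z \<otimes> x \<ominus> z \<otimes> y"
  by (simp add: diff_eq_smult mult_r_distr smult_mult_right smult_closed mult_closed)

lemma diff_zero_iff: "\<lbrakk>x \<in> carrier A; y \<in> carrier A\<rbrakk> \<Longrightarrow> x \<ominus> y = \<zero> \<longleftrightarrow> x = y"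
  by (metis a_minus_def add.inv_closed minus_equality minus_minus r_neg)

lemma diff_add_diff:
  "\<lbrakk>x \<in> carrier A; y \<in> carrier A; z \<in> carrier A; w \<in> carrier A\<rbrakk> \<Longrightarrow>
     (x \<oplus> y) \<ominus> (z \<oplus> w) = (x \<ominus> z) \<oplus> (y \<ominus> w)"
  by (simp add: a_minus_def minus_add a_ac)

lemma diff_split:
  "\<lbrakk>x \<in> carrier A; y \<in> carrier A; z \<in> carrier A\<rbrakk> \<Longrightarrow> x \<ominus> z = (x \<ominus> y) \<oplus> (y \<ominus> z)"
  by (metis (no_types, lifting) a_minus_def add.inv_closed add.m_assoc add.m_closed l_neg l_zero)

lemma mult_diff_split:
  "\<lbrakk>x \<in> carrier A; y \<in> carrier A; z \<in> carrier A; w \<in> carrier A\<rbrakk> \<Longrightarrow>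
     x \<otimes> y \<ominus> z \<otimes> w = (x \<ominus> z) \<otimes> y \<oplus> z \<otimes> (y \<ominus> w)"
  by (simp add: mult_diff_left mult_diff_right diff_split[of "x \<otimes> y" "z \<otimes> y" "z \<otimes> w"] mult_closed)

end

context cstar_seminorm
begin

lemma seminorm_zero: "N \<zero> = 0"
  using seminorm_smult[of \<zero> 0] by (simp add: smult_zero_right)

lemma seminorm_uminus: "x \<in> carrier A \<Longrightarrow> N (\<ominus> x) = N x"
  by (simp add: minus_eq_smult seminorm_smult)

lemma seminorm_diff_commute: "\<lbrakk>x \<in> carrier A; y \<in> carrier A\<rbrakk> \<Longrightarrow> N (x \<ominus> y) = N (y \<ominus> x)"
  by (metis minus_closed minus_eq minus_minus minus_add a_comm add.inv_closed seminorm_uminus)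

lemma seminorm_diff: "\<lbrakk>x \<in> carrier A; y \<in> carrier A\<rbrakk> \<Longrightarrow> N (x \<ominus> y) \<le> N x + N y"
  by (metis a_inv_closed a_minus_def seminorm_add seminorm_uminus)

lemma seminorm_triangle:
  "\<lbrakk>x \<in> carrier A; y \<in> carrier A; z \<in> carrier A\<rbrakk> \<Longrightarrow> N (x \<ominus> z) \<le> N (x \<ominus> y) + N (y \<ominus> z)"
  by (metis diff_split minus_closed seminorm_add)

lemma seminorm_diff_abs: "\<lbrakk>x \<in> carrier A; y \<in> carrier A\<rbrakk> \<Longrightarrow> \<bar>N x - N y\<bar> \<le> N (x \<ominus> y)"
proof -
  assume x: "x \<in> carrier A" and y: "y \<in> carrier A"
  have 1: "u \<ominus> \<zero> = u" if "u \<in> carrier A" for u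
    using that by (simp add: a_minus_def)
  show ?thesis
    using seminorm_triangle[OF x y zero_closed] seminorm_triangle[OF y x zero_closed]
      seminorm_diff_commute[OF x y] 1 x y by auto
qed

lemma seminorm_adj: "x \<in> carrier A \<Longrightarrow> N (star A x) = N x"
proof -
  have *: "N x \<le> N (star A x)" if x: "x \<in> carrier A" for x
  proof (cases "N x = 0")
    case True
    then show ?thesis using seminorm_nonneg star_closed x by auto
  next
    case False
    have "(N x)\<^sup>2 \<le> N (star A x) * N x"
      using seminorm_star[OF x] seminorm_mult[OF star_closed[OF x] x] by simp
    then show ?thesis
      using False seminorm_nonneg[OF x] by (simp add: power2_eq_square)
  qed
  assume "x \<in> carrier A"
  then show ?thesis
    using *[of x] *[of "star A x"] by (simp add: star_closed star_star)
qed

lemma seminorm_finsum: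
  "finite F \<Longrightarrow> x \<in> F \<rightarrow> carrier A \<Longrightarrow> N (finsum A x F) \<le> (\<Sum>i\<in>F. N (x i))"
proof (induction F rule: finite_induct)
  case (insert i F)
  then have "N (x i \<oplus> finsum A x F) \<le> N (x i) + N (finsum A x F)"
    by (intro seminorm_add finsum_closed) auto
  then show ?case using insert by (simp add: Pi_iff)
qed (simp add: seminorm_zero)

end


section \<open>The completion is a C*-algebra\<close>

context cstar_seminorm
begin

abbreviation "CS \<equiv> cauchy_seqs A N"
abbreviation "NR \<equiv> null_rel A N"
abbreviation "HC \<equiv> hausdorff_completion A N"
abbreviation cls where "cls x \<equiv> NR `` {x}"

lemma cs_carrier: "x \<in> CS \<Longrightarrow> x n \<in> carrier A"
  by (auto simp: cauchy_seqs_def)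

lemma cs_cauchy: "\<lbrakk>x \<in> CS; \<epsilon> > 0\<rbrakk> \<Longrightarrow> \<exists>M. \<forall>m\<ge>M. \<forall>n\<ge>M. N (x m \<ominus> x n) < \<epsilon>"
  by (auto simp: cauchy_seqs_def)

lemma cs_const: "a \<in> carrier A \<Longrightarrow> (\<lambda>n. a) \<in> CS"
  by (auto simp: cauchy_seqs_def a_minus_def r_neg seminorm_zero)

lemma cs_norm_Cauchy: assumes "x \<in> CS" shows "convergent (\<lambda>n. N (x n))"
proof -
  have "Cauchy (\<lambda>n. N (x n))"
  proof (rule metric_CauchyI)
    fix e :: real assume "e > 0"
    from cs_cauchy[OF assms this] obtain M where "\<forall>m\<ge>M. \<forall>n\<ge>M. N (x m \<ominus> x n) < e" by blast
    then show "\<exists>M. \<forall>m\<ge>M. \<forall>n\<ge>M. dist (N (x m)) (N (x n)) < e"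
      using seminorm_diff_abs cs_carrier[OF assms] unfolding dist_real_def
      by (meson order.strict_trans1)
  qed
  then show ?thesis by (simp add: Cauchy_convergent_iff)
qed

lemma cs_bounded: assumes "x \<in> CS" shows "\<exists>B>0. \<forall>n. N (x n) \<le> B"
proof -
  have "Bseq (\<lambda>n. N (x n))" using cs_norm_Cauchy[OF assms] by (rule convergent_imp_Bseq)
  then obtain B where "B > 0" "\<forall>n. norm (N (x n)) \<le> B" unfolding Bseq_def by blast
  then show ?thesis by (intro exI[of _ B]) (auto simp: abs_le_iff)
qed

lemma cs_map:
  assumes x: "x \<in> CS" and f: "\<And>a. a \<in> carrier A \<Longrightarrow> f a \<in> carrier A"
    and K: "\<And>a b. \<lbrakk>a \<in> carrier A; b \<in> carrier A\<rbrakk> \<Longrightarrow> N (f a \<ominus> f b) \<le> K * N (a \<ominus> b)"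
  shows "(\<lambda>n. f (x n)) \<in> CS"
  unfolding cauchy_seqs_def
proof (intro CollectI conjI allI impI)
  show "range (\<lambda>n. f (x n)) \<subseteq> carrier A" using f cs_carrier[OF x] by auto
  fix e :: real assume "e > 0"
  then have "e / (\<bar>K\<bar> + 1) > 0" by simp
  from cs_cauchy[OF x this] obtain M where M: "\<And>m n. \<lbrakk>m \<ge> M; n \<ge> M\<rbrakk> \<Longrightarrow> N (x m \<ominus> x n) < e / (\<bar>K\<bar> + 1)"
    by blast
  show "\<exists>M. \<forall>m\<ge>M. \<forall>n\<ge>M. N (f (x m) \<ominus> f (x n)) < e"
  proof (intro exI allI impI)
    fix m n assume mn: "m \<ge> M" "n \<ge> M"
    have c: "x m \<in> carrier A" "x n \<in> carrier A" using cs_carrier[OF x] by auto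
    have "N (f (x m) \<ominus> f (x n)) \<le> K * N (x m \<ominus> x n)" by (rule K[OF c])
    also have "\<dots> \<le> (\<bar>K\<bar> + 1) * N (x m \<ominus> x n)"
      using c by (intro mult_right_mono seminorm_nonneg) auto
    also have "\<dots> < e" using M[OF mn] by (simp add: field_simps)
    finally show "N (f (x m) \<ominus> f (x n)) < e" .
  qed
qed

lemma cs_smult: "x \<in> CS \<Longrightarrow> (\<lambda>n. c \<odot> x n) \<in> CS"
  by (rule cs_map[where K = "cmod c"]) (auto simp: smult_closed smult_diff[symmetric] seminorm_smult)

lemma cs_star: "x \<in> CS \<Longrightarrow> (\<lambda>n. star A (x n)) \<in> CS"
  by (rule cs_map[where K = 1]) (auto simp: star_closed star_diff[symmetric] seminorm_adj)

lemma cs_add: assumes x: "x \<in> CS" and y: "y \<in> CS" shows "(\<lambda>n. x n \<oplus> y n) \<in> CS"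
  unfolding cauchy_seqs_def
proof (intro CollectI conjI allI impI)
  show "range (\<lambda>n. x n \<oplus> y n) \<subseteq> carrier A" using cs_carrier x y by auto
  fix e :: real assume "e > 0"
  then have e: "e / 2 > 0" by simp
  obtain M1 M2 where M: "\<And>m n. \<lbrakk>m \<ge> M1; n \<ge> M1\<rbrakk> \<Longrightarrow> N (x m \<ominus> x n) < e / 2"
    "\<And>m n. \<lbrakk>m \<ge> M2; n \<ge> M2\<rbrakk> \<Longrightarrow> N (y m \<ominus> y n) < e / 2"
    using cs_cauchy[OF x e] cs_cauchy[OF y e] by blast
  show "\<exists>M. \<forall>m\<ge>M. \<forall>n\<ge>M. N ((x m \<oplus> y m) \<ominus> (x n \<oplus> y n)) < e"
  proof (intro exI[of _ "max M1 M2"] allI impI)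
    fix m n assume mn: "max M1 M2 \<le> m" "max M1 M2 \<le> n"
    have c: "x m \<in> carrier A" "x n \<in> carrier A" "y m \<in> carrier A" "y n \<in> carrier A"
      using cs_carrier x y by auto
    have "N ((x m \<oplus> y m) \<ominus> (x n \<oplus> y n)) \<le> N (x m \<ominus> x n) + N (y m \<ominus> y n)"
      using c by (simp add: diff_add_diff seminorm_add)
    also have "\<dots> < e" using M(1)[of m n] M(2)[of m n] mn by simp
    finally show "N ((x m \<oplus> y m) \<ominus> (x n \<oplus> y n)) < e" .
  qed
qed

lemma cs_mult: assumes x: "x \<in> CS" and y: "y \<in> CS" shows "(\<lambda>n. x n \<otimes> y n) \<in> CS"
  unfolding cauchy_seqs_def
proof (intro CollectI conjI allI impI)
  show "range (\<lambda>n. x n \<otimes> y n) \<subseteq> carrier A" using cs_carrier x y mult_closed by auto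
  obtain B C where B: "B > 0" "\<And>n. N (x n) \<le> B" and C: "C > 0" "\<And>n. N (y n) \<le> C"
    using cs_bounded x y by meson
  fix e :: real assume "e > 0"
  then have e: "e / (2 * C) > 0" "e / (2 * B) > 0" using B C by auto
  obtain M1 M2 where M: "\<And>m n. \<lbrakk>m \<ge> M1; n \<ge> M1\<rbrakk> \<Longrightarrow> N (x m \<ominus> x n) < e / (2 * C)"
    "\<And>m n. \<lbrakk>m \<ge> M2; n \<ge> M2\<rbrakk> \<Longrightarrow> N (y m \<ominus> y n) < e / (2 * B)"
    using cs_cauchy[OF x e(1)] cs_cauchy[OF y e(2)] by blast
  show "\<exists>M. \<forall>m\<ge>M. \<forall>n\<ge>M. N (x m \<otimes> y m \<ominus> x n \<otimes> y n) < e"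
  proof (intro exI[of _ "max M1 M2"] allI impI)
    fix m n assume mn: "max M1 M2 \<le> m" "max M1 M2 \<le> n"
    have c: "x m \<in> carrier A" "x n \<in> carrier A" "y m \<in> carrier A" "y n \<in> carrier A"
      using cs_carrier x y by auto
    have "N (x m \<otimes> y m \<ominus> x n \<otimes> y n) \<le> N ((x m \<ominus> x n) \<otimes> y m) + N (x n \<otimes> (y m \<ominus> y n))"
      using c by (subst mult_diff_split) (auto intro!: seminorm_add mult_closed)
    also have "\<dots> \<le> N (x m \<ominus> x n) * N (y m) + N (x n) * N (y m \<ominus> y n)"
      using c by (intro add_mono seminorm_mult) auto
    also have "\<dots> \<le> N (x m \<ominus> x n) * C + B * N (y m \<ominus> y n)"
      using c B C by (intro add_mono mult_left_mono mult_right_mono seminorm_nonneg) auto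
    also have "\<dots> < e / (2 * C) * C + B * (e / (2 * B))"
      using M(1)[of m n] M(2)[of m n] mn B C
      by (intro add_strict_mono mult_strict_right_mono mult_strict_left_mono) auto
    also have "\<dots> = e" using B C by simp
    finally show "N (x m \<otimes> y m \<ominus> x n \<otimes> y n) < e" .
  qed
qed

lemma NR_iff: "(x, y) \<in> NR \<longleftrightarrow> x \<in> CS \<and> y \<in> CS \<and> (\<lambda>n. N (x n \<ominus> y n)) \<longlonglongrightarrow> 0"
  by (auto simp: null_rel_def)

lemma NR_boundI:
  assumes "x \<in> CS" "y \<in> CS" "\<And>n. N (x n \<ominus> y n) \<le> f n" "f \<longlonglongrightarrow> 0"
  shows "(x, y) \<in> NR"
  unfolding NR_iff using assms
  by (auto intro!: tendsto_sandwich[OF _ _ tendsto_const[of 0] assms(4)] always_eventually seminorm_nonneg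
      simp: cs_carrier)

lemma NR_equiv: "equiv CS NR"
proof (rule equivI)
  show "NR \<subseteq> CS \<times> CS" by (auto simp: NR_iff)
  show "refl_on CS NR"
    by (rule refl_onI) (auto simp: NR_iff a_minus_def r_neg seminorm_zero cs_carrier)
  show "sym NR"
    by (rule symI) (auto simp: NR_iff cs_carrier seminorm_diff_commute)
  show "trans NR"
  proof (rule transI)
    fix x y z assume xy: "(x, y) \<in> NR" and yz: "(y, z) \<in> NR"
    show "(x, z) \<in> NR"
    proof (rule NR_boundI)
      show "N (x n \<ominus> z n) \<le> N (x n \<ominus> y n) + N (y n \<ominus> z n)" for n
        using xy yz by (intro seminorm_triangle) (auto simp: NR_iff cs_carrier)
      show "(\<lambda>n. N (x n \<ominus> y n) + N (y n \<ominus> z n)) \<longlonglongrightarrow> 0"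
        using tendsto_add[of _ 0 _ _ 0] xy yz by (fastforce simp: NR_iff)
    qed (use xy yz in \<open>auto simp: NR_iff\<close>)
  qed
qed

lemma HC_carrierE: assumes "X \<in> carrier HC" obtains x where "x \<in> CS" "X = cls x"
  using assms by (auto simp: hausdorff_completion_def elim: quotientE)

lemma cls_carrier: "x \<in> CS \<Longrightarrow> cls x \<in> carrier HC"
  by (auto simp: hausdorff_completion_def intro: quotientI)

lemma cls_eq_iff: "\<lbrakk>x \<in> CS; y \<in> CS\<rbrakk> \<Longrightarrow> cls x = cls y \<longleftrightarrow> (\<lambda>n. N (x n \<ominus> y n)) \<longlonglongrightarrow> 0"
  by (simp add: eq_equiv_class_iff[OF NR_equiv] NR_iff)

lemma NR_add: "\<lbrakk>(x, x') \<in> NR; (y, y') \<in> NR\<rbrakk> \<Longrightarrow> (\<lambda>n. x n \<oplus> y n, \<lambda>n. x' n \<oplus> y' n) \<in> NR"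
proof (rule NR_boundI)
  assume a: "(x, x') \<in> NR" "(y, y') \<in> NR"
  show "(\<lambda>n. x n \<oplus> y n) \<in> CS" "(\<lambda>n. x' n \<oplus> y' n) \<in> CS" using a by (auto simp: NR_iff cs_add)
  show "N ((x n \<oplus> y n) \<ominus> (x' n \<oplus> y' n)) \<le> N (x n \<ominus> x' n) + N (y n \<ominus> y' n)" for n
    using a by (subst diff_add_diff) (auto simp: NR_iff cs_carrier intro!: seminorm_add)
  show "(\<lambda>n. N (x n \<ominus> x' n) + N (y n \<ominus> y' n)) \<longlonglongrightarrow> 0"
    using tendsto_add[of _ 0 _ _ 0] a by (fastforce simp: NR_iff)
qed

lemma NR_mult: "\<lbrakk>(x, x') \<in> NR; (y, y') \<in> NR\<rbrakk> \<Longrightarrow> (\<lambda>n. x n \<otimes> y n, \<lambda>n. x' n \<otimes> y' n) \<in> NR"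
proof -
  assume a: "(x, x') \<in> NR" "(y, y') \<in> NR"
  have cs: "x \<in> CS" "x' \<in> CS" "y \<in> CS" "y' \<in> CS" using a by (auto simp: NR_iff)
  obtain B C where B: "B > 0" "\<And>n. N (x' n) \<le> B" and C: "C > 0" "\<And>n. N (y n) \<le> C"
    using cs_bounded cs by meson
  show ?thesis
  proof (rule NR_boundI)
    show "(\<lambda>n. x n \<otimes> y n) \<in> CS" "(\<lambda>n. x' n \<otimes> y' n) \<in> CS" using cs by (auto simp: cs_mult)
    show "N (x n \<otimes> y n \<ominus> x' n \<otimes> y' n) \<le> N (x n \<ominus> x' n) * C + B * N (y n \<ominus> y' n)" for n
    proof -
      have c: "x n \<in> carrier A" "x' n \<in> carrier A" "y n \<in> carrier A" "y' n \<in> carrier A"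
        using cs cs_carrier by auto
      have "N (x n \<otimes> y n \<ominus> x' n \<otimes> y' n) \<le> N ((x n \<ominus> x' n) \<otimes> y n) + N (x' n \<otimes> (y n \<ominus> y' n))"
        using c by (subst mult_diff_split) (auto intro!: seminorm_add mult_closed)
      also have "\<dots> \<le> N (x n \<ominus> x' n) * N (y n) + N (x' n) * N (y n \<ominus> y' n)"
        using c by (intro add_mono seminorm_mult) auto
      also have "\<dots> \<le> N (x n \<ominus> x' n) * C + B * N (y n \<ominus> y' n)"
        using c B C by (intro add_mono mult_left_mono mult_right_mono seminorm_nonneg) auto
      finally show ?thesis .
    qed
    have "(\<lambda>n. N (x n \<ominus> x' n) * C + B * N (y n \<ominus> y' n)) \<longlonglongrightarrow> 0 * C + B * 0"
      using a by (intro tendsto_intros) (auto simp: NR_iff)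
    then show "(\<lambda>n. N (x n \<ominus> x' n) * C + B * N (y n \<ominus> y' n)) \<longlonglongrightarrow> 0" by simp
  qed
qed

lemma NR_smult: "(x, x') \<in> NR \<Longrightarrow> (\<lambda>n. c \<odot> x n, \<lambda>n. c \<odot> x' n) \<in> NR"
  by (auto simp: NR_iff cs_smult smult_diff[symmetric] cs_carrier seminorm_smult tendsto_mult_right_zero)

lemma NR_star: "(x, x') \<in> NR \<Longrightarrow> (\<lambda>n. star A (x n), \<lambda>n. star A (x' n)) \<in> NR"
  by (auto simp: NR_iff cs_star star_diff[symmetric] cs_carrier seminorm_adj)

lemma HC_add: assumes "x \<in> CS" "y \<in> CS" shows "cls x \<oplus>\<^bsub>HC\<^esub> cls y = cls (\<lambda>n. x n \<oplus> y n)"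
proof -
  have "congruent2 NR NR (\<lambda>x y. cls (\<lambda>n. x n \<oplus> y n))"
    by (rule congruent2I', rule equiv_class_eq[OF NR_equiv], rule NR_add)
  from UN_equiv_class2[OF NR_equiv NR_equiv this assms] show ?thesis
    by (simp add: hausdorff_completion_def)
qed

lemma HC_mult: assumes "x \<in> CS" "y \<in> CS" shows "cls x \<otimes>\<^bsub>HC\<^esub> cls y = cls (\<lambda>n. x n \<otimes> y n)"
proof -
  have "congruent2 NR NR (\<lambda>x y. cls (\<lambda>n. x n \<otimes> y n))"
    by (rule congruent2I', rule equiv_class_eq[OF NR_equiv], rule NR_mult)
  from UN_equiv_class2[OF NR_equiv NR_equiv this assms] show ?thesis
    by (simp add: hausdorff_completion_def)
qed

lemma HC_smult: assumes "x \<in> CS" shows "c \<odot>\<^bsub>HC\<^esub> cls x = cls (\<lambda>n. c \<odot> x n)"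
proof -
  have "congruent NR (\<lambda>x. cls (\<lambda>n. c \<odot> x n))"
    by (rule congruentI, rule equiv_class_eq[OF NR_equiv], rule NR_smult)
  from UN_equiv_class[OF NR_equiv this assms] show ?thesis
    by (simp add: hausdorff_completion_def)
qed

lemma HC_star: assumes "x \<in> CS" shows "star HC (cls x) = cls (\<lambda>n. star A (x n))"
proof -
  have "congruent NR (\<lambda>x. cls (\<lambda>n. star A (x n)))"
    by (rule congruentI, rule equiv_class_eq[OF NR_equiv], rule NR_star)
  from UN_equiv_class[OF NR_equiv this assms] show ?thesis
    by (simp add: hausdorff_completion_def)
qed

lemma HC_zero: "\<zero>\<^bsub>HC\<^esub> = cls (\<lambda>n. \<zero>)"
  by (simp add: hausdorff_completion_def)

lemma HC_norm: assumes x: "x \<in> CS" shows "(\<lambda>n. N (x n)) \<longlonglongrightarrow> cnorm HC (cls x)"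
proof -
  obtain r where r: "(\<lambda>n. N (x n)) \<longlonglongrightarrow> r"
    using cs_norm_Cauchy[OF x] by (auto simp: convergent_def)
  have *: "(\<lambda>n. N (y n)) \<longlonglongrightarrow> r" if "y \<in> cls x" for y
  proof -
    from that have xy: "(x, y) \<in> NR" by auto
    have "(\<lambda>n. N (y n) - N (x n)) \<longlonglongrightarrow> 0"
    proof (rule tendsto_rabs_zero_cancel, rule tendsto_sandwich[OF _ _ tendsto_const])
      show "(\<lambda>n. N (x n \<ominus> y n)) \<longlonglongrightarrow> 0" using xy by (simp add: NR_iff)
      show "\<forall>\<^sub>F n in sequentially. \<bar>N (y n) - N (x n)\<bar> \<le> N (x n \<ominus> y n)"
        using xy seminorm_diff_abs by (auto intro!: always_eventually simp: NR_iff cs_carrier abs_minus_commute)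
    qed auto
    from tendsto_add[OF this r] show ?thesis by simp
  qed
  have mem: "x \<in> cls x" using NR_equiv x by (rule equiv_class_self)
  have "cnorm HC (cls x) = (THE r. \<forall>y\<in>cls x. (\<lambda>n. N (y n)) \<longlonglongrightarrow> r)"
    by (simp add: hausdorff_completion_def)
  also have "\<dots> = r"
  proof (rule the_equality)
    show "\<forall>y\<in>cls x. (\<lambda>n. N (y n)) \<longlonglongrightarrow> r" using * by blast
    show "s = r" if "\<forall>y\<in>cls x. (\<lambda>n. N (y n)) \<longlonglongrightarrow> s" for s
      using that mem r LIMSEQ_unique by blast
  qed
  finally show ?thesis using r by simp
qed

lemma HC_norm_eqI: "\<lbrakk>x \<in> CS; (\<lambda>n. N (x n)) \<longlonglongrightarrow> r\<rbrakk> \<Longrightarrow> cnorm HC (cls x) = r"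
  using HC_norm LIMSEQ_unique by blast

lemma abelian_group_HC: "abelian_group HC"
proof (rule abelian_groupI)
  fix X Y Z
  assume "X \<in> carrier HC" "Y \<in> carrier HC" "Z \<in> carrier HC"
  then obtain x y z where "x \<in> CS" "X = cls x" "y \<in> CS" "Y = cls y" "z \<in> CS" "Z = cls z"
    by (metis HC_carrierE)
  then show "X \<oplus>\<^bsub>HC\<^esub> Y \<in> carrier HC" "X \<oplus>\<^bsub>HC\<^esub> Y \<oplus>\<^bsub>HC\<^esub> Z = X \<oplus>\<^bsub>HC\<^esub> (Y \<oplus>\<^bsub>HC\<^esub> Z)"
    "X \<oplus>\<^bsub>HC\<^esub> Y = Y \<oplus>\<^bsub>HC\<^esub> X"
    by (simp_all add: HC_add cs_add cls_carrier a_ac cs_carrier)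
next
  show "\<zero>\<^bsub>HC\<^esub> \<in> carrier HC" by (simp add: HC_zero cls_carrier cs_const)
next
  fix X assume "X \<in> carrier HC"
  then obtain x where x: "x \<in> CS" "X = cls x" by (metis HC_carrierE)
  then show "\<zero>\<^bsub>HC\<^esub> \<oplus>\<^bsub>HC\<^esub> X = X" by (simp add: HC_zero HC_add cs_const cs_carrier)
  have "cls (\<lambda>n. (-1) \<odot> x n) \<oplus>\<^bsub>HC\<^esub> X = \<zero>\<^bsub>HC\<^esub>"
    using x by (simp add: HC_zero HC_add cs_smult)
      (simp add: cs_carrier minus_eq_smult[symmetric] l_neg)
  then show "\<exists>Y\<in>carrier HC. Y \<oplus>\<^bsub>HC\<^esub> X = \<zero>\<^bsub>HC\<^esub>"
    using x by (intro bexI[of _ "cls (\<lambda>n. (-1) \<odot> x n)"]) (auto simp: cls_carrier cs_smult)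
qed

lemma star_algebra_HC: "star_algebra HC"
proof (rule star_algebra.intro[OF abelian_group_HC], unfold_locales)
  fix X Y Z and c d :: complex
  assume XYZ: "X \<in> carrier HC" "Y \<in> carrier HC" "Z \<in> carrier HC"
  then obtain x y z where xyz: "x \<in> CS" "X = cls x" "y \<in> CS" "Y = cls y" "z \<in> CS" "Z = cls z"
    by (metis HC_carrierE)
  note ops = HC_add HC_mult HC_smult HC_star cs_add cs_mult cs_smult cs_star cls_carrier cs_carrier
  show "X \<otimes>\<^bsub>HC\<^esub> Y \<otimes>\<^bsub>HC\<^esub> Z = X \<otimes>\<^bsub>HC\<^esub> (Y \<otimes>\<^bsub>HC\<^esub> Z)"
    "(X \<oplus>\<^bsub>HC\<^esub> Y) \<otimes>\<^bsub>HC\<^esub> Z = X \<otimes>\<^bsub>HC\<^esub> Z \<oplus>\<^bsub>HC\<^esub> Y \<otimes>\<^bsub>HC\<^esub> Z"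
    "Z \<otimes>\<^bsub>HC\<^esub> (X \<oplus>\<^bsub>HC\<^esub> Y) = Z \<otimes>\<^bsub>HC\<^esub> X \<oplus>\<^bsub>HC\<^esub> Z \<otimes>\<^bsub>HC\<^esub> Y"
    using xyz by (simp_all add: ops mult_assoc mult_l_distr mult_r_distr)
next
  fix X Y and c d :: complex
  assume XYZ: "X \<in> carrier HC" "Y \<in> carrier HC"
  then obtain x y where xyz: "x \<in> CS" "X = cls x" "y \<in> CS" "Y = cls y"
    by (metis HC_carrierE)
  note ops = HC_add HC_mult HC_smult HC_star cs_add cs_mult cs_smult cs_star cls_carrier cs_carrier
  show "c \<odot>\<^bsub>HC\<^esub> (X \<oplus>\<^bsub>HC\<^esub> Y) = c \<odot>\<^bsub>HC\<^esub> X \<oplus>\<^bsub>HC\<^esub> c \<odot>\<^bsub>HC\<^esub> Y"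
    "X \<otimes>\<^bsub>HC\<^esub> Y \<in> carrier HC"
    "(c \<odot>\<^bsub>HC\<^esub> X) \<otimes>\<^bsub>HC\<^esub> Y = c \<odot>\<^bsub>HC\<^esub> (X \<otimes>\<^bsub>HC\<^esub> Y)"
    "X \<otimes>\<^bsub>HC\<^esub> (c \<odot>\<^bsub>HC\<^esub> Y) = c \<odot>\<^bsub>HC\<^esub> (X \<otimes>\<^bsub>HC\<^esub> Y)"
    "star HC (X \<oplus>\<^bsub>HC\<^esub> Y) = star HC X \<oplus>\<^bsub>HC\<^esub> star HC Y"
    "star HC (X \<otimes>\<^bsub>HC\<^esub> Y) = star HC Y \<otimes>\<^bsub>HC\<^esub> star HC X"
    using xyz by (simp_all add: ops smult_r_distr smult_mult_left smult_mult_right star_add star_mult)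
next
  fix X and c d :: complex
  assume XYZ: "X \<in> carrier HC"
  then obtain x where xyz: "x \<in> CS" "X = cls x"
    by (metis HC_carrierE)
  note ops = HC_add HC_mult HC_smult HC_star cs_add cs_mult cs_smult cs_star cls_carrier cs_carrier
  show "c \<odot>\<^bsub>HC\<^esub> X \<in> carrier HC"
    "(c + d) \<odot>\<^bsub>HC\<^esub> X = c \<odot>\<^bsub>HC\<^esub> X \<oplus>\<^bsub>HC\<^esub> d \<odot>\<^bsub>HC\<^esub> X"
    "(c * d) \<odot>\<^bsub>HC\<^esub> X = c \<odot>\<^bsub>HC\<^esub> (d \<odot>\<^bsub>HC\<^esub> X)"
    "1 \<odot>\<^bsub>HC\<^esub> X = X" "star HC X \<in> carrier HC" "star HC (star HC X) = X"
    "star HC (c \<odot>\<^bsub>HC\<^esub> X) = cnj c \<odot>\<^bsub>HC\<^esub> star HC X"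
    using xyz by (simp_all add: ops smult_l_distr smult_assoc smult_one star_star star_smult)
qed

lemma cstar_seminorm_HC: "cstar_seminorm HC (cnorm HC)"
proof (rule cstar_seminorm.intro[OF star_algebra_HC], unfold_locales)
  fix X Y and c :: complex
  assume "X \<in> carrier HC" "Y \<in> carrier HC"
  then obtain x y where xyz: "x \<in> CS" "X = cls x" "y \<in> CS" "Y = cls y"
    by (metis HC_carrierE)
  note lims = HC_norm[OF xyz(1)] HC_norm[OF xyz(3)]
  have "cnorm HC (cls (\<lambda>n. x n \<oplus> y n)) \<le> cnorm HC (cls x) + cnorm HC (cls y)"
    by (rule LIMSEQ_le[OF HC_norm tendsto_add[OF lims]])
      (use xyz in \<open>auto intro!: exI[of _ 0] seminorm_add cs_add cs_carrier\<close>)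
  then show "cnorm HC (X \<oplus>\<^bsub>HC\<^esub> Y) \<le> cnorm HC X + cnorm HC Y"
    using xyz by (simp add: HC_add)
  have "cnorm HC (cls (\<lambda>n. x n \<otimes> y n)) \<le> cnorm HC (cls x) * cnorm HC (cls y)"
    by (rule LIMSEQ_le[OF HC_norm tendsto_mult[OF lims]])
      (use xyz in \<open>auto intro!: exI[of _ 0] seminorm_mult cs_mult cs_carrier\<close>)
  then show "cnorm HC (X \<otimes>\<^bsub>HC\<^esub> Y) \<le> cnorm HC X * cnorm HC Y"
    using xyz by (simp add: HC_mult)
next
  fix X and c :: complex
  assume "X \<in> carrier HC"
  then obtain x where xyz: "x \<in> CS" "X = cls x"
    by (metis HC_carrierE)
  note lims = HC_norm[OF xyz(1)]
  show "0 \<le> cnorm HC X"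
    using xyz by (auto intro!: LIMSEQ_le_const[OF lims] seminorm_nonneg cs_carrier)
  have "cnorm HC (cls (\<lambda>n. c \<odot> x n)) = cmod c * cnorm HC (cls x)"
    by (rule HC_norm_eqI) (use xyz lims in \<open>auto simp: cs_smult seminorm_smult cs_carrier intro!: tendsto_mult_left\<close>)
  then show "cnorm HC (c \<odot>\<^bsub>HC\<^esub> X) = cmod c * cnorm HC X"
    using xyz by (simp add: HC_smult)
  have "cnorm HC (cls (\<lambda>n. star A (x n) \<otimes> x n)) = (cnorm HC (cls x))\<^sup>2"
    by (rule HC_norm_eqI) (use xyz lims in \<open>auto simp: cs_mult cs_star seminorm_star cs_carrier intro!: tendsto_power\<close>)
  then show "cnorm HC (star HC X \<otimes>\<^bsub>HC\<^esub> X) = (cnorm HC X)\<^sup>2"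
    using xyz by (simp add: HC_star HC_mult cs_star)
qed

lemma HC_diff: "\<lbrakk>x \<in> CS; y \<in> CS\<rbrakk> \<Longrightarrow> cls x \<ominus>\<^bsub>HC\<^esub> cls y = cls (\<lambda>n. x n \<ominus> y n)"
  by (simp add: star_algebra.diff_eq_smult[OF star_algebra_HC] cls_carrier HC_smult HC_add cs_smult
      diff_eq_smult cs_carrier)

lemma cs_diff: "\<lbrakk>x \<in> CS; y \<in> CS\<rbrakk> \<Longrightarrow> (\<lambda>n. x n \<ominus> y n) \<in> CS"
  using cs_add[OF _ cs_smult[of y "-1"], of x] by (simp add: diff_eq_smult cs_carrier)

lemma HC_norm_zero: "\<lbrakk>X \<in> carrier HC; cnorm HC X = 0\<rbrakk> \<Longrightarrow> X = \<zero>\<^bsub>HC\<^esub>"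
proof -
  assume X: "X \<in> carrier HC" "cnorm HC X = 0"
  then obtain x where x: "x \<in> CS" "X = cls x" by (metis HC_carrierE)
  then have "(\<lambda>n. N (x n)) \<longlonglongrightarrow> 0" using HC_norm[of x] X by simp
  then show ?thesis
    using x by (simp add: HC_zero cls_eq_iff cs_const diff_eq_smult smult_zero_right cs_carrier)
qed

lemma completion_embed_carrier: "a \<in> carrier A \<Longrightarrow> completion_embed A N a \<in> carrier HC"
  by (simp add: completion_embed_def cls_carrier cs_const)

lemma completion_embed_norm: "a \<in> carrier A \<Longrightarrow> cnorm HC (completion_embed A N a) = N a"
  by (simp add: completion_embed_def HC_norm_eqI cs_const)

lemma completion_embed_diff:
  "\<lbrakk>a \<in> carrier A; b \<in> carrier A\<rbrakk> \<Longrightarrow>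
    completion_embed A N a \<ominus>\<^bsub>HC\<^esub> completion_embed A N b = completion_embed A N (a \<ominus> b)"
  by (simp add: completion_embed_def HC_diff cs_const)

lemma completion_embed_hom: "completion_embed A N \<in> star_hom A HC"
  by (auto simp: star_hom_def completion_embed_carrier)
    (simp_all add: completion_embed_def HC_add HC_smult HC_mult HC_star cs_const)

lemma cs_tendsto: assumes "x \<in> CS"
  shows "(\<lambda>k. cdist HC (cls x) (completion_embed A N (x k))) \<longlonglongrightarrow> 0"
proof (rule LIMSEQ_I)
  fix e :: real assume e: "e > 0"
  then obtain M where M: "\<And>m n. \<lbrakk>m \<ge> M; n \<ge> M\<rbrakk> \<Longrightarrow> N (x m \<ominus> x n) < e / 2"
    using cs_cauchy[OF assms, of "e/2"] by auto
  show "\<exists>no. \<forall>k\<ge>no. norm (cdist HC (cls x) (completion_embed A N (x k)) - 0) < e"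
  proof (intro exI[of _ M] allI impI)
    fix k assume k: "k \<ge> M"
    have cs: "(\<lambda>n. x n \<ominus> x k) \<in> CS" by (intro cs_diff cs_const assms cs_carrier)
    have "cdist HC (cls x) (completion_embed A N (x k)) = cnorm HC (cls (\<lambda>n. x n \<ominus> x k))"
      using assms by (simp add: cdist_def completion_embed_def HC_diff cs_const cs_carrier cls_carrier)
    moreover have "0 \<le> cnorm HC (cls (\<lambda>n. x n \<ominus> x k))"
      using cstar_seminorm.seminorm_nonneg[OF cstar_seminorm_HC] cs cls_carrier by blast
    moreover have "cnorm HC (cls (\<lambda>n. x n \<ominus> x k)) \<le> e / 2"
      by (rule LIMSEQ_le_const2[OF HC_norm[OF cs]]) (use M k in \<open>auto intro!: exI[of _ M] less_imp_le\<close>)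
    ultimately show "norm (cdist HC (cls x) (completion_embed A N (x k)) - 0) < e" using e by simp
  qed
qed

lemma completion_dense:
  assumes "X \<in> carrier HC" "e > 0"
  shows "\<exists>a\<in>carrier A. cdist HC X (completion_embed A N a) < e"
proof -
  obtain x where x: "x \<in> CS" "X = cls x" using assms by (metis HC_carrierE)
  have "\<forall>\<^sub>F k in sequentially. cdist HC X (completion_embed A N (x k)) < e"
    using order_tendstoD(2)[OF cs_tendsto[OF x(1)] assms(2)] x by simp
  then obtain k where "cdist HC X (completion_embed A N (x k)) < e"
    unfolding eventually_sequentially by blast
  then show ?thesis using cs_carrier[OF x(1)] by blast
qed

end

lemma Metric_space_cdist:
  assumes "cstar_seminorm A (cnorm A)"
    and z: "\<And>x. \<lbrakk>x \<in> carrier A; cnorm A x = 0\<rbrakk> \<Longrightarrow> x = \<zero>\<^bsub>A\<^esub>"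
  shows "Metric_space (carrier A) (cdist A)"
proof -
  interpret cstar_seminorm A "cnorm A" by fact
  show ?thesis
  proof
    show "0 \<le> cdist A x y" "cdist A x y = cdist A y x" for x y
      by (auto simp: cdist_def seminorm_nonneg seminorm_diff_commute)
    show "cdist A x y = 0 \<longleftrightarrow> x = y" if "x \<in> carrier A" "y \<in> carrier A" for x y
      using that z[of "x \<ominus>\<^bsub>A\<^esub> y"] diff_zero_iff[of x y] by (auto simp: cdist_def seminorm_zero)
    show "cdist A x w \<le> cdist A x y + cdist A y w"
      if "x \<in> carrier A" "y \<in> carrier A" "w \<in> carrier A" for x y w
      using that by (simp add: cdist_def seminorm_triangle)
  qed
qed

lemma (in cstar_algebra) Metric_space: "Metric_space (carrier A) (cdist A)"
  by (rule Metric_space_cdist[OF cstar_seminorm_axioms norm_eq_0])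

context cstar_seminorm
begin

theorem cstar_algebra_HC: "cstar_algebra HC"
proof -
  interpret H: cstar_seminorm HC "cnorm HC" by (rule cstar_seminorm_HC)
  interpret M: Metric_space "carrier HC" "cdist HC"
    by (rule Metric_space_cdist[OF cstar_seminorm_HC HC_norm_zero])
  let ?j = "completion_embed A N"
  have "M.mcomplete"
    unfolding M.mcomplete_def
  proof (intro allI impI)
    fix X assume X: "M.MCauchy X"
    have Xc: "X k \<in> carrier HC" for k using X by (auto simp: M.MCauchy_def)
    have "\<exists>a\<in>carrier A. cdist HC (X k) (?j a) < 1 / real (Suc k)" for k
      by (rule completion_dense[OF Xc]) simp
    then obtain a where a: "\<And>k. a k \<in> carrier A" "\<And>k. cdist HC (X k) (?j (a k)) < 1 / real (Suc k)"
      by metis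
    have j: "?j (a k) \<in> carrier HC" for k using a completion_embed_carrier by blast
    have lim0: "(\<lambda>k. 1 / real (Suc k)) \<longlonglongrightarrow> 0" by (rule LIMSEQ_inverse_real_of_nat[unfolded inverse_eq_divide])
    have aCS: "a \<in> CS"
      unfolding cauchy_seqs_def
    proof (intro CollectI conjI allI impI)
      show "range a \<subseteq> carrier A" using a by auto
      fix e :: real assume e: "e > 0"
      then obtain M1 where M1: "\<And>m n. \<lbrakk>m \<ge> M1; n \<ge> M1\<rbrakk> \<Longrightarrow> cdist HC (X m) (X n) < e / 3"
        using X unfolding M.MCauchy_def by (metis divide_pos_pos zero_less_numeral)
      obtain M2 where M2: "\<And>k. k \<ge> M2 \<Longrightarrow> 1 / real (Suc k) < e / 3"
        using order_tendstoD(2)[OF lim0, of "e/3"] e by (auto simp: eventually_sequentially)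
      show "\<exists>M. \<forall>m\<ge>M. \<forall>n\<ge>M. N (a m \<ominus> a n) < e"
      proof (intro exI[of _ "max M1 M2"] allI impI)
        fix m n assume mn: "max M1 M2 \<le> m" "max M1 M2 \<le> n"
        have "N (a m \<ominus> a n) = cdist HC (?j (a m)) (?j (a n))"
          using a j by (simp add: cdist_def completion_embed_diff completion_embed_norm)
        also have "\<dots> \<le> cdist HC (?j (a m)) (X m) + cdist HC (X m) (?j (a n))"
          by (rule M.triangle) (auto simp: j Xc)
        also have "cdist HC (X m) (?j (a n)) \<le> cdist HC (X m) (X n) + cdist HC (X n) (?j (a n))"
          by (rule M.triangle) (auto simp: j Xc)
        finally show "N (a m \<ominus> a n) < e"
          using a(2)[of m] a(2)[of n] M1[of m n] M2[of m] M2[of n] mn M.commute[of "?j (a m)" "X m"]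
          by simp
      qed
    qed
    have "(\<lambda>k. cdist HC (X k) (cls a)) \<longlonglongrightarrow> 0"
    proof (rule tendsto_sandwich[OF _ _ tendsto_const])
      show "\<forall>\<^sub>F k in sequentially. cdist HC (X k) (cls a) \<le> 1 / real (Suc k) + cdist HC (cls a) (?j (a k))"
      proof (rule always_eventually, rule allI)
        fix k
        have "cdist HC (X k) (cls a) \<le> cdist HC (X k) (?j (a k)) + cdist HC (?j (a k)) (cls a)"
          by (rule M.triangle) (auto simp: j Xc cls_carrier aCS)
        then show "cdist HC (X k) (cls a) \<le> 1 / real (Suc k) + cdist HC (cls a) (?j (a k))"
          using a(2)[of k] M.commute[of "cls a" "?j (a k)"] by simp
      qed
      show "(\<lambda>k. 1 / real (Suc k) + cdist HC (cls a) (?j (a k))) \<longlonglongrightarrow> 0"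
        using tendsto_add[OF lim0 cs_tendsto[OF aCS]] by simp
    qed auto
    then have "limitin M.mtopology X (cls a) sequentially"
      using aCS Xc by (auto simp: M.limitin_metric_dist_null cls_carrier)
    then show "\<exists>x. limitin M.mtopology X x sequentially" ..
  qed
  then show ?thesis
    by (intro cstar_algebra.intro cstar_seminorm_HC cstar_algebra_axioms.intro HC_norm_zero)
qed

end


section \<open>The free star-algebra and the universal seminorm\<close>

definition gen_words :: "'g set \<Rightarrow> 'g star_word set" where
  "gen_words X = {w. letters w \<noteq> [] \<and> fst ` set (letters w) \<subseteq> X}"

lemma free_carrier: "carrier (free_star_algebra X) = {f. Poly_Mapping.keys f \<subseteq> gen_words X}"
  by (auto simp: free_star_algebra_def gen_words_def)

lemma free_ops [simp]:
  "mult (free_star_algebra X) = (*)" "zero (free_star_algebra X) = 0" "add (free_star_algebra X) = (+)"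
  "smult (free_star_algebra X) c = Poly_Mapping.map ((*) c)"
  "star (free_star_algebra X) f = Poly_Mapping.map_key adj_word (Poly_Mapping.map cnj f)"
  by (simp_all add: free_star_algebra_def)

lemma plus_gen_words: "\<lbrakk>v \<in> gen_words X; w \<in> gen_words X\<rbrakk> \<Longrightarrow> v + w \<in> gen_words X"
  by (auto simp: gen_words_def plus_star_word_def)

lemma adj_word_adj_word [simp]: "adj_word (adj_word w) = w"
  by (cases w) (auto simp: adj_word_def rev_map comp_def case_prod_unfold)

lemma inj_adj_word: "inj adj_word"
  by (metis adj_word_adj_word injI)

lemma adj_word_plus: "adj_word (v + w) = adj_word w + adj_word v"
  by (simp add: adj_word_def plus_star_word_def)

lemma adj_gen_words [simp]: "adj_word w \<in> gen_words X \<longleftrightarrow> w \<in> gen_words X"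
  by (cases w) (auto simp: gen_words_def adj_word_def image_image case_prod_unfold)

lemma map_key_adj_single [simp]:
  "Poly_Mapping.map_key adj_word (Poly_Mapping.single w c) = Poly_Mapping.single (adj_word w) c"
  using map_key_single[OF inj_adj_word, of "adj_word w" c] by simp

lemma lookup_smult: "Poly_Mapping.lookup (Poly_Mapping.map ((*) c) f) w = c * Poly_Mapping.lookup f w"
  for c :: complex
  by (simp add: Poly_Mapping.map.rep_eq when_def)

lemma lookup_star:
  "Poly_Mapping.lookup (Poly_Mapping.map_key adj_word (Poly_Mapping.map cnj f)) w =
   cnj (Poly_Mapping.lookup f (adj_word w))"
  by (simp add: Poly_Mapping.map_key.rep_eq[OF inj_adj_word] Poly_Mapping.map.rep_eq when_def)

lemma free_smult_eq: "Poly_Mapping.map ((*) c) f = Poly_Mapping.single 0 c * f" for c :: complex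
  by (rule mult_map_scale_conv_mult)

lemma sum_singles: "(\<Sum>w\<in>Poly_Mapping.keys f. Poly_Mapping.single w (Poly_Mapping.lookup f w)) = f"
  by (rule poly_mapping_eqI)
    (simp add: lookup_sum lookup_single when_def in_keys_iff)

lemma free_induct [consumes 1, case_names zero single add]:
  assumes f: "f \<in> carrier (free_star_algebra X)"
    and P0: "P 0" and Ps: "\<And>w c. w \<in> gen_words X \<Longrightarrow> P (Poly_Mapping.single w c)"
    and Pa: "\<And>f g. \<lbrakk>f \<in> carrier (free_star_algebra X); g \<in> carrier (free_star_algebra X); P f; P g\<rbrakk> \<Longrightarrow> P (f + g)"
  shows "P f"
proof -
  let ?s = "\<lambda>S. \<Sum>w\<in>S. Poly_Mapping.single w (Poly_Mapping.lookup f w)"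
  have "?s S \<in> carrier (free_star_algebra X) \<and> P (?s S)"
    if "finite S" "S \<subseteq> gen_words X" for S
    using that
  proof (induction S rule: finite_induct)
    case (insert w S)
    then have 1: "Poly_Mapping.single w (Poly_Mapping.lookup f w) \<in> carrier (free_star_algebra X)"
      by (auto simp: free_carrier)
    moreover have 2: "?s (insert w S) = Poly_Mapping.single w (Poly_Mapping.lookup f w) + ?s S"
      using insert by simp
    moreover have "Poly_Mapping.single w (Poly_Mapping.lookup f w) + ?s S \<in> carrier (free_star_algebra X)"
      using 1 insert Poly_Mapping.keys_add[of "Poly_Mapping.single w (Poly_Mapping.lookup f w)" "?s S"]
      by (auto simp: free_carrier)
    ultimately show ?case using insert Ps[of w] Pa by auto
  qed (auto simp: P0 free_carrier)
  from this[of "Poly_Mapping.keys f"] f show ?thesis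
    by (auto simp: sum_singles free_carrier)
qed

lemma poly_mapping_single_induct:
  fixes f :: "'g star_word \<Rightarrow>\<^sub>0 complex"
  assumes P0: "P 0" and Ps: "\<And>w c. P (Poly_Mapping.single w c)" and Pa: "\<And>f g. \<lbrakk>P f; P g\<rbrakk> \<Longrightarrow> P (f + g)"
  shows "P f"
proof -
  have "P (\<Sum>w\<in>S. Poly_Mapping.single w (Poly_Mapping.lookup f w))" if "finite S" for S
    using that by (induction S rule: finite_induct) (auto simp: assms)
  from this[of "Poly_Mapping.keys f"] show ?thesis by (simp add: sum_singles)
qed

lemma free_star_add:
  "Poly_Mapping.map_key adj_word (Poly_Mapping.map cnj (f + g)) =
   Poly_Mapping.map_key adj_word (Poly_Mapping.map cnj f) + Poly_Mapping.map_key adj_word (Poly_Mapping.map cnj g)"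
  by (rule poly_mapping_eqI) (simp add: lookup_star lookup_add)

lemma free_star_zero: "Poly_Mapping.map_key adj_word (Poly_Mapping.map cnj 0) = 0"
  by (rule poly_mapping_eqI) (simp add: lookup_star)

lemma free_star_mult:
  "Poly_Mapping.map_key adj_word (Poly_Mapping.map cnj (f * g)) =
   Poly_Mapping.map_key adj_word (Poly_Mapping.map cnj g) * Poly_Mapping.map_key adj_word (Poly_Mapping.map cnj f)"
proof (induction f rule: poly_mapping_single_induct)
  case (2 v c)
  show ?case
  proof (induction g rule: poly_mapping_single_induct)
    case (2 w d)
    then show ?case by (simp add: mult_single adj_word_plus mult.commute)
  qed (simp_all add: distrib_left distrib_right free_star_add free_star_zero)
qed (simp_all add: distrib_left distrib_right free_star_add free_star_zero)

lemma single_0_commute: "Poly_Mapping.single 0 c * f = f * Poly_Mapping.single (0 :: 'g star_word) c" for c :: complex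
  by (induction f rule: poly_mapping_single_induct) (simp_all add: distrib_left distrib_right mult_single mult.commute)

lemma free_closed:
  assumes "f \<in> carrier (free_star_algebra X)" "g \<in> carrier (free_star_algebra X)"
  shows "f + g \<in> carrier (free_star_algebra X)" "f * g \<in> carrier (free_star_algebra X)"
    "Poly_Mapping.map ((*) c) f \<in> carrier (free_star_algebra X)"
    "Poly_Mapping.map_key adj_word (Poly_Mapping.map cnj f) \<in> carrier (free_star_algebra X)"
proof -
  show "f + g \<in> carrier (free_star_algebra X)"
    using assms Poly_Mapping.keys_add[of f g] by (auto simp: free_carrier)
  show "f * g \<in> carrier (free_star_algebra X)"
    using assms keys_mult[of f g] plus_gen_words by (fastforce simp: free_carrier)
  show "Poly_Mapping.map ((*) c) f \<in> carrier (free_star_algebra X)"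
    using assms by (auto simp: free_carrier in_keys_iff lookup_smult)
  show "Poly_Mapping.map_key adj_word (Poly_Mapping.map cnj f) \<in> carrier (free_star_algebra X)"
    unfolding free_carrier mem_Collect_eq
  proof (rule subsetI)
    fix w assume "w \<in> Poly_Mapping.keys (Poly_Mapping.map_key adj_word (Poly_Mapping.map cnj f))"
    then have "adj_word w \<in> Poly_Mapping.keys f" by (simp add: in_keys_iff lookup_star)
    then show "w \<in> gen_words X" using assms(1) adj_gen_words unfolding free_carrier by blast
  qed
qed

lemma free_closed':
  assumes "f \<in> carrier (free_star_algebra X)"
  shows "Poly_Mapping.map ((*) c) f \<in> carrier (free_star_algebra X)"
    "Poly_Mapping.map_key adj_word (Poly_Mapping.map cnj f) \<in> carrier (free_star_algebra X)"
  using free_closed[OF assms assms] by auto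

lemma abelian_group_free: "abelian_group (free_star_algebra X)"
proof (rule abelian_groupI)
  fix f assume f: "f \<in> carrier (free_star_algebra X)"
  have "Poly_Mapping.map ((*) (-1)) f + f = 0"
    by (rule poly_mapping_eqI) (simp add: lookup_add lookup_smult)
  then show "\<exists>g\<in>carrier (free_star_algebra X). g \<oplus>\<^bsub>free_star_algebra X\<^esub> f = \<zero>\<^bsub>free_star_algebra X\<^esub>"
    using free_closed(3)[OF f f] by auto
qed (simp_all add: free_closed(1) add.assoc add.commute, simp add: free_carrier)

lemma star_algebra_free: "star_algebra (free_star_algebra X)"
proof (rule star_algebra.intro[OF abelian_group_free], unfold_locales, goal_cases)
  case (2 x c d)
  show ?case by (rule poly_mapping_eqI) (simp add: lookup_smult lookup_add algebra_simps)
next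
  case (3 x y c)
  show ?case by (rule poly_mapping_eqI) (simp add: lookup_smult lookup_add algebra_simps)
next
  case (4 x c d)
  show ?case by (rule poly_mapping_eqI) (simp add: lookup_smult)
next
  case (5 x)
  show ?case by (rule poly_mapping_eqI) (simp add: lookup_smult)
next
  case (10 x y c)
  show ?case by (simp only: free_ops free_smult_eq mult.assoc)
next
  case (11 x y c)
  show ?case by (metis free_ops(1,4) free_smult_eq mult.assoc single_0_commute)
next
  case (13 x)
  show ?case by (rule poly_mapping_eqI) (simp add: lookup_star)
next
  case (15 x c)
  show ?case by (rule poly_mapping_eqI) (simp add: lookup_star lookup_smult)
qed (simp_all add: free_closed(1,2) free_closed' mult.assoc distrib_left distrib_right free_star_add free_star_mult)

lemma free_diff: assumes "f \<in> carrier (free_star_algebra X)" "g \<in> carrier (free_star_algebra X)"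
  shows "f \<ominus>\<^bsub>free_star_algebra X\<^esub> g = f - g"
proof -
  interpret star_algebra "free_star_algebra X" by (rule star_algebra_free)
  have "f \<ominus>\<^bsub>free_star_algebra X\<^esub> g = f + Poly_Mapping.map ((*) (-1)) g"
    using diff_eq_smult[OF assms] by simp
  also have "\<dots> = f - g" by (rule poly_mapping_eqI) (simp add: lookup_add lookup_smult lookup_minus)
  finally show ?thesis .
qed

lemma free_gen_carrier: "g \<in> X \<Longrightarrow> free_gen g \<in> carrier (free_star_algebra X)"
  by (auto simp: free_gen_def free_carrier gen_words_def)


subsection \<open>The universal seminorm\<close>

definition admissible :: "('a, 'm) star_alg_scheme \<Rightarrow> ('a \<times> 'a) set \<Rightarrow> ('a \<Rightarrow> real) set" where
  "admissible A R = {N. cstar_seminorm A N \<and> (\<forall>(a, b)\<in>R. N (a \<ominus>\<^bsub>A\<^esub> b) = 0)}"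

lemma universal_seminorm_eq: "universal_seminorm A R x = (SUP N\<in>admissible A R. N x)"
  by (simp add: universal_seminorm_def admissible_def)

context star_algebra
begin

lemma zero_admissible: "(\<lambda>_. 0) \<in> admissible A R"
  using star_algebra_axioms by (auto simp: admissible_def cstar_seminorm_def cstar_seminorm_axioms_def)

lemma universal_seminorm_upper:
  assumes "bdd_above ((\<lambda>N. N x) ` admissible A R)" "N \<in> admissible A R"
  shows "N x \<le> universal_seminorm A R x"
  unfolding universal_seminorm_eq by (rule cSUP_upper) (use assms in auto)

lemma universal_seminorm_least:
  assumes "\<And>N. N \<in> admissible A R \<Longrightarrow> N x \<le> b"
  shows "universal_seminorm A R x \<le> b"
  unfolding universal_seminorm_eq by (rule cSUP_least) (use assms zero_admissible in auto)

lemma universal_seminorm_cstar: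
  assumes bdd: "\<And>x. x \<in> carrier A \<Longrightarrow> bdd_above ((\<lambda>N. N x) ` admissible A R)"
  shows "cstar_seminorm A (universal_seminorm A R)"
proof unfold_locales
  let ?U = "universal_seminorm A R"
  note upper = universal_seminorm_upper[OF bdd]
  have adm: "cstar_seminorm A N" if "N \<in> admissible A R" for N
    using that by (auto simp: admissible_def)
  show nn: "0 \<le> ?U x" if "x \<in> carrier A" for x
    using upper[OF that zero_admissible] .
  show "?U (x \<oplus> y) \<le> ?U x + ?U y" if "x \<in> carrier A" "y \<in> carrier A" for x y
    using that upper by (intro universal_seminorm_least)
      (meson adm add_mono cstar_seminorm.seminorm_add order_trans)
  show "?U (x \<otimes> y) \<le> ?U x * ?U y" if "x \<in> carrier A" "y \<in> carrier A" for x y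
  proof (rule universal_seminorm_least)
    fix N assume N: "N \<in> admissible A R"
    interpret cstar_seminorm A N by (rule adm[OF N])
    have "N (x \<otimes> y) \<le> N x * N y" by (rule seminorm_mult[OF that])
    also have "\<dots> \<le> ?U x * ?U y" using that N by (intro mult_mono upper nn seminorm_nonneg)
    finally show "N (x \<otimes> y) \<le> ?U x * ?U y" .
  qed
  have le: "?U (c \<odot> x) \<le> cmod c * ?U x" if "x \<in> carrier A" for c x
    using that upper by (intro universal_seminorm_least)
      (simp add: cstar_seminorm.seminorm_smult[OF adm] mult_left_mono)
  show "?U (c \<odot> x) = cmod c * ?U x" if x: "x \<in> carrier A" for c x
  proof (cases "c = 0")
    case True
    have "?U (c \<odot> x) \<le> 0" using le[OF x, of c] True by simp
    then show ?thesis using nn[of "c \<odot> x"] x True by (simp add: smult_closed)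
  next
    case False
    have "?U x = ?U (inverse c \<odot> (c \<odot> x))" using x False by (simp add: smult_assoc[symmetric] smult_one)
    also have "\<dots> \<le> inverse (cmod c) * ?U (c \<odot> x)"
      using le[OF smult_closed[OF x], of "inverse c" c] by (simp add: norm_inverse)
    finally have "cmod c * ?U x \<le> ?U (c \<odot> x)" using False by (simp add: field_simps)
    then show ?thesis using le[OF x, of c] by simp
  qed
  show "?U (star A x \<otimes> x) = (?U x)\<^sup>2" if x: "x \<in> carrier A" for x
  proof (rule antisym)
    have c: "star A x \<otimes> x \<in> carrier A" using x by (simp add: star_closed mult_closed)
    show "?U (star A x \<otimes> x) \<le> (?U x)\<^sup>2"
    proof (rule universal_seminorm_least)
      fix N assume N: "N \<in> admissible A R"
      interpret cstar_seminorm A N by (rule adm[OF N])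
      show "N (star A x \<otimes> x) \<le> (?U x)\<^sup>2"
        using x N by (simp add: seminorm_star power_mono upper seminorm_nonneg)
    qed
    have "?U x \<le> sqrt (?U (star A x \<otimes> x))"
    proof (rule universal_seminorm_least)
      fix N assume N: "N \<in> admissible A R"
      interpret cstar_seminorm A N by (rule adm[OF N])
      show "N x \<le> sqrt (?U (star A x \<otimes> x))"
        using upper[OF c N] seminorm_nonneg[OF x] by (intro real_le_rsqrt) (simp add: seminorm_star[OF x])
    qed
    from power_mono[OF this nn[OF x], of 2] show "(?U x)\<^sup>2 \<le> ?U (star A x \<otimes> x)"
      using nn[OF c] by simp
  qed
qed

lemma universal_seminorm_admissible:
  assumes bdd: "\<And>x. x \<in> carrier A \<Longrightarrow> bdd_above ((\<lambda>N. N x) ` admissible A R)"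
    and "R \<subseteq> carrier A \<times> carrier A"
  shows "universal_seminorm A R \<in> admissible A R"
proof -
  have "universal_seminorm A R (a \<ominus> b) = 0" if "(a, b) \<in> R" for a b
  proof (rule antisym)
    show "universal_seminorm A R (a \<ominus> b) \<le> 0"
      using that by (intro universal_seminorm_least) (auto simp: admissible_def)
    have "a \<ominus> b \<in> carrier A" using that assms(2) by auto
    then show "0 \<le> universal_seminorm A R (a \<ominus> b)"
      using universal_seminorm_upper[OF bdd zero_admissible] by auto
  qed
  then show ?thesis
    using universal_seminorm_cstar[OF bdd] by (auto simp: admissible_def)
qed

end


section \<open>Star-homomorphisms between C*-algebras are contractive\<close>

context star_algebra
begin

lemma minus_smult_smult: "x \<in> carrier A \<Longrightarrow> c \<odot> x \<oplus> (-c) \<odot> x = \<zero>"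
  using smult_l_distr[of x c "-c"] by (simp add: smult_zero_left)

lemma normal_square:
  assumes P: "P \<in> carrier A" and y: "y \<in> carrier A" and c: "star A P \<otimes> y = star A y \<otimes> P"
    and i: "cnj i = - i" "i * i = -1"
  shows "star A (P \<oplus> i \<odot> y) \<otimes> (P \<oplus> i \<odot> y) = star A P \<otimes> P \<oplus> star A y \<otimes> y"
proof -
  have cs: "star A P \<otimes> P \<in> carrier A" "star A P \<otimes> y \<in> carrier A" "star A y \<otimes> P \<in> carrier A"
    "star A y \<otimes> y \<in> carrier A" "star A P \<in> carrier A" "star A y \<in> carrier A"
    using P y by (auto simp: star_closed mult_closed)
  have "star A (P \<oplus> i \<odot> y) = star A P \<oplus> (-i) \<odot> star A y"
    using P y i by (simp add: star_add star_smult smult_closed)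
  then have "star A (P \<oplus> i \<odot> y) \<otimes> (P \<oplus> i \<odot> y) =
      (star A P \<otimes> P \<oplus> (-i) \<odot> (star A y \<otimes> P)) \<oplus> (i \<odot> (star A P \<otimes> y) \<oplus> i \<odot> ((-i) \<odot> (star A y \<otimes> y)))"
    using P y cs by (simp add: mult_l_distr mult_r_distr smult_closed smult_mult_left smult_mult_right smult_r_distr)
  also have "i \<odot> ((-i) \<odot> (star A y \<otimes> y)) = star A y \<otimes> y"
    using cs i by (simp add: smult_assoc[symmetric] smult_one)
  also have "(star A P \<otimes> P \<oplus> (-i) \<odot> (star A y \<otimes> P)) \<oplus> (i \<odot> (star A P \<otimes> y) \<oplus> star A y \<otimes> y) =
     star A P \<otimes> P \<oplus> ((i \<odot> (star A y \<otimes> P) \<oplus> (-i) \<odot> (star A y \<otimes> P)) \<oplus> star A y \<otimes> y)"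
    using cs c by (simp add: a_ac smult_closed)
  finally show ?thesis using cs by (simp add: minus_smult_smult)
qed

lemma quarter_turn_sum:
  assumes h: "h \<in> carrier A" "star A h = h" and b: "b \<in> carrier A" "star A b = b"
    and bh: "b \<otimes> h = h \<otimes> b" and eq: "b \<oplus> b = h \<otimes> h \<oplus> b \<otimes> b" and x: "x \<in> carrier A"
  defines "P \<equiv> h \<otimes> x" and "y \<equiv> x \<ominus> b \<otimes> x"
  shows "star A P \<otimes> y = star A y \<otimes> P" "star A P \<otimes> P \<oplus> star A y \<otimes> y = star A x \<otimes> x"
proof -
  let ?x = "star A x"
  note cl = h b x star_closed mult_closed
  have sP: "star A P = ?x \<otimes> h" and sy: "star A y = ?x \<ominus> ?x \<otimes> b"
    using cl by (auto simp: P_def y_def star_mult star_diff)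
  have "star A P \<otimes> y = ?x \<otimes> h \<otimes> x \<ominus> ?x \<otimes> h \<otimes> (b \<otimes> x)"
    unfolding sP unfolding y_def using cl by (simp add: mult_diff_right)
  also have "?x \<otimes> h \<otimes> (b \<otimes> x) = ?x \<otimes> (h \<otimes> b) \<otimes> x"
    using cl by (simp add: mult_assoc)
  also have "?x \<otimes> h \<otimes> x \<ominus> ?x \<otimes> (h \<otimes> b) \<otimes> x = star A y \<otimes> P"
    unfolding sy P_def bh[symmetric] using cl by (simp add: mult_diff_left mult_assoc)
  finally show "star A P \<otimes> y = star A y \<otimes> P" .
  define \<xi> where "\<xi> = ?x \<otimes> x"
  define \<beta> where "\<beta> = ?x \<otimes> (b \<otimes> x)"
  define \<eta> where "\<eta> = ?x \<otimes> ((h \<otimes> h) \<otimes> x)"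
  define \<kappa> where "\<kappa> = ?x \<otimes> ((b \<otimes> b) \<otimes> x)"
  have g: "\<xi> \<in> carrier A" "\<beta> \<in> carrier A" "\<eta> \<in> carrier A" "\<kappa> \<in> carrier A"
    using cl by (auto simp: \<xi>_def \<beta>_def \<eta>_def \<kappa>_def)
  have "?x \<otimes> ((b \<oplus> b) \<otimes> x) = ?x \<otimes> ((h \<otimes> h \<oplus> b \<otimes> b) \<otimes> x)" by (simp only: eq)
  then have 1: "\<beta> \<oplus> \<beta> = \<eta> \<oplus> \<kappa>"
    using cl by (simp add: \<beta>_def \<eta>_def \<kappa>_def mult_l_distr mult_r_distr)
  have 2: "star A P \<otimes> P = \<eta>"
    unfolding sP unfolding P_def \<eta>_def using cl by (simp add: mult_assoc)
  have "star A y \<otimes> y = (\<xi> \<ominus> \<beta>) \<ominus> (\<beta> \<ominus> \<kappa>)"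
    unfolding sy unfolding y_def \<xi>_def \<beta>_def \<kappa>_def using cl
    by (simp add: mult_diff_left mult_diff_right mult_assoc)
  also have "\<dots> = \<xi> \<oplus> (\<kappa> \<ominus> (\<beta> \<oplus> \<beta>))"
    using g by (simp add: a_minus_def minus_add a_ac)
  also have "\<dots> = \<xi> \<oplus> (\<kappa> \<ominus> (\<eta> \<oplus> \<kappa>))" by (simp only: 1)
  also have "\<kappa> \<ominus> (\<eta> \<oplus> \<kappa>) = \<kappa> \<oplus> (\<ominus> \<kappa> \<oplus> \<ominus> \<eta>)"
    unfolding a_minus_def minus_add[OF g(3,4)] by (subst a_comm[of "\<ominus> \<eta>"]) (use g in auto)
  also have "\<dots> = \<ominus> \<eta>" using g by (intro r_neg2) auto
  finally have "star A P \<otimes> P \<oplus> star A y \<otimes> y = \<xi> \<oplus> (\<eta> \<oplus> \<ominus> \<eta>)"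
    unfolding 2 using g by (simp add: a_lcomm)
  then show "star A P \<otimes> P \<oplus> star A y \<otimes> y = star A x \<otimes> x"
    using g by (simp add: r_neg \<xi>_def)
qed

end

lemma (in cstar_seminorm) seminorm_le_1_by_quarter_turn:
  assumes h: "h \<in> carrier A" "star A h = h" and b: "b \<in> carrier A" "star A b = b"
    and bh: "b \<otimes> h = h \<otimes> b" and eq: "b \<oplus> b = h \<otimes> h \<oplus> b \<otimes> b"
  shows "N h \<le> 1"
proof -
  define y where "y = h \<ominus> b \<otimes> h"
  have yc: "y \<in> carrier A" and P: "h \<otimes> h \<in> carrier A" using h b by (auto simp: y_def mult_closed)
  note q = quarter_turn_sum[OF h b bh eq h(1), folded y_def]
  have U: "N (h \<otimes> h \<oplus> i \<odot> y) = N h" if "cnj i = - i" "i * i = -1" for i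
  proof -
    have "(N (h \<otimes> h \<oplus> i \<odot> y))\<^sup>2 = (N h)\<^sup>2"
      using normal_square[OF P yc q(1) that] q(2) seminorm_star[of "h \<otimes> h \<oplus> i \<odot> y"] seminorm_star[of h] P yc h
      by (simp add: smult_closed)
    then show ?thesis
      using P yc h by (simp add: power2_eq_iff_nonneg seminorm_nonneg smult_closed)
  qed
  let ?U = "h \<otimes> h \<oplus> \<i> \<odot> y" and ?V = "h \<otimes> h \<oplus> (-\<i>) \<odot> y"
  have c: "?U \<in> carrier A" "?V \<in> carrier A" using P yc by (auto simp: smult_closed)
  have "?U \<oplus> ?V = (h \<otimes> h \<oplus> h \<otimes> h) \<oplus> (\<i> \<odot> y \<oplus> (-\<i>) \<odot> y)"
    using P yc by (simp add: a_ac smult_closed)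
  also have "\<dots> = 1 \<odot> (h \<otimes> h) \<oplus> 1 \<odot> (h \<otimes> h)" using P yc by (simp add: minus_smult_smult smult_one)
  also have "\<dots> = 2 \<odot> (h \<otimes> h)" using smult_l_distr[OF P, of 1 1] by simp
  finally have "N (2 \<odot> (h \<otimes> h)) \<le> N ?U + N ?V" using seminorm_add[OF c] by simp
  then have "2 * N (h \<otimes> h) \<le> 2 * N h" using U[of \<i>] U[of "-\<i>"] P by (simp add: seminorm_smult)
  moreover have "N (h \<otimes> h) = (N h)\<^sup>2" using seminorm_star[of h] h by simp
  ultimately have "N h * N h \<le> N h * 1" by (simp add: power2_eq_square)
  then show ?thesis using seminorm_nonneg[OF h(1)] by (cases "N h = 0") auto
qed

context cstar_algebra
begin

lemma eqI_norm: "\<lbrakk>x \<in> carrier A; y \<in> carrier A; cnorm A (x \<ominus> y) \<le> 0\<rbrakk> \<Longrightarrow> x = y"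
  using seminorm_nonneg[of "x \<ominus> y"] norm_eq_0[of "x \<ominus> y"] by (simp add: diff_zero_iff)

lemma quarter_turn_root:
  assumes h: "h \<in> carrier A" "star A h = h" and h1: "cnorm A h < 1"
  shows "\<exists>b\<in>carrier A. star A b = b \<and> b \<otimes> h = h \<otimes> b \<and> b \<oplus> b = h \<otimes> h \<oplus> b \<otimes> b"
proof -
  let ?N = "cnorm A"
  interpret M: Metric_space "carrier A" "cdist A" by (rule Metric_space)
  define T where "T = (\<lambda>b. (1/2) \<odot> (h \<otimes> h \<oplus> b \<otimes> b))"
  define b where "b = (\<lambda>n. (T ^^ n) \<zero>)"
  define q where "q = (?N h)\<^sup>2"
  define \<rho> where "\<rho> = (1 + q) / 2"
  have q: "0 \<le> q" "q < 1" using h1 seminorm_nonneg[OF h(1)] by (auto simp: q_def power2_less_1_iff)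
  then have \<rho>: "0 < \<rho>" "\<rho> < 1" by (auto simp: \<rho>_def)
  have Tc: "T x \<in> carrier A" if "x \<in> carrier A" for x
    using that h by (simp add: T_def smult_closed mult_closed)
  have bS: "b (Suc n) = T (b n)" for n by (simp add: b_def)
  have b0: "b 0 = \<zero>" by (simp add: b_def)
  have bc: "b n \<in> carrier A" for n by (induction n) (auto simp: b0 bS Tc)
  have bstar: "star A (b n) = b n" for n
    by (induction n) (use h bc in \<open>auto simp: b0 bS T_def star_zero star_smult star_add star_mult smult_closed mult_closed\<close>)
  have bcomm: "b n \<otimes> h = h \<otimes> b n" for n
  proof (induction n)
    case (Suc n)
    have "(b n \<otimes> b n) \<otimes> h = b n \<otimes> (h \<otimes> b n)" using bc h Suc by (simp add: mult_assoc)
    also have "\<dots> = (h \<otimes> b n) \<otimes> b n" using bc h Suc by (simp add: mult_assoc[symmetric])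
    also have "\<dots> = h \<otimes> (b n \<otimes> b n)" using bc h by (simp add: mult_assoc)
    finally show ?case using bc h
      by (simp add: bS T_def smult_mult_left smult_mult_right mult_closed mult_l_distr mult_r_distr mult_assoc)
  qed (use h in \<open>simp add: b0 mult_zero_left mult_zero_right\<close>)
  have hh: "?N (h \<otimes> h) = q" using seminorm_star[of h] h by (simp add: q_def)
  have bb: "?N (b n) \<le> \<rho>" for n
  proof (induction n)
    case (Suc n)
    have "?N (b (Suc n)) = ?N (h \<otimes> h \<oplus> b n \<otimes> b n) / 2"
      using h bc by (simp add: bS T_def seminorm_smult mult_closed)
    also have "\<dots> \<le> (?N (h \<otimes> h) + ?N (b n) * ?N (b n)) / 2"
      using h bc seminorm_add[of "h \<otimes> h" "b n \<otimes> b n"] seminorm_mult[of "b n" "b n"] by (simp add: mult_closed)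
    also have "\<dots> \<le> (q + \<rho> * \<rho>) / 2"
      using Suc \<rho> bc by (simp add: hh mult_mono seminorm_nonneg)
    also have "\<dots> \<le> (q + 1) / 2" using \<rho> by (simp add: mult_le_one)
    also have "\<dots> = \<rho>" by (simp add: \<rho>_def)
    finally show ?case .
  qed (use \<rho> in \<open>simp add: b0 seminorm_zero\<close>)
  have TT: "?N (T x \<ominus> T y) \<le> \<rho> * ?N (x \<ominus> y)"
    if "x \<in> carrier A" "y \<in> carrier A" "?N x \<le> \<rho>" "?N y \<le> \<rho>" for x y
  proof -
    have "T x \<ominus> T y = (1/2) \<odot> ((h \<otimes> h \<oplus> x \<otimes> x) \<ominus> (h \<otimes> h \<oplus> y \<otimes> y))"
      using that h by (simp add: T_def smult_diff mult_closed)
    also have "(h \<otimes> h \<oplus> x \<otimes> x) \<ominus> (h \<otimes> h \<oplus> y \<otimes> y) = x \<otimes> x \<ominus> y \<otimes> y"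
      using that h by (subst diff_add_diff) (simp_all add: mult_closed diff_zero_iff[THEN iffD2])
    also have "\<dots> = (x \<ominus> y) \<otimes> x \<oplus> y \<otimes> (x \<ominus> y)"
      using that by (simp add: mult_diff_split)
    finally have "?N (T x \<ominus> T y) = ?N ((x \<ominus> y) \<otimes> x \<oplus> y \<otimes> (x \<ominus> y)) / 2"
      using that by (simp add: seminorm_smult mult_closed)
    also have "?N ((x \<ominus> y) \<otimes> x \<oplus> y \<otimes> (x \<ominus> y)) \<le> ?N (x \<ominus> y) * ?N x + ?N y * ?N (x \<ominus> y)"
      using that by (meson add_mono mult_closed minus_closed order_trans seminorm_add seminorm_mult)
    also have "\<dots> \<le> ?N (x \<ominus> y) * \<rho> + \<rho> * ?N (x \<ominus> y)"
      using that by (intro add_mono mult_left_mono mult_right_mono seminorm_nonneg) auto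
    finally show ?thesis by simp
  qed
  have step: "?N (b (Suc n) \<ominus> b n) \<le> \<rho> ^ n" for n
  proof (induction n)
    case 0
    have "b (Suc 0) \<ominus> b 0 = b (Suc 0)"
      using bc[of "Suc 0"] by (simp add: b0 diff_eq_smult smult_zero_right)
    then show ?case using bb[of "Suc 0"] \<rho> by simp
  next
    case (Suc n)
    have "?N (b (Suc (Suc n)) \<ominus> b (Suc n)) \<le> \<rho> * ?N (b (Suc n) \<ominus> b n)"
      using TT[OF bc bc bb bb, of "Suc n" n] by (simp only: bS)
    also have "\<dots> \<le> \<rho> * \<rho> ^ n" using Suc \<rho> by simp
    finally show ?case by simp
  qed
  have far: "?N (b (n + k) \<ominus> b n) \<le> \<rho> ^ n / (1 - \<rho>) - \<rho> ^ (n + k) / (1 - \<rho>)" for n k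
  proof (induction k)
    case 0
    then show ?case using bc[of n] by (simp add: a_minus_def r_neg seminorm_zero)
  next
    case (Suc k)
    have "?N (b (n + Suc k) \<ominus> b n) \<le> ?N (b (Suc (n + k)) \<ominus> b (n + k)) + ?N (b (n + k) \<ominus> b n)"
      using seminorm_triangle[OF bc bc bc] by simp
    also have "\<dots> \<le> \<rho> ^ (n + k) + (\<rho> ^ n / (1 - \<rho>) - \<rho> ^ (n + k) / (1 - \<rho>))"
      using step Suc by (intro add_mono)
    also have "\<dots> = \<rho> ^ n / (1 - \<rho>) - \<rho> ^ (n + Suc k) / (1 - \<rho>)"
    proof -
      have "\<rho> ^ (n + k) = \<rho> ^ (n + k) * (1 - \<rho>) / (1 - \<rho>)" using \<rho> by simp
      also have "\<dots> = \<rho> ^ (n + k) / (1 - \<rho>) - \<rho> ^ (n + Suc k) / (1 - \<rho>)"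
        by (simp only: right_diff_distrib diff_divide_distrib mult_1_right add_Suc_right power_Suc2)
      finally show ?thesis by linarith
    qed
    finally show ?case .
  qed
  have far': "?N (b m \<ominus> b n) \<le> \<rho> ^ n / (1 - \<rho>)" if "n \<le> m" for m n
  proof -
    have "?N (b m \<ominus> b n) \<le> \<rho> ^ n / (1 - \<rho>) - \<rho> ^ m / (1 - \<rho>)" using far[of n "m - n"] that by simp
    also have "\<dots> \<le> \<rho> ^ n / (1 - \<rho>)" using \<rho> by simp
    finally show ?thesis .
  qed
  have geo: "(\<lambda>n. \<rho> ^ n / (1 - \<rho>)) \<longlonglongrightarrow> 0"
    using LIMSEQ_power_zero[of \<rho>] \<rho> by (intro tendsto_divide_zero) auto
  have "M.MCauchy b"
    unfolding M.MCauchy_def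
  proof (intro conjI allI impI)
    show "range b \<subseteq> carrier A" using bc by auto
    fix e :: real assume "e > 0"
    then obtain K where K: "\<And>n. n \<ge> K \<Longrightarrow> \<rho> ^ n / (1 - \<rho>) < e"
      using order_tendstoD(2)[OF geo] unfolding eventually_sequentially by blast
    show "\<exists>K. \<forall>n n'. K \<le> n \<longrightarrow> K \<le> n' \<longrightarrow> cdist A (b n) (b n') < e"
    proof (intro exI[of _ K] allI impI)
      fix n n' assume "K \<le> n" "K \<le> n'"
      then show "cdist A (b n) (b n') < e"
        using far'[of n n'] far'[of n' n] K[of n] K[of n'] bc seminorm_diff_commute[OF bc bc, of n n']
        by (cases "n \<le> n'") (auto simp: cdist_def)
    qed
  qed
  then obtain \<beta> where "limitin M.mtopology b \<beta> sequentially"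
    using complete unfolding M.mcomplete_def by blast
  then have \<beta>: "\<beta> \<in> carrier A" and "(\<lambda>n. cdist A (b n) \<beta>) \<longlonglongrightarrow> 0"
    by (auto simp: M.limitin_metric_dist_null)
  then have lim: "(\<lambda>n. ?N (b n \<ominus> \<beta>)) \<longlonglongrightarrow> 0" using bc by (simp add: cdist_def)
  have \<beta>\<rho>: "?N \<beta> \<le> \<rho>"
  proof -
    have l: "(\<lambda>n. \<rho> + ?N (b n \<ominus> \<beta>)) \<longlonglongrightarrow> \<rho> + 0"
      by (intro tendsto_add tendsto_const lim)
    have "?N \<beta> \<le> \<rho> + ?N (b n \<ominus> \<beta>)" for n
      using seminorm_diff_abs[OF bc \<beta>, of n] bb[of n] by linarith
    then have "?N \<beta> \<le> \<rho> + 0" by (intro LIMSEQ_le_const[OF l]) auto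
    then show ?thesis by simp
  qed
  have c0: "r \<le> 0" if "\<And>n. r \<le> C * ?N (b n \<ominus> \<beta>) + \<rho> ^ n / (1 - \<rho>)" for r C
  proof -
    have "(\<lambda>n. C * ?N (b n \<ominus> \<beta>) + \<rho> ^ n / (1 - \<rho>)) \<longlonglongrightarrow> C * 0 + 0"
      by (intro tendsto_add tendsto_mult_left lim geo)
    then show ?thesis using that by (intro LIMSEQ_le_const[of _ 0]) auto
  qed
  have geo0: "0 \<le> \<rho> ^ n / (1 - \<rho>)" for n using \<rho> by simp
  have "star A \<beta> = \<beta>"
  proof (rule eqI_norm, goal_cases)
    case 3
    show ?case
    proof (rule c0[of _ 2])
      fix n
      have "?N (star A \<beta> \<ominus> \<beta>) \<le> ?N (star A \<beta> \<ominus> star A (b n)) + ?N (b n \<ominus> \<beta>)"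
        using seminorm_triangle[of "star A \<beta>" "b n" \<beta>] bc \<beta> by (simp add: bstar star_closed)
      also have "?N (star A \<beta> \<ominus> star A (b n)) = ?N (b n \<ominus> \<beta>)"
        using bc \<beta> seminorm_diff_commute[OF \<beta> bc] by (simp add: star_diff[symmetric] seminorm_adj)
      finally show "?N (star A \<beta> \<ominus> \<beta>) \<le> 2 * ?N (b n \<ominus> \<beta>) + \<rho> ^ n / (1 - \<rho>)"
        using geo0[of n] by simp
    qed
  qed (use \<beta> in \<open>auto simp: star_closed\<close>)
  moreover have "\<beta> \<otimes> h = h \<otimes> \<beta>"
  proof (rule eqI_norm, goal_cases)
    case 3
    show ?case
    proof (rule c0[of _ "2 * ?N h"])
      fix n
      have "?N (\<beta> \<otimes> h \<ominus> h \<otimes> \<beta>) \<le> ?N (\<beta> \<otimes> h \<ominus> b n \<otimes> h) + ?N (h \<otimes> b n \<ominus> h \<otimes> \<beta>)"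
        using seminorm_triangle[of "\<beta> \<otimes> h" "b n \<otimes> h" "h \<otimes> \<beta>"] bc \<beta> h by (simp add: bcomm mult_closed)
      also have "\<dots> \<le> ?N (\<beta> \<ominus> b n) * ?N h + ?N h * ?N (b n \<ominus> \<beta>)"
        using bc \<beta> h by (simp add: mult_diff_left[symmetric] mult_diff_right[symmetric] add_mono seminorm_mult)
      finally show "?N (\<beta> \<otimes> h \<ominus> h \<otimes> \<beta>) \<le> 2 * ?N h * ?N (b n \<ominus> \<beta>) + \<rho> ^ n / (1 - \<rho>)"
        using geo0[of n] seminorm_diff_commute[OF \<beta> bc] by simp
    qed
  qed (use \<beta> h in \<open>auto simp: mult_closed\<close>)
  moreover have "\<beta> = T \<beta>"
  proof (rule eqI_norm, goal_cases)
    case 3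
    show ?case
    proof (rule c0[of _ 2])
      fix n
      have "?N (\<beta> \<ominus> T \<beta>) \<le> ?N (\<beta> \<ominus> b n) + ?N (b n \<ominus> T \<beta>)"
        using seminorm_triangle[of \<beta> "b n" "T \<beta>"] bc \<beta> Tc by simp
      also have "?N (b n \<ominus> T \<beta>) \<le> ?N (b n \<ominus> b (Suc n)) + ?N (b (Suc n) \<ominus> T \<beta>)"
        using seminorm_triangle[of "b n" "b (Suc n)" "T \<beta>"] bc \<beta> Tc by simp
      also have "?N (b n \<ominus> b (Suc n)) \<le> \<rho> ^ n / (1 - \<rho>)"
        using far'[of n "Suc n"] seminorm_diff_commute[OF bc bc, of n "Suc n"] by simp
      also have "?N (b (Suc n) \<ominus> T \<beta>) \<le> \<rho> * ?N (b n \<ominus> \<beta>)"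
        using TT[OF bc \<beta> bb \<beta>\<rho>] by (simp add: bS)
      also have "\<rho> * ?N (b n \<ominus> \<beta>) \<le> 1 * ?N (b n \<ominus> \<beta>)"
        using \<rho> bc \<beta> by (intro mult_right_mono seminorm_nonneg) auto
      finally show "?N (\<beta> \<ominus> T \<beta>) \<le> 2 * ?N (b n \<ominus> \<beta>) + \<rho> ^ n / (1 - \<rho>)"
        using seminorm_diff_commute[OF \<beta> bc, of n] by simp
    qed
  qed (use \<beta> Tc in auto)
  then have "\<beta> \<oplus> \<beta> = h \<otimes> h \<oplus> \<beta> \<otimes> \<beta>"
  proof -
    let ?w = "h \<otimes> h \<oplus> \<beta> \<otimes> \<beta>"
    assume "\<beta> = T \<beta>"
    then have "\<beta> \<oplus> \<beta> = (1/2) \<odot> ?w \<oplus> (1/2) \<odot> ?w" by (simp add: T_def)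
    also have "\<dots> = (1/2 + 1/2) \<odot> ?w"
      by (rule smult_l_distr[symmetric]) (use h \<beta> in \<open>simp add: mult_closed\<close>)
    finally show ?thesis using h \<beta> by (simp add: smult_one mult_closed)
  qed
  ultimately show ?thesis using \<beta> by blast
qed

theorem seminorm_le_norm:
  assumes M: "cstar_seminorm A M" and x: "x \<in> carrier A"
  shows "M x \<le> cnorm A x"
proof -
  interpret M: cstar_seminorm A M by fact
  have sa: "M h \<le> cnorm A h" if h: "h \<in> carrier A" "star A h = h" for h
  proof (rule field_le_epsilon)
    fix e :: real assume e: "e > 0"
    define t where "t = cnorm A h + e"
    have t: "t > 0" using seminorm_nonneg[OF h(1)] e by (simp add: t_def)
    define k where "k = complex_of_real (1 / t) \<odot> h"
    have k: "k \<in> carrier A" "star A k = k" using h by (auto simp: k_def smult_closed star_smult)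
    have "cnorm A k = cnorm A h / t" using t h by (simp add: k_def seminorm_smult norm_divide)
    also have "\<dots> < 1" using t e by (simp add: t_def)
    finally have "cnorm A k < 1" .
    from quarter_turn_root[OF k this] obtain b where "b \<in> carrier A" "star A b = b" "b \<otimes> k = k \<otimes> b" "b \<oplus> b = k \<otimes> k \<oplus> b \<otimes> b"
      by blast
    from M.seminorm_le_1_by_quarter_turn[OF k this] have "M k \<le> 1" .
    then show "M h \<le> cnorm A h + e"
      using t h by (simp add: k_def M.seminorm_smult norm_divide t_def[symmetric])
  qed
  have "(M x)\<^sup>2 \<le> (cnorm A x)\<^sup>2"
    using sa[of "star A x \<otimes> x"] x
    by (simp add: M.seminorm_star seminorm_star mult_closed star_closed star_mult star_star)
  then show ?thesis using seminorm_nonneg[OF x] by (rule power2_le_imp_le)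
qed

end

lemma star_hom_props:
  assumes "\<phi> \<in> star_hom A B"
  shows "x \<in> carrier A \<Longrightarrow> \<phi> x \<in> carrier B"
    "\<lbrakk>x \<in> carrier A; y \<in> carrier A\<rbrakk> \<Longrightarrow> \<phi> (x \<oplus>\<^bsub>A\<^esub> y) = \<phi> x \<oplus>\<^bsub>B\<^esub> \<phi> y"
    "x \<in> carrier A \<Longrightarrow> \<phi> (c \<odot>\<^bsub>A\<^esub> x) = c \<odot>\<^bsub>B\<^esub> \<phi> x"
    "\<lbrakk>x \<in> carrier A; y \<in> carrier A\<rbrakk> \<Longrightarrow> \<phi> (x \<otimes>\<^bsub>A\<^esub> y) = \<phi> x \<otimes>\<^bsub>B\<^esub> \<phi> y"
    "x \<in> carrier A \<Longrightarrow> \<phi> (star A x) = star B (\<phi> x)"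
  using assms by (auto simp: star_hom_def)

lemma star_hom_zero:
  assumes "star_algebra A" "star_algebra B" "\<phi> \<in> star_hom A B"
  shows "\<phi> \<zero>\<^bsub>A\<^esub> = \<zero>\<^bsub>B\<^esub>"
proof -
  interpret A: star_algebra A by fact
  interpret B: star_algebra B by fact
  show ?thesis
    using star_hom_props(3)[OF assms(3), of "\<zero>\<^bsub>A\<^esub>" 0] star_hom_props(1)[OF assms(3), of "\<zero>\<^bsub>A\<^esub>"]
    by (simp add: A.smult_zero_left B.smult_zero_left)
qed

lemma star_hom_diff:
  assumes "star_algebra A" "star_algebra B" "\<phi> \<in> star_hom A B" "x \<in> carrier A" "y \<in> carrier A"
  shows "\<phi> (x \<ominus>\<^bsub>A\<^esub> y) = \<phi> x \<ominus>\<^bsub>B\<^esub> \<phi> y"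
proof -
  interpret A: star_algebra A by fact
  interpret B: star_algebra B by fact
  show ?thesis
    using assms(4,5) by (simp add: A.diff_eq_smult B.diff_eq_smult star_hom_props[OF assms(3)] A.smult_closed)
qed

lemma star_hom_pullback_seminorm:
  assumes "star_algebra A" "cstar_seminorm B N" "\<phi> \<in> star_hom A B"
  shows "cstar_seminorm A (\<lambda>x. N (\<phi> x))"
proof -
  interpret A: star_algebra A by fact
  interpret B: cstar_seminorm B N by fact
  show ?thesis
    by unfold_locales
      (use star_hom_props[OF assms(3)] in
        \<open>auto simp: B.seminorm_nonneg B.seminorm_add B.seminorm_smult B.seminorm_mult B.seminorm_star A.star_closed\<close>)
qed

theorem star_hom_contractive:
  assumes "cstar_algebra A" "cstar_algebra B" "\<phi> \<in> star_hom A B" "x \<in> carrier A"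
  shows "cnorm B (\<phi> x) \<le> cnorm A x"
proof -
  interpret A: cstar_algebra A by fact
  interpret B: cstar_algebra B by fact
  show ?thesis
    by (rule A.seminorm_le_norm[OF star_hom_pullback_seminorm])
      (use assms A.star_algebra_axioms B.cstar_seminorm_axioms in auto)
qed


section \<open>Homomorphisms out of free algebras and completions\<close>

lemma star_homI:
  assumes "\<And>x. x \<in> carrier A \<Longrightarrow> \<phi> x \<in> carrier B"
    "\<And>x y. \<lbrakk>x \<in> carrier A; y \<in> carrier A\<rbrakk> \<Longrightarrow> \<phi> (x \<oplus>\<^bsub>A\<^esub> y) = \<phi> x \<oplus>\<^bsub>B\<^esub> \<phi> y"
    "\<And>c x. x \<in> carrier A \<Longrightarrow> \<phi> (c \<odot>\<^bsub>A\<^esub> x) = c \<odot>\<^bsub>B\<^esub> \<phi> x"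
    "\<And>x y. \<lbrakk>x \<in> carrier A; y \<in> carrier A\<rbrakk> \<Longrightarrow> \<phi> (x \<otimes>\<^bsub>A\<^esub> y) = \<phi> x \<otimes>\<^bsub>B\<^esub> \<phi> y"
    "\<And>x. x \<in> carrier A \<Longrightarrow> \<phi> (star A x) = star B (\<phi> x)"
  shows "\<phi> \<in> star_hom A B"
  using assms by (simp add: star_hom_def Pi_iff)

lemma star_hom_comp:
  assumes "\<phi> \<in> star_hom A B" "\<psi> \<in> star_hom B C"
  shows "(\<lambda>x. \<psi> (\<phi> x)) \<in> star_hom A C"
  by (rule star_homI) (simp_all add: star_hom_props[OF assms(1)] star_hom_props[OF assms(2)])

lemma star_hom_cong:
  assumes "star_algebra A" "\<phi> \<in> star_hom A B" "\<And>x. x \<in> carrier A \<Longrightarrow> \<phi> x = \<psi> x"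
  shows "\<psi> \<in> star_hom A B"
proof -
  interpret star_algebra A by fact
  show ?thesis
    by (rule star_homI)
      (simp_all add: assms(3)[symmetric] star_hom_props[OF assms(2)] smult_closed mult_closed star_closed)
qed

lemma star_hom_inv:
  assumes A: "star_algebra A" and \<phi>: "\<phi> \<in> star_hom A B" and bij: "bij_betw \<phi> (carrier A) (carrier B)"
  shows "inv_into (carrier A) \<phi> \<in> star_hom B A"
proof -
  interpret star_algebra A by fact
  let ?i = "inv_into (carrier A) \<phi>"
  have c: "?i y \<in> carrier A" and f: "\<phi> (?i y) = y" if "y \<in> carrier B" for y
    using that bij by (auto simp: bij_betw_def inv_into_into f_inv_into_f)
  have e: "?i y = x" if "x \<in> carrier A" "\<phi> x = y" for x y
    using that bij by (auto simp: bij_betw_def inv_into_f_f)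
  show ?thesis
    by (rule star_homI; (rule e)?) (simp_all add: c f star_hom_props[OF \<phi>] smult_closed mult_closed star_closed)
qed

lemma star_hom_finsum:
  assumes "star_algebra A" "star_algebra B" "\<phi> \<in> star_hom A B" "finite F" "f \<in> F \<rightarrow> carrier A"
  shows "\<phi> (finsum A f F) = finsum B (\<lambda>i. \<phi> (f i)) F"
proof -
  interpret A: star_algebra A by fact
  interpret B: star_algebra B by fact
  note p = star_hom_props[OF assms(3)]
  show ?thesis using assms(4,5)
  proof (induction F rule: finite_induct)
    case empty
    then show ?case using star_hom_zero[OF assms(1-3)] by simp
  next
    case (insert i F)
    then have "f i \<in> carrier A" "f \<in> F \<rightarrow> carrier A" "(\<lambda>i. \<phi> (f i)) \<in> F \<rightarrow> carrier B"
      using p(1) by auto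
    then show ?case using insert p by (simp add: A.finsum_closed)
  qed
qed


subsection \<open>Functoriality of the completion\<close>

lemma completion_map:
  assumes "cstar_seminorm A N" "cstar_seminorm B M" and \<phi>: "\<phi> \<in> star_hom A B"
    and le: "\<And>a. a \<in> carrier A \<Longrightarrow> M (\<phi> a) \<le> N a"
  shows "\<exists>\<Phi>\<in>star_hom (hausdorff_completion A N) (hausdorff_completion B M).
    \<forall>a\<in>carrier A. \<Phi> (completion_embed A N a) = completion_embed B M (\<phi> a)"
proof -
  interpret A: cstar_seminorm A N by fact
  interpret B: cstar_seminorm B M by fact
  note p = star_hom_props[OF \<phi>]
  note pd = star_hom_diff[OF A.star_algebra_axioms B.star_algebra_axioms \<phi>]
  have cs: "(\<lambda>n. \<phi> (x n)) \<in> B.CS" if x: "x \<in> A.CS" for x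
    unfolding cauchy_seqs_def
  proof (intro CollectI conjI allI impI)
    show "range (\<lambda>n. \<phi> (x n)) \<subseteq> carrier B" using p(1) A.cs_carrier[OF x] by auto
    fix e :: real assume "e > 0"
    from A.cs_cauchy[OF x this] show "\<exists>K. \<forall>m\<ge>K. \<forall>n\<ge>K. M (\<phi> (x m) \<ominus>\<^bsub>B\<^esub> \<phi> (x n)) < e"
      using le A.cs_carrier[OF x] by (simp add: pd[symmetric]) (meson A.minus_closed le_less_trans)
  qed
  have rel: "(\<lambda>n. \<phi> (x n), \<lambda>n. \<phi> (y n)) \<in> B.NR" if "(x, y) \<in> A.NR" for x y
    using that by (intro B.NR_boundI[where f = "\<lambda>n. N (x n \<ominus>\<^bsub>A\<^esub> y n)"])
      (auto simp: A.NR_iff cs pd[symmetric] A.cs_carrier le)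
  define \<Phi> where "\<Phi> = (\<lambda>X. \<Union>x\<in>X. B.cls (\<lambda>n. \<phi> (x n)))"
  have \<Phi>: "\<Phi> (A.cls x) = B.cls (\<lambda>n. \<phi> (x n))" if "x \<in> A.CS" for x
  proof -
    have "congruent A.NR (\<lambda>x. B.cls (\<lambda>n. \<phi> (x n)))"
      by (rule congruentI, rule equiv_class_eq[OF B.NR_equiv], rule rel)
    from UN_equiv_class[OF A.NR_equiv this that] show ?thesis by (simp add: \<Phi>_def)
  qed
  have "\<Phi> \<in> star_hom A.HC B.HC"
  proof (rule star_homI)
    fix X Y c assume "X \<in> carrier A.HC" "Y \<in> carrier A.HC"
    then obtain x y where "x \<in> A.CS" "X = A.cls x" "y \<in> A.CS" "Y = A.cls y" by (metis A.HC_carrierE)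
    then show "\<Phi> (X \<oplus>\<^bsub>A.HC\<^esub> Y) = \<Phi> X \<oplus>\<^bsub>B.HC\<^esub> \<Phi> Y" "\<Phi> (X \<otimes>\<^bsub>A.HC\<^esub> Y) = \<Phi> X \<otimes>\<^bsub>B.HC\<^esub> \<Phi> Y"
      by (simp_all add: \<Phi> A.HC_add B.HC_add A.HC_mult B.HC_mult A.cs_add A.cs_mult cs p A.cs_carrier)
  next
    fix X c assume "X \<in> carrier A.HC"
    then obtain x where "x \<in> A.CS" "X = A.cls x" by (metis A.HC_carrierE)
    then show "\<Phi> X \<in> carrier B.HC" "\<Phi> (c \<odot>\<^bsub>A.HC\<^esub> X) = c \<odot>\<^bsub>B.HC\<^esub> \<Phi> X" "\<Phi> (star A.HC X) = star B.HC (\<Phi> X)"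
      by (simp_all add: \<Phi> A.HC_smult B.HC_smult A.HC_star B.HC_star A.cs_smult A.cs_star cs p A.cs_carrier
          B.cls_carrier)
  qed
  moreover have "\<forall>a\<in>carrier A. \<Phi> (completion_embed A N a) = completion_embed B M (\<phi> a)"
    by (simp add: completion_embed_def \<Phi> A.cs_const)
  ultimately show ?thesis by blast
qed

lemma (in cstar_algebra) completion_embed_bij:
  "bij_betw (completion_embed A (cnorm A)) (carrier A) (carrier (hausdorff_completion A (cnorm A)))"
proof -
  let ?j = "completion_embed A (cnorm A)"
  interpret M: Metric_space "carrier A" "cdist A" by (rule Metric_space)
  have "inj_on ?j (carrier A)"
  proof (rule inj_onI)
    fix x y assume xy: "x \<in> carrier A" "y \<in> carrier A" "?j x = ?j y"
    then have "(\<lambda>n::nat. cnorm A (x \<ominus> y)) \<longlonglongrightarrow> 0"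
      by (simp add: completion_embed_def cls_eq_iff cs_const)
    then have "cnorm A (x \<ominus> y) = 0" by (simp add: LIMSEQ_const_iff)
    then show "x = y" using xy by (intro eqI_norm) auto
  qed
  moreover have "X \<in> ?j ` carrier A" if "X \<in> carrier HC" for X
  proof -
    obtain x where x: "x \<in> CS" "X = cls x" using \<open>X \<in> carrier HC\<close> by (rule HC_carrierE)
    have "M.MCauchy x"
      using x(1) by (simp add: M.MCauchy_def cauchy_seqs_def cdist_def image_subset_iff)
    then obtain a where "limitin M.mtopology x a sequentially"
      using complete unfolding M.mcomplete_def by blast
    then have a: "a \<in> carrier A" and "(\<lambda>n. cdist A (x n) a) \<longlonglongrightarrow> 0"
      by (auto simp: M.limitin_metric_dist_null)
    then have "X = ?j a"
      using x by (simp add: completion_embed_def cls_eq_iff cs_const cdist_def cs_carrier)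
    then show ?thesis using a by blast
  qed
  ultimately show ?thesis by (auto simp: bij_betw_def completion_embed_carrier)
qed

lemma completion_extend:
  assumes "cstar_seminorm A N" "cstar_algebra B" "\<phi> \<in> star_hom A B"
    and le: "\<And>a. a \<in> carrier A \<Longrightarrow> cnorm B (\<phi> a) \<le> N a"
  shows "\<exists>\<Phi>\<in>star_hom (hausdorff_completion A N) B. \<forall>a\<in>carrier A. \<Phi> (completion_embed A N a) = \<phi> a"
proof -
  interpret A: cstar_seminorm A N by fact
  interpret B: cstar_algebra B by fact
  let ?j = "completion_embed B (cnorm B)" and ?B = "hausdorff_completion B (cnorm B)"
  obtain \<Phi> where \<Phi>: "\<Phi> \<in> star_hom A.HC ?B" "\<And>a. a \<in> carrier A \<Longrightarrow> \<Phi> (completion_embed A N a) = ?j (\<phi> a)"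
    using completion_map[OF assms(1) B.cstar_seminorm_axioms assms(3) le] by blast
  let ?i = "inv_into (carrier B) ?j"
  have i: "?i \<in> star_hom ?B B"
    by (rule star_hom_inv[OF B.star_algebra_axioms B.completion_embed_hom B.completion_embed_bij])
  have "?i (?j b) = b" if "b \<in> carrier B" for b
    using that B.completion_embed_bij by (auto simp: bij_betw_def inv_into_f_f)
  then show ?thesis
    using star_hom_comp[OF \<Phi>(1) i] star_hom_props(1)[OF assms(3)]
    by (intro bexI[of _ "\<lambda>X. ?i (\<Phi> X)"]) (auto simp: \<Phi>(2))
qed

lemma completion_hom_unique:
  assumes "cstar_seminorm A N" "cstar_algebra B"
    and \<phi>: "\<phi> \<in> star_hom (hausdorff_completion A N) B" and \<psi>: "\<psi> \<in> star_hom (hausdorff_completion A N) B"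
    and eq: "\<And>a. a \<in> carrier A \<Longrightarrow> \<phi> (completion_embed A N a) = \<psi> (completion_embed A N a)"
    and X: "X \<in> carrier (hausdorff_completion A N)"
  shows "\<phi> X = \<psi> X"
proof -
  interpret A: cstar_seminorm A N by fact
  interpret H: cstar_algebra A.HC by (rule A.cstar_algebra_HC)
  interpret B: cstar_algebra B by fact
  have c: "\<phi> X \<in> carrier B" "\<psi> X \<in> carrier B" using star_hom_props(1)[OF \<phi> X] star_hom_props(1)[OF \<psi> X] .
  have "cnorm B (\<phi> X \<ominus>\<^bsub>B\<^esub> \<psi> X) \<le> 0 + e" if e: "e > 0" for e
  proof -
    obtain a where a: "a \<in> carrier A" "cdist A.HC X (completion_embed A N a) < e / 2"
      using A.completion_dense[OF X, of "e / 2"] e by auto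
    let ?a = "completion_embed A N a"
    have ac: "?a \<in> carrier A.HC" using a A.completion_embed_carrier by blast
    have d: "cnorm B (\<theta> X \<ominus>\<^bsub>B\<^esub> \<theta> ?a) \<le> e / 2" if "\<theta> \<in> star_hom A.HC B" for \<theta>
    proof -
      have "\<theta> X \<ominus>\<^bsub>B\<^esub> \<theta> ?a = \<theta> (X \<ominus>\<^bsub>A.HC\<^esub> ?a)"
        using star_hom_diff[OF H.star_algebra_axioms B.star_algebra_axioms that X ac] by simp
      moreover have "cnorm B (\<theta> (X \<ominus>\<^bsub>A.HC\<^esub> ?a)) \<le> cnorm A.HC (X \<ominus>\<^bsub>A.HC\<^esub> ?a)"
        by (rule star_hom_contractive[OF A.cstar_algebra_HC assms(2) that]) (use X ac in simp)
      ultimately show ?thesis using a X ac by (simp add: cdist_def)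
    qed
    have ca: "\<phi> ?a \<in> carrier B" using star_hom_props(1)[OF \<phi> ac] .
    have "cnorm B (\<phi> X \<ominus>\<^bsub>B\<^esub> \<psi> X) \<le> cnorm B (\<phi> X \<ominus>\<^bsub>B\<^esub> \<phi> ?a) + cnorm B (\<phi> ?a \<ominus>\<^bsub>B\<^esub> \<psi> X)"
      by (rule B.seminorm_triangle[OF c(1) ca c(2)])
    also have "cnorm B (\<phi> ?a \<ominus>\<^bsub>B\<^esub> \<psi> X) = cnorm B (\<psi> X \<ominus>\<^bsub>B\<^esub> \<psi> ?a)"
      using B.seminorm_diff_commute[OF ca c(2)] eq[OF a(1)] by simp
    finally show ?thesis using d[OF \<phi>] d[OF \<psi>] by simp
  qed
  then have "cnorm B (\<phi> X \<ominus>\<^bsub>B\<^esub> \<psi> X) \<le> 0" by (rule field_le_epsilon)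
  then show ?thesis by (rule B.eqI_norm[OF c])
qed


subsection \<open>The universal property of the free star-algebra\<close>

definition letter_ev :: "('b, 'm) star_alg_scheme \<Rightarrow> ('g \<Rightarrow> 'b) \<Rightarrow> 'g \<times> bool \<Rightarrow> 'b" where
  "letter_ev B q l = (if snd l then star B (q (fst l)) else q (fst l))"

fun list_ev :: "('b, 'm) star_alg_scheme \<Rightarrow> ('g \<Rightarrow> 'b) \<Rightarrow> ('g \<times> bool) list \<Rightarrow> 'b" where
  "list_ev B q [] = \<zero>\<^bsub>B\<^esub>"
| "list_ev B q [l] = letter_ev B q l"
| "list_ev B q (l # m # ls) = letter_ev B q l \<otimes>\<^bsub>B\<^esub> list_ev B q (m # ls)"

definition lin_ev :: "('b, 'm) star_alg_scheme \<Rightarrow> ('g \<Rightarrow> 'b) \<Rightarrow> ('g star_word \<Rightarrow>\<^sub>0 complex) \<Rightarrow> 'b" where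
  "lin_ev B q f =
     finsum B (\<lambda>w. Poly_Mapping.lookup f w \<odot>\<^bsub>B\<^esub> list_ev B q (letters w)) (Poly_Mapping.keys f)"

context star_algebra
begin

context
  fixes q :: "'g \<Rightarrow> 'a" and X :: "'g set"
  assumes q: "q \<in> X \<rightarrow> carrier A"
begin

lemma q_closed: "g \<in> X \<Longrightarrow> q g \<in> carrier A"
  using q by auto

lemma letter_ev_closed: "fst l \<in> X \<Longrightarrow> letter_ev A q l \<in> carrier A"
  by (auto simp: letter_ev_def star_closed q_closed)

lemma list_ev_closed: "fst ` set ls \<subseteq> X \<Longrightarrow> list_ev A q ls \<in> carrier A"
  by (induction ls rule: induct_list012) (auto simp: letter_ev_closed mult_closed)

lemma list_ev_Cons:
  "ls \<noteq> [] \<Longrightarrow> list_ev A q (l # ls) = letter_ev A q l \<otimes> list_ev A q ls"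
  by (cases ls) auto

lemma list_ev_append:
  "\<lbrakk>ls \<noteq> []; ms \<noteq> []; fst ` set ls \<subseteq> X; fst ` set ms \<subseteq> X\<rbrakk> \<Longrightarrow>
    list_ev A q (ls @ ms) = list_ev A q ls \<otimes> list_ev A q ms"
  by (induction ls rule: list_nonempty_induct)
    (auto simp: list_ev_Cons letter_ev_closed list_ev_closed mult_assoc)

lemma list_ev_adj:
  "\<lbrakk>ls \<noteq> []; fst ` set ls \<subseteq> X\<rbrakk> \<Longrightarrow>
    list_ev A q (rev (map (\<lambda>(g, b). (g, \<not> b)) ls)) = star A (list_ev A q ls)"
proof (induction ls rule: list_nonempty_induct)
  case (single l)
  then show ?case by (auto simp: letter_ev_def case_prod_unfold star_star q_closed)
next
  case (cons l ls)
  have l: "letter_ev A q (case l of (g, b) \<Rightarrow> (g, \<not> b)) = star A (letter_ev A q l)"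
    using cons by (auto simp: letter_ev_def case_prod_unfold star_star q_closed)
  have "list_ev A q (rev (map (\<lambda>(g, b). (g, \<not> b)) ls) @ [case l of (g, b) \<Rightarrow> (g, \<not> b)]) =
     list_ev A q (rev (map (\<lambda>(g, b). (g, \<not> b)) ls)) \<otimes> list_ev A q [case l of (g, b) \<Rightarrow> (g, \<not> b)]"
    using cons by (intro list_ev_append) (auto simp: case_prod_unfold image_image)
  then show ?case using cons
    by (simp add: l list_ev_Cons star_mult letter_ev_closed list_ev_closed)
qed

lemma word_ev_closed: "w \<in> gen_words X \<Longrightarrow> list_ev A q (letters w) \<in> carrier A"
  by (auto simp: gen_words_def intro: list_ev_closed)

lemma word_ev_mult:
  "\<lbrakk>v \<in> gen_words X; w \<in> gen_words X\<rbrakk> \<Longrightarrow>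
    list_ev A q (letters (v + w)) = list_ev A q (letters v) \<otimes> list_ev A q (letters w)"
  by (auto simp: gen_words_def plus_star_word_def intro: list_ev_append)

lemma word_ev_adj:
  "w \<in> gen_words X \<Longrightarrow> list_ev A q (letters (adj_word w)) = star A (list_ev A q (letters w))"
  by (auto simp: gen_words_def adj_word_def intro: list_ev_adj)

lemma lin_ev_superset:
  assumes "finite S" "Poly_Mapping.keys f \<subseteq> S" "S \<subseteq> gen_words X"
  shows "lin_ev A q f = finsum A (\<lambda>w. Poly_Mapping.lookup f w \<odot> list_ev A q (letters w)) S"
  unfolding lin_ev_def
  by (rule add.finprod_mono_neutral_cong_left)
    (use assms word_ev_closed in \<open>auto simp: in_keys_iff smult_zero_left smult_closed\<close>)

lemma lin_ev_closed: "f \<in> carrier (free_star_algebra X) \<Longrightarrow> lin_ev A q f \<in> carrier A"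
  unfolding lin_ev_def free_carrier
  by (intro finsum_closed) (auto intro!: smult_closed word_ev_closed)

lemma lin_ev_single: "w \<in> gen_words X \<Longrightarrow> lin_ev A q (Poly_Mapping.single w c) = c \<odot> list_ev A q (letters w)"
  using lin_ev_superset[of "{w}" "Poly_Mapping.single w c"] word_ev_closed[of w]
  by (auto simp: smult_closed)

lemma lin_ev_zero: "lin_ev A q 0 = \<zero>"
  by (simp add: lin_ev_def)

lemma lin_ev_add:
  assumes "f \<in> carrier (free_star_algebra X)" "g \<in> carrier (free_star_algebra X)"
  shows "lin_ev A q (f + g) = lin_ev A q f \<oplus> lin_ev A q g"
proof -
  let ?S = "Poly_Mapping.keys f \<union> Poly_Mapping.keys g"
  have S: "finite ?S" "?S \<subseteq> gen_words X" using assms by (auto simp: free_carrier)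
  have k: "Poly_Mapping.keys (f + g) \<subseteq> ?S" by (rule Poly_Mapping.keys_add)
  have c: "\<And>w. w \<in> ?S \<Longrightarrow> list_ev A q (letters w) \<in> carrier A" using S word_ev_closed by blast
  have "lin_ev A q (f + g) =
    finsum A (\<lambda>w. Poly_Mapping.lookup f w \<odot> list_ev A q (letters w) \<oplus>
      Poly_Mapping.lookup g w \<odot> list_ev A q (letters w)) ?S"
    unfolding lin_ev_superset[OF S(1) k S(2)]
    by (rule finsum_cong') (use c in \<open>auto simp: lookup_add smult_l_distr smult_closed\<close>)
  also have "\<dots> = lin_ev A q f \<oplus> lin_ev A q g"
    unfolding lin_ev_superset[OF S(1) Un_upper1 S(2)] lin_ev_superset[OF S(1) Un_upper2 S(2)]
    by (rule finsum_addf) (use c in \<open>auto simp: smult_closed\<close>)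
  finally show ?thesis .
qed

lemma lin_ev_smult:
  "f \<in> carrier (free_star_algebra X) \<Longrightarrow> lin_ev A q (Poly_Mapping.map ((*) c) f) = c \<odot> lin_ev A q f"
proof (induction f rule: free_induct)
  case zero
  have "Poly_Mapping.map ((*) c) (0 :: 'g star_word \<Rightarrow>\<^sub>0 complex) = 0" by (rule poly_mapping_eqI) (simp add: lookup_smult)
  then show ?case by (simp add: lin_ev_zero smult_zero_right)
next
  case (add f g)
  have "Poly_Mapping.map ((*) c) (f + g) = Poly_Mapping.map ((*) c) f + Poly_Mapping.map ((*) c) g"
    by (rule poly_mapping_eqI) (simp add: lookup_smult lookup_add distrib_left)
  then show ?case using add by (simp add: lin_ev_add free_closed' smult_r_distr lin_ev_closed)
qed (simp add: lin_ev_single smult_assoc word_ev_closed)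

lemma single_free_carrier: "w \<in> gen_words X \<Longrightarrow> Poly_Mapping.single w c \<in> carrier (free_star_algebra X)"
  by (auto simp: free_carrier)

lemma lin_ev_star:
  "f \<in> carrier (free_star_algebra X) \<Longrightarrow>
    lin_ev A q (Poly_Mapping.map_key adj_word (Poly_Mapping.map cnj f)) = star A (lin_ev A q f)"
proof (induction f rule: free_induct)
  case (add f g)
  then show ?case by (simp add: free_star_add lin_ev_add free_closed' star_add lin_ev_closed)
qed (simp_all add: free_star_zero lin_ev_zero star_zero lin_ev_single word_ev_adj star_smult word_ev_closed)

lemma lin_ev_mult:
  assumes f: "f \<in> carrier (free_star_algebra X)" and g: "g \<in> carrier (free_star_algebra X)"
  shows "lin_ev A q (f * g) = lin_ev A q f \<otimes> lin_ev A q g"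
  using f
proof (induction f rule: free_induct)
  case zero
  then show ?case using g by (simp add: lin_ev_zero mult_zero_left lin_ev_closed)
next
  case (add f f')
  then show ?case using g by (simp add: distrib_right lin_ev_add free_closed(2) mult_l_distr lin_ev_closed)
next
  case (single w c)
  note w = single single_free_carrier[OF single, of c]
  show ?case using g
  proof (induction g rule: free_induct)
    case zero
    then show ?case using w by (simp add: lin_ev_zero mult_zero_right lin_ev_closed)
  next
    case (add g g')
    then show ?case using w by (simp add: distrib_left lin_ev_add free_closed(2) mult_r_distr lin_ev_closed)
  next
    case (single v d)
    then show ?case using w
      by (simp add: mult_single lin_ev_single plus_gen_words word_ev_mult word_ev_closed
          smult_mult_left smult_mult_right smult_assoc[symmetric] mult.commute smult_closed mult_closed)
  qed
qed

theorem lin_ev_hom: "lin_ev A q \<in> star_hom (free_star_algebra X) A"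
  by (rule star_homI) (simp_all add: lin_ev_closed lin_ev_add lin_ev_smult lin_ev_mult lin_ev_star)

lemma lin_ev_gen: "g \<in> X \<Longrightarrow> lin_ev A q (free_gen g) = q g"
  by (auto simp: free_gen_def lin_ev_single gen_words_def letter_ev_def smult_one q_closed)

end

lemma free_hom_unique:
  assumes \<phi>: "\<phi> \<in> star_hom (free_star_algebra X) A" and \<psi>: "\<psi> \<in> star_hom (free_star_algebra X) A"
    and eq: "\<And>g. g \<in> X \<Longrightarrow> \<phi> (free_gen g) = \<psi> (free_gen g)"
    and f: "f \<in> carrier (free_star_algebra X)"
  shows "\<phi> f = \<psi> f"
proof -
  note p = star_hom_props[OF \<phi>] and r = star_hom_props[OF \<psi>]
  let ?F = "free_star_algebra X"
  have s: "Poly_Mapping.single (Star_Word ls) 1 \<in> carrier ?F" if "ls \<noteq> []" "fst ` set ls \<subseteq> X" for ls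
    using that by (auto simp: free_carrier gen_words_def)
  have l: "\<phi> (Poly_Mapping.single (Star_Word [l]) 1) = \<psi> (Poly_Mapping.single (Star_Word [l]) 1)"
    if "fst l \<in> X" for l
  proof (cases l)
    case (Pair g b)
    have g: "free_gen g \<in> carrier ?F" using that Pair by (auto intro: free_gen_carrier)
    have "Poly_Mapping.single (Star_Word [l]) 1 = (if b then star ?F (free_gen g) else free_gen g)"
      using Pair by (auto simp: free_gen_def adj_word_def)
    then show ?thesis using g p(5) r(5) eq[of g] that Pair by (auto simp del: free_ops)
  qed
  have w: "\<phi> (Poly_Mapping.single (Star_Word ls) 1) = \<psi> (Poly_Mapping.single (Star_Word ls) 1)"
    if "ls \<noteq> []" "fst ` set ls \<subseteq> X" for ls
    using that
  proof (induction ls rule: list_nonempty_induct)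
    case (single m)
    then show ?case using l by auto
  next
    case (cons m ls)
    have "Poly_Mapping.single (Star_Word (m # ls)) 1 =
      (Poly_Mapping.single (Star_Word [m]) 1 * Poly_Mapping.single (Star_Word ls) 1 :: _ \<Rightarrow>\<^sub>0 complex)"
      by (simp add: mult_single plus_star_word_def)
    then show ?case
      using p(4)[OF s s, of "[m]" ls] r(4)[OF s s, of "[m]" ls] cons l[of m] by simp
  qed
  show ?thesis using f
  proof (induction f rule: free_induct)
    case zero
    then show ?case
      using star_hom_zero[OF star_algebra_free star_algebra_axioms \<phi>]
        star_hom_zero[OF star_algebra_free star_algebra_axioms \<psi>] by simp
  next
    case (single w c)
    then have 1: "letters w \<noteq> []" "fst ` set (letters w) \<subseteq> X" by (auto simp: gen_words_def)
    have "Poly_Mapping.single w c = c \<odot>\<^bsub>?F\<^esub> Poly_Mapping.single (Star_Word (letters w)) 1" by simp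
    then show ?case using p(3)[OF s[OF 1]] r(3)[OF s[OF 1]] w[OF 1] by (simp del: free_ops)
  next
    case (add f g)
    then show ?case using p(2)[of f g] r(2)[of f g] by simp
  qed
qed

end


section \<open>Universal property of graph C*-algebras, existence of the gauge action\<close>

subsection \<open>Transport of the Cuntz--Krieger relations\<close>

context
  fixes E :: "('v, 'e) pre_digraph" and A :: "('a, 'm) star_alg_scheme" and B :: "('b, 'n) star_alg_scheme"
    and p :: "'v \<Rightarrow> 'a" and s :: "'e \<Rightarrow> 'a" and q :: "'v \<Rightarrow> 'b" and t :: "'e \<Rightarrow> 'b" and \<phi> :: "'a \<Rightarrow> 'b"
  assumes E: "wf_digraph E" and A: "star_algebra A" and B: "star_algebra B" and \<phi>: "\<phi> \<in> star_hom A B"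
    and p: "\<And>v. v \<in> verts E \<Longrightarrow> p v \<in> carrier A" and s: "\<And>e. e \<in> arcs E \<Longrightarrow> s e \<in> carrier A"
    and q: "\<And>v. v \<in> verts E \<Longrightarrow> q v = \<phi> (p v)" and t: "\<And>e. e \<in> arcs E \<Longrightarrow> t e = \<phi> (s e)"
begin

private lemma hd: "e \<in> arcs E \<Longrightarrow> head E e \<in> verts E" "e \<in> arcs E \<Longrightarrow> tail E e \<in> verts E"
  using E by (auto simp: wf_digraph_def)

private lemmas cl = p s hd star_algebra.mult_closed[OF A] star_algebra.star_closed[OF A]
private lemmas hom = star_hom_props[OF \<phi>]

private lemma sum_eq:
  assumes "finite F" "F \<subseteq> arcs E"
  shows "finsum B (\<lambda>e. t e \<otimes>\<^bsub>B\<^esub> star B (t e)) F = \<phi> (finsum A (\<lambda>e. s e \<otimes>\<^bsub>A\<^esub> star A (s e)) F)"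
proof -
  interpret B: star_algebra B by (rule B)
  have c: "\<phi> (s e) \<in> carrier B" if "e \<in> F" for e using that assms s hom(1) by blast
  have "\<phi> (finsum A (\<lambda>e. s e \<otimes>\<^bsub>A\<^esub> star A (s e)) F) = finsum B (\<lambda>e. \<phi> (s e \<otimes>\<^bsub>A\<^esub> star A (s e))) F"
    by (rule star_hom_finsum[OF A B \<phi> assms(1)]) (use assms cl in auto)
  also have "\<dots> = finsum B (\<lambda>e. t e \<otimes>\<^bsub>B\<^esub> star B (t e)) F"
    by (rule B.finsum_cong') (use assms cl t hom c B.mult_closed B.star_closed in \<open>auto simp: subset_iff\<close>)
  finally show ?thesis by simp
qed

lemma ck_equations_closed: "ck_equations E A p s \<subseteq> carrier A \<times> carrier A"
proof -
  interpret A: star_algebra A by (rule A)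
  have "a \<in> carrier A \<and> b \<in> carrier A" if "(a, b) \<in> ck_equations E A p s" for a b
    using that by cases (auto simp: cl intro!: A.finsum_closed)
  then show ?thesis by auto
qed

lemma ck_equations_hom:
  assumes "(a, b) \<in> ck_equations E A p s"
  shows "(\<phi> a, \<phi> b) \<in> ck_equations E B q t"
  using assms
proof cases
  case (proj_adjoint v)
  then show ?thesis using ck_equations.proj_adjoint[where E = E and A = B and p = q and s = t, of v] by (simp add: q hom cl)
next
  case (proj_idem v)
  then show ?thesis using ck_equations.proj_idem[where E = E and A = B and p = q and s = t, of v] by (simp add: q hom cl)
next
  case (proj_orth v w)
  then show ?thesis using ck_equations.proj_orth[where E = E and A = B and p = q and s = t, of v w]
    by (simp add: q hom cl star_hom_zero[OF A B \<phi>])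
next
  case (partial_isom e)
  then show ?thesis using ck_equations.partial_isom[where E = E and A = B and p = q and s = t, of e] by (simp add: t hom cl)
next
  case (range_orth e f)
  then show ?thesis using ck_equations.range_orth[where E = E and A = B and p = q and s = t, of e f]
    by (simp add: t hom cl star_hom_zero[OF A B \<phi>])
next
  case (source_proj e)
  then show ?thesis using ck_equations.source_proj[where E = E and A = B and p = q and s = t, of e] by (simp add: q t hom cl)
next
  case (range_proj e)
  then show ?thesis using ck_equations.range_proj[where E = E and A = B and p = q and s = t, of e] by (simp add: q t hom cl)
next
  case (ck_sum v)
  then show ?thesis using ck_equations.ck_sum[where E = E and A = B and p = q and s = t, of v] sum_eq[of "{e \<in> arcs E. head E e = v}"]
    by (simp add: q)
qed

lemma ck_equations_hom_inv:
  assumes "(x, y) \<in> ck_equations E B q t"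
  shows "\<exists>a b. (a, b) \<in> ck_equations E A p s \<and> x = \<phi> a \<and> y = \<phi> b"
  using assms
proof cases
  case (proj_adjoint v)
  then show ?thesis using ck_equations.proj_adjoint[where E = E and A = A and p = p and s = s, of v] by (force simp: q hom cl)
next
  case (proj_idem v)
  then show ?thesis using ck_equations.proj_idem[where E = E and A = A and p = p and s = s, of v] by (force simp: q hom cl)
next
  case (proj_orth v w)
  then show ?thesis using ck_equations.proj_orth[where E = E and A = A and p = p and s = s, of v w]
    by (force simp: q hom cl star_hom_zero[OF A B \<phi>])
next
  case (partial_isom e)
  then show ?thesis using ck_equations.partial_isom[where E = E and A = A and p = p and s = s, of e] by (force simp: t hom cl)
next
  case (range_orth e f)
  then show ?thesis using ck_equations.range_orth[where E = E and A = A and p = p and s = s, of e f]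
    by (force simp: t hom cl star_hom_zero[OF A B \<phi>])
next
  case (source_proj e)
  then show ?thesis using ck_equations.source_proj[where E = E and A = A and p = p and s = s, of e] by (force simp: q t hom cl)
next
  case (range_proj e)
  then show ?thesis using ck_equations.range_proj[where E = E and A = A and p = p and s = s, of e] by (force simp: q t hom cl)
next
  case (ck_sum v)
  then show ?thesis using ck_equations.ck_sum[where E = E and A = A and p = p and s = s, of v] sum_eq[of "{e \<in> arcs E. head E e = v}"]
    by (force simp: q)
qed

end


subsection \<open>The graph C*-algebra\<close>

abbreviation (input) ck_relations ::
    "('v, 'e) pre_digraph \<Rightarrow>
     (('v, 'e) ck_gen star_word \<Rightarrow>\<^sub>0 complex) rel" where
  "ck_relations E \<equiv> ck_equations E (ck_free_algebra E)
     (\<lambda>v. free_gen (Proj_Gen v)) (\<lambda>e. free_gen (Isom_Gen e))"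

lemma ck_free_gen_carrier:
  "v \<in> verts E \<Longrightarrow> free_gen (Proj_Gen v) \<in> carrier (ck_free_algebra E)"
  "e \<in> arcs E \<Longrightarrow> free_gen (Isom_Gen e) \<in> carrier (ck_free_algebra E)"
  by (auto simp: ck_free_algebra_def intro!: free_gen_carrier)

lemma star_algebra_ck_free: "star_algebra (ck_free_algebra E)"
  by (simp add: ck_free_algebra_def star_algebra_free)

lemma id_star_hom: "(\<lambda>x. x) \<in> star_hom A A"
  by (simp add: star_hom_def)

lemma ck_relations_closed:
  "wf_digraph E \<Longrightarrow> ck_relations E \<subseteq> carrier (ck_free_algebra E) \<times> carrier (ck_free_algebra E)"
  by (rule ck_equations_closed[OF _ star_algebra_ck_free star_algebra_ck_free id_star_hom])
    (auto simp: ck_free_gen_carrier)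

lemma ck_seminorm_bounded:
  fixes E :: "('v, 'e) pre_digraph"
  assumes E: "wf_digraph E" and f: "f \<in> carrier (ck_free_algebra E)"
  shows "bdd_above ((\<lambda>N. N f) ` admissible (ck_free_algebra E) (ck_relations E))"
proof -
  let ?F = "ck_free_algebra E" and ?X = "Proj_Gen ` verts E \<union> Isom_Gen ` arcs E :: ('v, 'e) ck_gen set"
  interpret F: star_algebra ?F by (rule star_algebra_ck_free)
  have ops: "mult ?F = (*)" "smult ?F = smult (free_star_algebra ?X)" "star ?F = star (free_star_algebra ?X)"
    "add ?F = (+)" "zero ?F = 0"
    by (simp_all add: ck_free_algebra_def)
  have tl: "tail E e \<in> verts E" if "e \<in> arcs E" for e using E that by (auto simp: wf_digraph_def)
  have letter: "N (Poly_Mapping.single (Star_Word [l]) 1) \<le> 1"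
    if N: "N \<in> admissible ?F (ck_relations E)" and l: "fst l \<in> ?X" for N l
  proof -
    interpret cstar_seminorm ?F N using N by (simp add: admissible_def)
    have rel: "N (a \<ominus>\<^bsub>?F\<^esub> b) = 0" "a \<in> carrier ?F" "b \<in> carrier ?F" "N a = N b" if ab: "(a, b) \<in> ck_relations E" for a b
    proof -
      show 1: "N (a \<ominus>\<^bsub>?F\<^esub> b) = 0" using ab N by (auto simp: admissible_def)
      show 2: "a \<in> carrier ?F" "b \<in> carrier ?F" using ck_relations_closed[OF E] ab by auto
      show "N a = N b" using seminorm_diff_abs[OF 2] 1 by simp
    qed
    have pg: "N (free_gen (Proj_Gen v)) \<le> 1" if v: "v \<in> verts E" for v
    proof -
      let ?p = "free_gen (Proj_Gen v)"
      have c: "?p \<in> carrier ?F" "star ?F ?p \<in> carrier ?F" using ck_free_gen_carrier(1)[OF v] F.star_closed by blast+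
      note r1 = rel[OF ck_equations.proj_adjoint[OF v]] and r2 = rel[OF ck_equations.proj_idem[OF v]]
      have "N (star ?F ?p \<otimes>\<^bsub>?F\<^esub> ?p \<ominus>\<^bsub>?F\<^esub> ?p \<otimes>\<^bsub>?F\<^esub> ?p) \<le> N (star ?F ?p \<ominus>\<^bsub>?F\<^esub> ?p) * N ?p"
        using seminorm_mult[of "star ?F ?p \<ominus>\<^bsub>?F\<^esub> ?p" ?p] c by (simp add: F.mult_diff_left)
      then have "N (star ?F ?p \<otimes>\<^bsub>?F\<^esub> ?p) = N (?p \<otimes>\<^bsub>?F\<^esub> ?p)"
        using r1(1) seminorm_diff_abs[of "star ?F ?p \<otimes>\<^bsub>?F\<^esub> ?p" "?p \<otimes>\<^bsub>?F\<^esub> ?p"] c F.mult_closed by simp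
      then have "(N ?p)\<^sup>2 = N ?p" using seminorm_star[OF c(1)] r2(4) by simp
      then have "N ?p = 0 \<or> N ?p = 1" by (simp add: power2_eq_square)
      then show ?thesis by auto
    qed
    have sg: "N (free_gen (Isom_Gen e)) \<le> 1" if e: "e \<in> arcs E" for e
    proof -
      have "(N (free_gen (Isom_Gen e)))\<^sup>2 \<le> 1"
        using seminorm_star[OF ck_free_gen_carrier(2)[OF e]] rel(4)[OF ck_equations.source_proj[OF e]] pg[OF tl[OF e]]
        by simp
      then show ?thesis using power2_le_imp_le[of "N (free_gen (Isom_Gen e))" 1] by simp
    qed
    have g: "N (free_gen (fst l)) \<le> 1" and gc: "free_gen (fst l) \<in> carrier ?F"
      using l pg sg ck_free_gen_carrier by auto
    have "Poly_Mapping.single (Star_Word [l]) 1 = (if snd l then star ?F (free_gen (fst l)) else free_gen (fst l))"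
      by (cases l) (auto simp: ops free_gen_def adj_word_def)
    then show ?thesis using g gc seminorm_adj by auto
  qed
  have word: "N (Poly_Mapping.single (Star_Word ls) 1) \<le> 1"
    if N: "N \<in> admissible ?F (ck_relations E)" and "ls \<noteq> []" "fst ` set ls \<subseteq> ?X" for N ls
    using that(2,3)
  proof (induction ls rule: list_nonempty_induct)
    case (single m)
    then show ?case using letter[OF N] by auto
  next
    case (cons m ls)
    interpret cstar_seminorm ?F N using N by (simp add: admissible_def)
    let ?a = "Poly_Mapping.single (Star_Word [m]) 1" and ?b = "Poly_Mapping.single (Star_Word ls) 1"
    have c: "?a \<in> carrier ?F" "?b \<in> carrier ?F"
      using cons unfolding ck_free_algebra_def free_carrier by (auto simp: gen_words_def)
    have "Poly_Mapping.single (Star_Word (m # ls)) 1 = ?a \<otimes>\<^bsub>?F\<^esub> ?b"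
      by (simp add: ops mult_single plus_star_word_def)
    then have "N (Poly_Mapping.single (Star_Word (m # ls)) 1) \<le> N ?a * N ?b" using seminorm_mult[OF c] by simp
    also have "\<dots> \<le> 1 * 1"
      using cons letter[OF N, of m] by (intro mult_mono seminorm_nonneg c) auto
    finally show ?case by simp
  qed
  from f have "\<exists>b. \<forall>N\<in>admissible ?F (ck_relations E). N f \<le> b"
    unfolding ck_free_algebra_def
  proof (induction f rule: free_induct)
    case zero
    have "N 0 \<le> 0" if "N \<in> admissible ?F (ck_relations E)" for N
      using cstar_seminorm.seminorm_zero[of ?F N] that by (simp add: admissible_def ops)
    then show ?case unfolding ck_free_algebra_def by blast
  next
    case (single w c)
    have 1: "letters w \<noteq> []" "fst ` set (letters w) \<subseteq> ?X" using single by (auto simp: gen_words_def)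
    have "N (Poly_Mapping.single w c) \<le> cmod c" if N: "N \<in> admissible ?F (ck_relations E)" for N
    proof -
      interpret cstar_seminorm ?F N using N by (simp add: admissible_def)
      have k: "Poly_Mapping.single (Star_Word (letters w)) 1 \<in> carrier ?F"
        using single unfolding ck_free_algebra_def free_carrier by auto
      have "Poly_Mapping.single w c = c \<odot>\<^bsub>?F\<^esub> Poly_Mapping.single (Star_Word (letters w)) 1" by (simp add: ops)
      then show ?thesis using seminorm_smult[OF k, of c] word[OF N 1] by (simp add: mult_left_le)
    qed
    then show ?case unfolding ck_free_algebra_def by blast
  next
    case (add f g)
    then obtain b c where bc: "\<forall>N\<in>admissible ?F (ck_relations E). N f \<le> b"
      "\<forall>N\<in>admissible ?F (ck_relations E). N g \<le> c" unfolding ck_free_algebra_def by blast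
    have "N (f + g) \<le> b + c" if N: "N \<in> admissible ?F (ck_relations E)" for N
    proof -
      interpret cstar_seminorm ?F N using N by (simp add: admissible_def)
      have "f \<in> carrier ?F" "g \<in> carrier ?F" using add by (simp_all add: ck_free_algebra_def)
      from seminorm_add[OF this] show ?thesis using bc N by (fastforce simp: ops)
    qed
    then show ?case unfolding ck_free_algebra_def by blast
  qed
  then show ?thesis by (auto simp: bdd_above_def)
qed

lemma ck_seminorm_admissible:
  "wf_digraph E \<Longrightarrow> ck_seminorm E \<in> admissible (ck_free_algebra E) (ck_relations E)"
  unfolding ck_seminorm_def
  by (rule star_algebra.universal_seminorm_admissible[OF star_algebra_ck_free ck_seminorm_bounded ck_relations_closed])

lemma ck_seminorm_cstar: "wf_digraph E \<Longrightarrow> cstar_seminorm (ck_free_algebra E) (ck_seminorm E)"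
  using ck_seminorm_admissible by (auto simp: admissible_def)

theorem cstar_algebra_graph_cstar: "wf_digraph E \<Longrightarrow> cstar_algebra (graph_cstar E)"
  unfolding graph_cstar_def by (rule cstar_seminorm.cstar_algebra_HC[OF ck_seminorm_cstar])

lemma graph_embed_hom:
  "wf_digraph E \<Longrightarrow> completion_embed (ck_free_algebra E) (ck_seminorm E) \<in> star_hom (ck_free_algebra E) (graph_cstar E)"
  unfolding graph_cstar_def by (rule cstar_seminorm.completion_embed_hom[OF ck_seminorm_cstar])

lemma star_algebra_graph_cstar: "wf_digraph E \<Longrightarrow> star_algebra (graph_cstar E)"
  using cstar_algebra_graph_cstar
  by (auto simp: cstar_algebra_def cstar_seminorm_def)

theorem ck_family_graph_cstar:
  assumes E: "wf_digraph E"
  shows "ck_family E (graph_cstar E) (graph_proj E) (graph_isom E)"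
proof -
  let ?j = "completion_embed (ck_free_algebra E) (ck_seminorm E)"
  interpret N: cstar_seminorm "ck_free_algebra E" "ck_seminorm E" by (rule ck_seminorm_cstar[OF E])
  interpret C: cstar_algebra "graph_cstar E" by (rule cstar_algebra_graph_cstar[OF E])
  note j = star_hom_props[OF graph_embed_hom[OF E]]
  have "x = y" if "(x, y) \<in> ck_equations E (graph_cstar E) (graph_proj E) (graph_isom E)" for x y
  proof -
    have "\<exists>a b. (a, b) \<in> ck_relations E \<and> x = ?j a \<and> y = ?j b"
      by (rule ck_equations_hom_inv[OF E star_algebra_ck_free star_algebra_graph_cstar[OF E] graph_embed_hom[OF E]])
        (use that in \<open>auto simp: graph_proj_def graph_isom_def ck_free_gen_carrier\<close>)
    then obtain a b where ab: "(a, b) \<in> ck_relations E" "x = ?j a" "y = ?j b" by blast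
    have c: "a \<in> carrier (ck_free_algebra E)" "b \<in> carrier (ck_free_algebra E)"
      using ck_relations_closed[OF E] ab by auto
    have "ck_seminorm E (a \<ominus>\<^bsub>ck_free_algebra E\<^esub> b) = 0"
      using ck_seminorm_admissible[OF E] ab by (auto simp: admissible_def)
    then have "cnorm (graph_cstar E) (x \<ominus>\<^bsub>graph_cstar E\<^esub> y) \<le> 0"
      using c ab by (simp add: graph_cstar_def N.completion_embed_diff N.completion_embed_norm)
    then show ?thesis using C.eqI_norm[of x y] ab c j(1) by simp
  qed
  then show ?thesis
    using j(1)[OF ck_free_gen_carrier(1)] j(1)[OF ck_free_gen_carrier(2)]
    by (auto simp: ck_family_def graph_proj_def graph_isom_def)
qed

lemma graph_hom_unique:
  assumes E: "wf_digraph E" and B: "cstar_algebra B"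
    and \<phi>: "\<phi> \<in> star_hom (graph_cstar E) B" and \<psi>: "\<psi> \<in> star_hom (graph_cstar E) B"
    and "\<And>v. v \<in> verts E \<Longrightarrow> \<phi> (graph_proj E v) = \<psi> (graph_proj E v)"
    and "\<And>e. e \<in> arcs E \<Longrightarrow> \<phi> (graph_isom E e) = \<psi> (graph_isom E e)"
    and "x \<in> carrier (graph_cstar E)"
  shows "\<phi> x = \<psi> x"
proof -
  let ?j = "completion_embed (ck_free_algebra E) (ck_seminorm E)"
  interpret B: cstar_algebra B by (rule B)
  note h = star_hom_comp[OF graph_embed_hom[OF E]]
  have "\<phi> (?j f) = \<psi> (?j f)" if "f \<in> carrier (ck_free_algebra E)" for f
    by (rule B.free_hom_unique[OF h[OF \<phi>, unfolded ck_free_algebra_def] h[OF \<psi>, unfolded ck_free_algebra_def],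
          folded ck_free_algebra_def, OF _ that])
      (use assms(5,6) in \<open>auto simp: graph_proj_def graph_isom_def\<close>)
  then show ?thesis
    using completion_hom_unique[OF ck_seminorm_cstar[OF E] B] \<phi> \<psi> assms(7) by (simp add: graph_cstar_def)
qed

theorem graph_cstar_universal:
  assumes E: "wf_digraph E" and B: "cstar_algebra B" and qt: "ck_family E B q t"
  shows "\<exists>!\<phi>. \<phi> \<in> star_hom (graph_cstar E) B \<and> \<phi> \<in> extensional (carrier (graph_cstar E)) \<and>
    (\<forall>v\<in>verts E. \<phi> (graph_proj E v) = q v) \<and> (\<forall>e\<in>arcs E. \<phi> (graph_isom E e) = t e)"
proof -
  let ?F = "ck_free_algebra E" and ?C = "graph_cstar E"
  let ?j = "completion_embed ?F (ck_seminorm E)"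
  interpret B: cstar_algebra B by (rule B)
  define r where "r = (\<lambda>g. case g of Proj_Gen v \<Rightarrow> q v | Isom_Gen e \<Rightarrow> t e)"
  have rc: "r \<in> (Proj_Gen ` verts E \<union> Isom_Gen ` arcs E) \<rightarrow> carrier B"
    using qt by (auto simp: r_def ck_family_def)
  have ev: "lin_ev B r \<in> star_hom ?F B" unfolding ck_free_algebra_def by (rule B.lin_ev_hom[OF rc])
  have evq: "lin_ev B r (free_gen (Proj_Gen v)) = q v" if "v \<in> verts E" for v
    using B.lin_ev_gen[OF rc, of "Proj_Gen v"] that by (simp add: r_def)
  have evt: "lin_ev B r (free_gen (Isom_Gen e)) = t e" if "e \<in> arcs E" for e
    using B.lin_ev_gen[OF rc, of "Isom_Gen e"] that by (simp add: r_def)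
  have "(\<lambda>f. cnorm B (lin_ev B r f)) \<in> admissible ?F (ck_relations E)"
    unfolding admissible_def
  proof (intro CollectI conjI ballI)
    show "cstar_seminorm ?F (\<lambda>f. cnorm B (lin_ev B r f))"
      by (rule star_hom_pullback_seminorm[OF star_algebra_ck_free B.cstar_seminorm_axioms ev])
    fix z assume z: "z \<in> ck_relations E"
    obtain a b where ab: "z = (a, b)" by (cases z)
    have c: "a \<in> carrier ?F" "b \<in> carrier ?F" using ck_relations_closed[OF E] z ab by auto
    have "(lin_ev B r a, lin_ev B r b) \<in> ck_equations E B q t"
      by (rule ck_equations_hom[OF E star_algebra_ck_free B.star_algebra_axioms ev ck_free_gen_carrier])
        (use evq evt z ab in auto)
    then have "lin_ev B r a = lin_ev B r b" using qt by (auto simp: ck_family_def)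
    then have "lin_ev B r (a \<ominus>\<^bsub>?F\<^esub> b) = \<zero>\<^bsub>B\<^esub>"
      using star_hom_diff[OF star_algebra_ck_free B.star_algebra_axioms ev c] star_hom_props(1)[OF ev c(2)]
      by (simp add: B.diff_zero_iff)
    then show "case z of (a, b) \<Rightarrow> cnorm B (lin_ev B r (a \<ominus>\<^bsub>?F\<^esub> b)) = 0"
      by (simp add: ab B.seminorm_zero)
  qed
  then have le: "cnorm B (lin_ev B r f) \<le> ck_seminorm E f" if "f \<in> carrier ?F" for f
    unfolding ck_seminorm_def
    using star_algebra.universal_seminorm_upper[OF star_algebra_ck_free ck_seminorm_bounded[OF E that]] by blast
  obtain \<Phi> where \<Phi>: "\<Phi> \<in> star_hom ?C B" "\<And>f. f \<in> carrier ?F \<Longrightarrow> \<Phi> (?j f) = lin_ev B r f"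
    using completion_extend[OF ck_seminorm_cstar[OF E] B ev le] unfolding graph_cstar_def by blast
  let ?P = "restrict \<Phi> (carrier ?C)"
  have gc: "graph_proj E v \<in> carrier ?C" if "v \<in> verts E" for v
    using ck_family_graph_cstar[OF E] that by (auto simp: ck_family_def)
  have ic: "graph_isom E e \<in> carrier ?C" if "e \<in> arcs E" for e
    using ck_family_graph_cstar[OF E] that by (auto simp: ck_family_def)
  show ?thesis
  proof (rule ex1I[of _ ?P])
    show "?P \<in> star_hom ?C B \<and> ?P \<in> extensional (carrier ?C) \<and>
      (\<forall>v\<in>verts E. ?P (graph_proj E v) = q v) \<and> (\<forall>e\<in>arcs E. ?P (graph_isom E e) = t e)"
      using star_hom_cong[OF star_algebra_graph_cstar[OF E] \<Phi>(1), of ?P] \<Phi>(2) gc ic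
      by (auto simp: graph_proj_def graph_isom_def ck_free_gen_carrier evq evt)
    then show "\<psi> = ?P" if "\<psi> \<in> star_hom ?C B \<and> \<psi> \<in> extensional (carrier ?C) \<and>
      (\<forall>v\<in>verts E. \<psi> (graph_proj E v) = q v) \<and> (\<forall>e\<in>arcs E. \<psi> (graph_isom E e) = t e)" for \<psi>
      using that graph_hom_unique[OF E B, of \<psi> ?P]
      by (intro extensionalityI[of _ "carrier ?C"]) auto
  qed
qed


subsection \<open>The gauge action\<close>

lemma ck_family_scale:
  assumes "star_algebra A" "ck_family E A p s" "cmod z = 1"
  shows "ck_family E A p (\<lambda>e. z \<odot>\<^bsub>A\<^esub> s e)"
proof -
  interpret A: star_algebra A by fact
  have z: "z * cnj z = 1" "cnj z * z = 1"
    using assms(3) complex_norm_square[of z] by (simp_all add: mult.commute)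
  have sc: "s e \<in> carrier A" if "e \<in> arcs E" for e using assms that by (auto simp: ck_family_def)
  have ss: "(z \<odot>\<^bsub>A\<^esub> s e) \<otimes>\<^bsub>A\<^esub> star A (z \<odot>\<^bsub>A\<^esub> s e) = s e \<otimes>\<^bsub>A\<^esub> star A (s e)" if "e \<in> arcs E" for e
    using sc[OF that] z
    by (simp add: A.star_smult A.smult_mult_left A.smult_mult_right A.smult_closed A.star_closed
        A.mult_closed A.smult_assoc[symmetric] A.smult_one)
  have ss': "star A (z \<odot>\<^bsub>A\<^esub> s e) \<otimes>\<^bsub>A\<^esub> (z \<odot>\<^bsub>A\<^esub> s e) = star A (s e) \<otimes>\<^bsub>A\<^esub> s e" if "e \<in> arcs E" for e
    using sc[OF that] z
    by (simp add: A.star_smult A.smult_mult_left A.smult_mult_right A.smult_closed A.star_closed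
        A.mult_closed A.smult_assoc[symmetric] A.smult_one)
  have eq: "a = b" if "(a, b) \<in> ck_equations E A p s" for a b
    using that assms(2) by (auto simp: ck_family_def)
  have "x = y" if "(x, y) \<in> ck_equations E A p (\<lambda>e. z \<odot>\<^bsub>A\<^esub> s e)" for x y
    using that
  proof cases
    case (partial_isom e)
    have "s e \<otimes>\<^bsub>A\<^esub> star A (s e) \<otimes>\<^bsub>A\<^esub> s e = s e" by (rule eq, rule ck_equations.partial_isom) fact
    then show ?thesis using partial_isom sc
      by (simp add: ss A.smult_mult_right A.mult_closed A.star_closed)
  next
    case (ck_sum v)
    have "finsum A (\<lambda>e. (z \<odot>\<^bsub>A\<^esub> s e) \<otimes>\<^bsub>A\<^esub> star A (z \<odot>\<^bsub>A\<^esub> s e)) {e \<in> arcs E. head E e = v} =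
        finsum A (\<lambda>e. s e \<otimes>\<^bsub>A\<^esub> star A (s e)) {e \<in> arcs E. head E e = v}"
      by (rule A.finsum_cong') (auto simp: ss sc A.mult_closed A.star_closed)
    then show ?thesis using ck_sum eq[OF ck_equations.ck_sum[OF ck_sum(3-5)]] by simp
  qed (simp_all add: ss ss' eq[OF ck_equations.proj_adjoint] eq[OF ck_equations.proj_idem]
      eq[OF ck_equations.proj_orth] eq[OF ck_equations.range_orth] eq[OF ck_equations.source_proj]
      eq[OF ck_equations.range_proj])
  then show ?thesis using assms(2) sc by (auto simp: ck_family_def A.smult_closed)
qed

theorem gauge_action_unique_existence:
  assumes E: "wf_digraph E" and z: "cmod z = 1"
  shows "\<exists>!\<phi>. \<phi> \<in> star_aut (graph_cstar E) \<and> \<phi> \<in> extensional (carrier (graph_cstar E)) \<and>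
     (\<forall>e\<in>arcs E. \<phi> (graph_isom E e) = z \<odot>\<^bsub>graph_cstar E\<^esub> graph_isom E e) \<and>
     (\<forall>v\<in>verts E. \<phi> (graph_proj E v) = graph_proj E v)"
proof -
  let ?C = "graph_cstar E"
  interpret C: cstar_algebra ?C by (rule cstar_algebra_graph_cstar[OF E])
  note fam = ck_family_graph_cstar[OF E]
  note cs = C.cstar_algebra_axioms
  have pc: "graph_proj E v \<in> carrier ?C" if "v \<in> verts E" for v using fam that by (auto simp: ck_family_def)
  have ic: "graph_isom E e \<in> carrier ?C" if "e \<in> arcs E" for e using fam that by (auto simp: ck_family_def)
  have ex: "\<exists>\<phi>. \<phi> \<in> star_hom ?C ?C \<and> \<phi> \<in> extensional (carrier ?C) \<and>
     (\<forall>v\<in>verts E. \<phi> (graph_proj E v) = graph_proj E v) \<and>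
     (\<forall>e\<in>arcs E. \<phi> (graph_isom E e) = w \<odot>\<^bsub>?C\<^esub> graph_isom E e)" if "cmod w = 1" for w
    using graph_cstar_universal[OF E cs ck_family_scale[OF C.star_algebra_axioms fam that]] by blast
  have inv: "\<psi> (\<phi> x) = x"
    if "\<phi> \<in> star_hom ?C ?C" "\<forall>v\<in>verts E. \<phi> (graph_proj E v) = graph_proj E v"
      "\<forall>e\<in>arcs E. \<phi> (graph_isom E e) = w \<odot>\<^bsub>?C\<^esub> graph_isom E e"
      "\<psi> \<in> star_hom ?C ?C" "\<forall>v\<in>verts E. \<psi> (graph_proj E v) = graph_proj E v"
      "\<forall>e\<in>arcs E. \<psi> (graph_isom E e) = w' \<odot>\<^bsub>?C\<^esub> graph_isom E e" "w * w' = 1" "x \<in> carrier ?C"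
    for \<phi> \<psi> w w' x
    by (rule graph_hom_unique[OF E cs star_hom_comp[OF that(1,4)] id_star_hom _ _ that(8)])
      (use that ic in \<open>auto simp: star_hom_props(3)[OF that(4)] C.smult_assoc[symmetric] C.smult_one\<close>)
  obtain \<phi> where \<phi>: "\<phi> \<in> star_hom ?C ?C" "\<phi> \<in> extensional (carrier ?C)"
     "\<forall>v\<in>verts E. \<phi> (graph_proj E v) = graph_proj E v"
     "\<forall>e\<in>arcs E. \<phi> (graph_isom E e) = z \<odot>\<^bsub>?C\<^esub> graph_isom E e" using ex[OF z] by blast
  obtain \<psi> where \<psi>: "\<psi> \<in> star_hom ?C ?C"
     "\<forall>v\<in>verts E. \<psi> (graph_proj E v) = graph_proj E v"
     "\<forall>e\<in>arcs E. \<psi> (graph_isom E e) = cnj z \<odot>\<^bsub>?C\<^esub> graph_isom E e"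
    using ex[of "cnj z"] z by auto
  have zz: "z * cnj z = 1" "cnj z * z = 1"
    using z complex_norm_square[of z] by (simp_all add: mult.commute)
  have "bij_betw \<phi> (carrier ?C) (carrier ?C)"
    by (rule bij_betwI[where g = \<psi>])
      (use inv[OF \<phi>(1,3,4) \<psi> zz(1)] inv[OF \<psi> \<phi>(1,3,4) zz(2)] star_hom_props(1)[OF \<phi>(1)] star_hom_props(1)[OF \<psi>(1)] in auto)
  then have "\<phi> \<in> star_aut ?C" using \<phi>(1) by (simp add: star_aut_def)
  then show ?thesis
  proof (intro ex1I[of _ \<phi>])
    fix \<theta> assume "\<theta> \<in> star_aut ?C \<and> \<theta> \<in> extensional (carrier ?C) \<and>
     (\<forall>e\<in>arcs E. \<theta> (graph_isom E e) = z \<odot>\<^bsub>?C\<^esub> graph_isom E e) \<and>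
     (\<forall>v\<in>verts E. \<theta> (graph_proj E v) = graph_proj E v)"
    then show "\<theta> = \<phi>"
      using \<phi> graph_hom_unique[OF E cs, of \<theta> \<phi>]
      by (intro extensionalityI[of _ "carrier ?C"]) (auto simp: star_aut_def)
  qed (use \<phi> in auto)
qed

end

theory Submission
  imports Defs
begin

text \<open>
  Write \<open>A\<close> for the graph algebra of \<open>E\<close>, \<open>A\<^sub>n\<close> for its gauge components, \<open>p v\<close> and \<open>s e\<close> for its
  generators, and call the number of letters \<open>s e\<close> minus the number of letters \<open>(s e)\<^sup>*\<close> the degree of
  a word in the generators.

  Averaging over finitely many gauge automorphisms removes the components of unwanted degree without
  increasing the norm (\<open>V_norm_le_sum\<close>). Hence the components are independent and \<open>A\<^sub>n\<close> is the closed
  span of the words of degree \<open>n\<close> (\<open>V_dense\<close>). So the grading only has to be understood on words.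

  For sufficiency, every word \<open>w\<close> equals \<open>p v \<cdot> w\<close> for some vertex \<open>v\<close>, so \<open>A\<^sub>m\<^sub>+\<^sub>n\<close> lies in the closed span of
  \<open>A\<^sub>m \<cdot> A\<^sub>n\<close> as soon as each \<open>p v\<close> is in the span of \<open>A\<^sub>m \<cdot> A\<^sub>-\<^sub>m\<close>
  (\<open>strongly_graded_if_p_in_J\<close>). For \<open>m \<ge> 0\<close> this follows by iterating the Cuntz--Krieger sum, which is
  available at every vertex when \<open>E\<close> is row-finite without sources. For \<open>m = -k\<close>, a path \<open>\<alpha>\<close> that has
  a companion \<open>\<beta>\<close> with the same source and \<open>k\<close> more edges satisfies
  \<open>s\<^sub>\<alpha> s\<^sub>\<alpha>\<^sup>* = (s\<^sub>\<alpha> s\<^sub>\<beta>\<^sup>*)(s\<^sub>\<beta> s\<^sub>\<alpha>\<^sup>*)\<close>. If \<open>p v\<close> were not in the span, splitting it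
  along the Cuntz--Krieger sum again and again would produce an infinite path none of whose initial
  segments has such a companion, contrary to property (Y).

  For necessity, represent \<open>A\<close> on the finitely supported functions on a set of paths, where \<open>s e\<close>
  prepends the edge \<open>e\<close>. A word of degree \<open>n\<close> sends a basis vector \<open>\<delta>\<^sub>x\<close> to zero or to a basis vector
  \<open>\<delta>\<^sub>y\<close> where \<open>y\<close> arises from \<open>x\<close> by exchanging initial segments whose lengths differ by \<open>n\<close>. If there
  is no such \<open>y\<close>, then \<open>A\<^sub>n\<close> annihilates \<open>\<delta>\<^sub>x\<close>, and so does the closed span of \<open>A\<^sub>-\<^sub>n \<cdot> A\<^sub>n\<close>; but the
  projection at the range of \<open>x\<close> fixes \<open>\<delta>\<^sub>x\<close>, so the grading is not strong
  (\<open>not_strongly_graded_if_annihilated\<close>). A vertex \<open>v\<close> that is a source or receives infinitely many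
  edges gives such an \<open>x\<close> with \<open>n = -1\<close>: among the paths with source \<open>v\<close>, the path of length zero cannot
  be shortened. An infinite path violating property (Y) for \<open>k\<close> gives one with \<open>n = k\<close>.
\<close>

section \<open>Closed subspaces and products of subspaces\<close>

context star_algebra
begin

lemma csubspaceD:
  assumes "csubspace A V"
  shows "V \<subseteq> carrier A" "\<zero> \<in> V"
    "\<lbrakk>x \<in> V; y \<in> V\<rbrakk> \<Longrightarrow> x \<oplus> y \<in> V" "x \<in> V \<Longrightarrow> c \<odot> x \<in> V"
  using assms by (auto simp: csubspace_def)

lemma csubspace_finsum:
  assumes "csubspace A V" "finite F" "x \<in> F \<rightarrow> V"
  shows "finsum A x F \<in> V"
  using assms(2,3)
proof (induction F rule: finite_induct)
  case empty
  then show ?case using csubspaceD[OF assms(1)] by simp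
next
  case (insert i F)
  moreover from this have "x \<in> F \<rightarrow> carrier A" "x i \<in> carrier A" using csubspaceD(1)[OF assms(1)] by auto
  ultimately show ?case using csubspaceD(3)[OF assms(1)] by simp
qed

lemma csubspace_carrier: "csubspace A (carrier A)"
  by (auto simp: csubspace_def smult_closed)

lemma csubspace_hull:
  assumes "S \<subseteq> carrier A"
  shows "csubspace A (csubspace A hull S)"
  unfolding hull_def csubspace_def
  using assms csubspace_carrier by (auto simp: csubspace_def)

lemma products_carrier:
  assumes "S \<subseteq> carrier A" "T \<subseteq> carrier A"
  shows "{x \<otimes> y | x y. x \<in> S \<and> y \<in> T} \<subseteq> carrier A"
  using assms by (auto intro!: mult_closed)

lemma csubspace_prod_span:
  assumes "S \<subseteq> carrier A" "T \<subseteq> carrier A"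
  shows "csubspace A (prod_span A S T)"
  unfolding prod_span_def by (rule csubspace_hull[OF products_carrier[OF assms]])

lemma prod_spanI: "\<lbrakk>x \<in> S; y \<in> T\<rbrakk> \<Longrightarrow> x \<otimes> y \<in> prod_span A S T"
  unfolding prod_span_def by (rule hull_inc) blast

lemma prod_span_least:
  assumes "csubspace A V" "\<And>x y. \<lbrakk>x \<in> S; y \<in> T\<rbrakk> \<Longrightarrow> x \<otimes> y \<in> V"
  shows "prod_span A S T \<subseteq> V"
  unfolding prod_span_def by (rule hull_minimal) (use assms in auto)

text \<open>
  The elements whose product with a fixed \<open>u\<close> lies in the target form a subspace, so it is enough to
  look at single products; there associativity moves \<open>u\<close> onto one factor.
\<close>

lemma prod_span_mult_right:
  assumes S: "S \<subseteq> carrier A" and T: "T \<subseteq> carrier A" and W: "W \<subseteq> carrier A" and u: "u \<in> carrier A"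
    and tu: "\<And>t. t \<in> T \<Longrightarrow> t \<otimes> u \<in> W" and x: "x \<in> prod_span A S T"
  shows "x \<otimes> u \<in> prod_span A S W"
proof -
  note sub = csubspaceD[OF csubspace_prod_span[OF S W]]
  have "prod_span A S T \<subseteq> {x \<in> carrier A. x \<otimes> u \<in> prod_span A S W}"
  proof (rule prod_span_least)
    show "csubspace A {x \<in> carrier A. x \<otimes> u \<in> prod_span A S W}"
      using u sub by (auto simp: csubspace_def mult_l_distr smult_mult_left smult_closed mult_zero_left)
    show "x \<otimes> y \<in> {x \<in> carrier A. x \<otimes> u \<in> prod_span A S W}" if "x \<in> S" "y \<in> T" for x y
      using that S T u tu by (auto simp: mult_assoc mult_closed subset_iff intro!: prod_spanI)
  qed
  then show ?thesis using x by auto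
qed

lemma prod_span_mult_left:
  assumes S: "S \<subseteq> carrier A" and T: "T \<subseteq> carrier A" and W: "W \<subseteq> carrier A" and u: "u \<in> carrier A"
    and us: "\<And>s. s \<in> S \<Longrightarrow> u \<otimes> s \<in> W" and x: "x \<in> prod_span A S T"
  shows "u \<otimes> x \<in> prod_span A W T"
proof -
  note sub = csubspaceD[OF csubspace_prod_span[OF W T]]
  have "prod_span A S T \<subseteq> {x \<in> carrier A. u \<otimes> x \<in> prod_span A W T}"
  proof (rule prod_span_least)
    show "csubspace A {x \<in> carrier A. u \<otimes> x \<in> prod_span A W T}"
      using u sub by (auto simp: csubspace_def mult_r_distr smult_mult_right smult_closed mult_zero_right)
    show "x \<otimes> y \<in> {x \<in> carrier A. u \<otimes> x \<in> prod_span A W T}" if "x \<in> S" "y \<in> T" for x y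
      using that S T u us by (auto simp: mult_assoc[symmetric] mult_closed subset_iff intro!: prod_spanI)
  qed
  then show ?thesis using x by auto
qed

end

context cstar_algebra
begin

lemma cclosure_iff:
  assumes "S \<subseteq> carrier A"
  shows "x \<in> cclosure A S \<longleftrightarrow> x \<in> carrier A \<and> (\<forall>\<epsilon>>0. \<exists>y\<in>S. cnorm A (x \<ominus> y) < \<epsilon>)"
proof -
  interpret M: Metric_space "carrier A" "cdist A" by (rule Metric_space)
  show ?thesis
    unfolding M.metric_closure_of using assms by (fastforce simp: cdist_def)
qed

lemma cclosureI:
  assumes "S \<subseteq> carrier A" "x \<in> carrier A" "\<And>\<epsilon>. \<epsilon> > 0 \<Longrightarrow> \<exists>y\<in>S. cnorm A (x \<ominus> y) < \<epsilon>"
  shows "x \<in> cclosure A S"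
  using assms by (simp add: cclosure_iff)

lemma cclosureE:
  assumes "x \<in> cclosure A S" "S \<subseteq> carrier A" "\<epsilon> > 0"
  obtains y where "y \<in> S" "cnorm A (x \<ominus> y) < \<epsilon>"
  using assms by (auto simp: cclosure_iff)

lemma cclosure_subset_carrier: "cclosure A S \<subseteq> carrier A"
proof -
  interpret M: Metric_space "carrier A" "cdist A" by (rule Metric_space)
  show ?thesis using closure_of_subset_topspace[of M.mtopology S] by simp
qed

lemma cclosure_superset: "S \<subseteq> carrier A \<Longrightarrow> S \<subseteq> cclosure A S"
proof -
  interpret M: Metric_space "carrier A" "cdist A" by (rule Metric_space)
  show "S \<subseteq> carrier A \<Longrightarrow> ?thesis" by (simp add: closure_of_subset)
qed

lemma cclosure_mono: "S \<subseteq> T \<Longrightarrow> cclosure A S \<subseteq> cclosure A T"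
  by (rule closure_of_mono)

lemma closedin_iff_cclosure: "S \<subseteq> carrier A \<Longrightarrow> closedin (ctopology A) S \<longleftrightarrow> cclosure A S \<subseteq> S"
proof -
  interpret M: Metric_space "carrier A" "cdist A" by (rule Metric_space)
  show "S \<subseteq> carrier A \<Longrightarrow> ?thesis" by (simp add: closure_of_subset_eq[symmetric])
qed

lemma csubspace_cclosure:
  assumes V: "csubspace A V"
  shows "csubspace A (cclosure A V)"
  unfolding csubspace_def
proof (intro conjI ballI allI)
  note sub = csubspaceD[OF V]
  note cl = subsetD[OF cclosure_subset_carrier]
  show "cclosure A V \<subseteq> carrier A" by (rule cclosure_subset_carrier)
  show "\<zero> \<in> cclosure A V" using cclosure_superset sub by blast
  fix x assume x: "x \<in> cclosure A V"
  show "c \<odot> x \<in> cclosure A V" for c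
  proof (rule cclosureI[OF sub(1) smult_closed[OF cl[OF x]]])
    fix \<epsilon> :: real assume "\<epsilon> > 0"
    then have "\<epsilon> / (cmod c + 1) > 0" by (intro divide_pos_pos add_nonneg_pos) auto
    then obtain y where y: "y \<in> V" "cnorm A (x \<ominus> y) < \<epsilon> / (cmod c + 1)"
      using cclosureE[OF x sub(1)] by blast
    have yc: "y \<in> carrier A" "x \<in> carrier A" using y sub cl x by auto
    have "cnorm A (c \<odot> x \<ominus> c \<odot> y) = cmod c * cnorm A (x \<ominus> y)"
      using yc by (simp add: smult_diff[symmetric] seminorm_smult)
    also have "\<dots> \<le> (cmod c + 1) * cnorm A (x \<ominus> y)"
      using yc by (intro mult_right_mono) (auto intro: seminorm_nonneg)
    also have "\<dots> < \<epsilon>" using y(2) by (simp add: pos_less_divide_eq add_nonneg_pos mult.commute)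
    finally show "\<exists>y\<in>V. cnorm A (c \<odot> x \<ominus> y) < \<epsilon>" using sub(4) y(1) by blast
  qed
  fix y assume y: "y \<in> cclosure A V"
  show "x \<oplus> y \<in> cclosure A V"
  proof (rule cclosureI[OF sub(1)])
    show "x \<oplus> y \<in> carrier A" using cl x y by simp
    fix \<epsilon> :: real assume "\<epsilon> > 0"
    then have e: "\<epsilon> / 2 > 0" by simp
    obtain u v where uv: "u \<in> V" "cnorm A (x \<ominus> u) < \<epsilon> / 2" "v \<in> V" "cnorm A (y \<ominus> v) < \<epsilon> / 2"
      using cclosureE[OF x sub(1) e] cclosureE[OF y sub(1) e] by metis
    have c: "x \<in> carrier A" "y \<in> carrier A" "u \<in> carrier A" "v \<in> carrier A" using x y uv cl sub by auto
    have "cnorm A ((x \<oplus> y) \<ominus> (u \<oplus> v)) \<le> cnorm A (x \<ominus> u) + cnorm A (y \<ominus> v)"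
      using c by (simp add: diff_add_diff seminorm_add)
    then show "\<exists>w\<in>V. cnorm A (x \<oplus> y \<ominus> w) < \<epsilon>" using uv sub(3)[OF uv(1,3)] by force
  qed
qed

text \<open>Multiplication is jointly continuous, so products of limits are limits of products.\<close>

lemma cclosure_mult:
  assumes S: "S \<subseteq> carrier A" and T: "T \<subseteq> carrier A" and W: "W \<subseteq> carrier A"
    and st: "\<And>s t. \<lbrakk>s \<in> S; t \<in> T\<rbrakk> \<Longrightarrow> s \<otimes> t \<in> W"
    and x: "x \<in> cclosure A S" and y: "y \<in> cclosure A T"
  shows "x \<otimes> y \<in> cclosure A W"
proof -
  note cl = subsetD[OF cclosure_subset_carrier]
  have xy: "x \<in> carrier A" "y \<in> carrier A" using x y cl by auto
  have st': "s \<otimes> y \<in> cclosure A W" if "s \<in> S" for s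
  proof (rule cclosureI[OF W])
    have s: "s \<in> carrier A" using that S by auto
    then show "s \<otimes> y \<in> carrier A" using xy by (simp add: mult_closed)
    fix \<epsilon> :: real assume "\<epsilon> > 0"
    then have "\<epsilon> / (cnorm A s + 1) > 0" using seminorm_nonneg[OF s] by simp
    then obtain t where t: "t \<in> T" "cnorm A (y \<ominus> t) < \<epsilon> / (cnorm A s + 1)" by (metis cclosureE[OF y T])
    have tc: "t \<in> carrier A" using t T by auto
    have "cnorm A (s \<otimes> y \<ominus> s \<otimes> t) \<le> cnorm A s * cnorm A (y \<ominus> t)"
      using s tc xy by (simp add: mult_diff_right[symmetric] seminorm_mult)
    also have "\<dots> \<le> (cnorm A s + 1) * cnorm A (y \<ominus> t)"
      using tc xy by (intro mult_right_mono) (auto intro: seminorm_nonneg)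
    also have "\<dots> < \<epsilon>" using t(2) seminorm_nonneg[OF s] by (simp add: field_simps)
    finally show "\<exists>w\<in>W. cnorm A (s \<otimes> y \<ominus> w) < \<epsilon>" using st[OF that t(1)] by blast
  qed
  have "x \<otimes> y \<in> cclosure A (cclosure A W)"
  proof (rule cclosureI[OF cclosure_subset_carrier])
    show "x \<otimes> y \<in> carrier A" using xy by (simp add: mult_closed)
    fix \<epsilon> :: real assume "\<epsilon> > 0"
    then have "\<epsilon> / (cnorm A y + 1) > 0" using seminorm_nonneg[OF xy(2)] by simp
    then obtain s where s: "s \<in> S" "cnorm A (x \<ominus> s) < \<epsilon> / (cnorm A y + 1)" by (metis cclosureE[OF x S])
    have sc: "s \<in> carrier A" using s S by auto
    have "cnorm A (x \<otimes> y \<ominus> s \<otimes> y) \<le> cnorm A (x \<ominus> s) * cnorm A y"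
      using sc xy by (simp add: mult_diff_left[symmetric] seminorm_mult)
    also have "\<dots> \<le> cnorm A (x \<ominus> s) * (cnorm A y + 1)"
      using sc xy by (intro mult_left_mono) (auto intro: seminorm_nonneg)
    also have "\<dots> < \<epsilon>" using s(2) seminorm_nonneg[OF xy(2)] by (simp add: field_simps)
    finally show "\<exists>w\<in>cclosure A W. cnorm A (x \<otimes> y \<ominus> w) < \<epsilon>" using st'[OF s(1)] by blast
  qed
  then show ?thesis by simp
qed

end


section \<open>The gauge grading of a graph algebra\<close>

definition letter_degree :: "('v, 'e) ck_gen \<times> bool \<Rightarrow> int" where
  "letter_degree l = (case fst l of Proj_Gen v \<Rightarrow> 0 | Isom_Gen e \<Rightarrow> if snd l then -1 else 1)"

definition word_degree :: "('v, 'e) ck_gen star_word \<Rightarrow> int" where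
  "word_degree w = (\<Sum>l\<leftarrow>letters w. letter_degree l)"

definition homogeneous_part ::
    "int \<Rightarrow> (('v, 'e) ck_gen star_word \<Rightarrow>\<^sub>0 complex) \<Rightarrow> (('v, 'e) ck_gen star_word \<Rightarrow>\<^sub>0 complex)" where
  "homogeneous_part n = Poly_Mapping.mapp (\<lambda>w c. if word_degree w = n then c else 0)"

lemma lookup_homogeneous_part:
  "Poly_Mapping.lookup (homogeneous_part n f) w = (if word_degree w = n then Poly_Mapping.lookup f w else 0)"
  by (simp add: homogeneous_part_def lookup_mapp when_def in_keys_iff)

lemma keys_homogeneous_part:
  "Poly_Mapping.keys (homogeneous_part n f) = {w \<in> Poly_Mapping.keys f. word_degree w = n}"
  by (auto simp: in_keys_iff lookup_homogeneous_part split: if_splits)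

lemma sum_homogeneous_parts:
  "(\<Sum>d\<in>word_degree ` Poly_Mapping.keys f. homogeneous_part d f) = f"
  by (rule poly_mapping_eqI) (auto simp: lookup_sum lookup_homogeneous_part in_keys_iff image_iff)

lemma free_finsum:
  assumes "finite F" "f \<in> F \<rightarrow> carrier (free_star_algebra X)"
  shows "finsum (free_star_algebra X) f F = sum f F"
proof -
  interpret star_algebra "free_star_algebra X" by (rule star_algebra_free)
  show ?thesis using assms
    by (induction F rule: finite_induct) (auto simp: Pi_iff)
qed

lemma cnj_powi_unit:
  assumes "cmod z = 1"
  shows "cnj (z powi n) = z powi (- n)"
proof -
  have "cnj z = inverse z"
    using assms by (metis complex_norm_square inverse_unique mult.commute of_real_1 power_one)
  then show ?thesis by (simp add: power_int_minus power_int_inverse)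
qed

text \<open>
  The graph algebra is given the name \<open>C\<close> so that it can be declared as the implicit structure of the
  algebraic notation.
\<close>

locale graph_algebra = cstar_algebra C
  for E :: "('v, 'e) pre_digraph"
    and C :: "(nat \<Rightarrow> ('v, 'e) ck_gen star_word \<Rightarrow>\<^sub>0 complex) set cstar_alg" (structure) +
  assumes wf: "wf_digraph E" and C_eq: "C = graph_cstar E"
begin

abbreviation "p \<equiv> graph_proj E"
abbreviation "s \<equiv> graph_isom E"
abbreviation "\<gamma> \<equiv> gauge_action E"
abbreviation "V \<equiv> gauge_component E"
abbreviation "F \<equiv> ck_free_algebra E"
abbreviation "j \<equiv> completion_embed (ck_free_algebra E) (ck_seminorm E)"
abbreviation "gens \<equiv> Proj_Gen ` verts E \<union> Isom_Gen ` arcs E"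
abbreviation "gen_ev \<equiv> case_ck_gen p s"

lemma arcs_verts [simp]: "e \<in> arcs E \<Longrightarrow> head E e \<in> verts E" "e \<in> arcs E \<Longrightarrow> tail E e \<in> verts E"
  using wf by (auto simp: wf_digraph_def)

lemma family: "ck_family E C p s"
  using ck_family_graph_cstar[OF wf] by (simp add: C_eq)

lemma relation: "(a, b) \<in> ck_equations E C p s \<Longrightarrow> a = b"
  using family by (auto simp: ck_family_def)

lemma p_closed [simp]: "v \<in> verts E \<Longrightarrow> p v \<in> carrier C"
  and s_closed [simp]: "e \<in> arcs E \<Longrightarrow> s e \<in> carrier C"
  using family by (auto simp: ck_family_def)

lemma p_adj: "v \<in> verts E \<Longrightarrow> star C (p v) = p v"
  by (rule relation, rule ck_equations.proj_adjoint)

lemma p_idem: "v \<in> verts E \<Longrightarrow> p v \<otimes> p v = p v"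
  by (rule relation, rule ck_equations.proj_idem)

lemma s_adj_s: "e \<in> arcs E \<Longrightarrow> star C (s e) \<otimes> s e = p (tail E e)"
  by (rule relation, rule ck_equations.source_proj)

lemma s_p: assumes "e \<in> arcs E" shows "s e \<otimes> p (tail E e) = s e"
proof -
  have "s e \<otimes> star C (s e) \<otimes> s e = s e" by (rule relation, rule ck_equations.partial_isom) fact
  then show ?thesis using assms by (simp add: s_adj_s[symmetric] mult_assoc star_closed)
qed

lemma p_s: assumes e: "e \<in> arcs E" shows "p (head E e) \<otimes> s e = s e"
proof -
  have 1: "s e \<otimes> star C (s e) \<otimes> s e = s e" by (rule relation, rule ck_equations.partial_isom) fact
  have "p (head E e) \<otimes> (s e \<otimes> star C (s e)) = s e \<otimes> star C (s e)"
    by (rule relation, rule ck_equations.range_proj) fact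
  then have "p (head E e) \<otimes> (s e \<otimes> star C (s e)) \<otimes> s e = s e" by (simp add: 1)
  moreover have "p (head E e) \<otimes> (s e \<otimes> star C (s e)) \<otimes> s e = p (head E e) \<otimes> (s e \<otimes> star C (s e) \<otimes> s e)"
    using e by (intro mult_assoc) (auto simp: mult_closed star_closed)
  ultimately show ?thesis by (simp add: 1)
qed

lemma p_adj_s: assumes "e \<in> arcs E" shows "p (tail E e) \<otimes> star C (s e) = star C (s e)"
  using star_mult[of "s e" "p (tail E e)"] assms by (simp add: s_p p_adj)

lemma p_sum:
  assumes "v \<in> verts E" "finite {e \<in> arcs E. head E e = v}" "{e \<in> arcs E. head E e = v} \<noteq> {}"
  shows "p v = (\<Oplus>e\<in>{e \<in> arcs E. head E e = v}. s e \<otimes> star C (s e))"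
  by (rule relation, rule ck_equations.ck_sum) (use assms in \<open>auto simp: fun_eq_iff\<close>)

lemma j_hom: "j \<in> star_hom F C"
  using graph_embed_hom[OF wf] by (simp add: C_eq)

lemmas j = star_hom_props[OF j_hom]

lemma star_algebra_F: "star_algebra F" by (rule star_algebra_ck_free)

lemma gen_ev: "gen_ev \<in> gens \<rightarrow> carrier C"
  by auto

lemma j_eq: "f \<in> carrier F \<Longrightarrow> j f = lin_ev C gen_ev f"
  unfolding ck_free_algebra_def
  by (rule free_hom_unique[OF j_hom[unfolded ck_free_algebra_def] lin_ev_hom[OF gen_ev]])
    (auto simp: lin_ev_gen[OF gen_ev] graph_proj_def graph_isom_def ck_free_algebra_def)

lemma F_carrier: "f \<in> carrier F \<longleftrightarrow> Poly_Mapping.keys f \<subseteq> gen_words gens"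
  by (simp add: ck_free_algebra_def free_carrier)

lemma j_single: "w \<in> gen_words gens \<Longrightarrow> j (Poly_Mapping.single w c) = c \<odot> list_ev C gen_ev (letters w)"
  using j_eq[of "Poly_Mapping.single w c"] lin_ev_single[OF gen_ev] by (simp add: F_carrier)

lemma j_norm: "f \<in> carrier F \<Longrightarrow> cnorm C (j f) = ck_seminorm E f"
  using cstar_seminorm.completion_embed_norm[OF ck_seminorm_cstar[OF wf]] by (simp add: C_eq graph_cstar_def)

lemma j_diff: "\<lbrakk>f \<in> carrier F; g \<in> carrier F\<rbrakk> \<Longrightarrow> j f \<ominus> j g = j (f \<ominus>\<^bsub>F\<^esub> g)"
  using cstar_seminorm.completion_embed_diff[OF ck_seminorm_cstar[OF wf]] by (simp add: C_eq graph_cstar_def)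

lemma j_dense:
  assumes "a \<in> carrier C" "\<epsilon> > 0"
  obtains f where "f \<in> carrier F" "cnorm C (a \<ominus> j f) < \<epsilon>"
  using cstar_seminorm.completion_dense[OF ck_seminorm_cstar[OF wf], of a \<epsilon>] assms j(1)
  by (auto simp: C_eq graph_cstar_def cdist_def)

lemma gauge:
  assumes "cmod z = 1"
  shows gauge_hom: "\<gamma> z \<in> star_hom C C"
    and gauge_s: "e \<in> arcs E \<Longrightarrow> \<gamma> z (s e) = z \<odot> s e"
    and gauge_p: "v \<in> verts E \<Longrightarrow> \<gamma> z (p v) = p v"
  using theI'[OF gauge_action_unique_existence[OF wf assms], folded gauge_action_def]
  by (auto simp: star_aut_def C_eq)

lemma gauge_contractive: "\<lbrakk>cmod z = 1; a \<in> carrier C\<rbrakk> \<Longrightarrow> cnorm C (\<gamma> z a) \<le> cnorm C a"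
  by (rule star_hom_contractive[OF cstar_algebra_axioms cstar_algebra_axioms gauge_hom])

lemma V_iff: "a \<in> V n \<longleftrightarrow> a \<in> carrier C \<and> (\<forall>z. cmod z = 1 \<longrightarrow> \<gamma> z a = (z powi n) \<odot> a)"
  by (simp add: gauge_component_def C_eq)

lemma V_closed: "a \<in> V n \<Longrightarrow> a \<in> carrier C"
  by (simp add: V_iff)

lemma V_subset: "V n \<subseteq> carrier C"
  by (auto simp: V_closed)

lemma V_csubspace: "csubspace C (V n)"
  unfolding csubspace_def
  using star_hom_zero[OF star_algebra_axioms star_algebra_axioms gauge_hom]
  by (auto simp: V_iff smult_zero_right smult_closed smult_r_distr star_hom_props[OF gauge_hom]
      smult_assoc[symmetric] mult.commute)

lemmas V_sub = csubspaceD[OF V_csubspace]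

lemma V_mult:
  assumes "a \<in> V m" "b \<in> V n"
  shows "a \<otimes> b \<in> V (m + n)"
proof -
  have "\<gamma> z (a \<otimes> b) = z powi (m + n) \<odot> (a \<otimes> b)" if z: "cmod z = 1" for z
  proof -
    have "z \<noteq> 0" using z by auto
    then have "z powi (m + n) = z powi n * z powi m" by (simp add: power_int_add)
    then show ?thesis using assms z
      by (simp add: V_iff star_hom_props[OF gauge_hom[OF z]] smult_mult_left smult_mult_right smult_closed
          mult_closed smult_assoc)
  qed
  then show ?thesis using assms by (simp add: V_iff mult_closed)
qed

lemma V_star: "a \<in> V n \<Longrightarrow> star C a \<in> V (- n)"
  by (simp add: V_iff star_closed star_hom_props[OF gauge_hom] star_smult cnj_powi_unit del: complex_cnj_power_int)

lemma p_in_V: "v \<in> verts E \<Longrightarrow> p v \<in> V 0"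
  by (simp add: V_iff gauge_p smult_one)

lemma s_in_V: "e \<in> arcs E \<Longrightarrow> s e \<in> V 1"
  by (simp add: V_iff gauge_s)

lemma letter_ev_in_V:
  assumes "fst l \<in> gens"
  shows "letter_ev C gen_ev l \<in> V (letter_degree l)"
  using assms V_star[OF p_in_V] V_star[OF s_in_V]
  by (auto simp: letter_ev_def letter_degree_def p_in_V s_in_V)

lemma list_ev_in_V:
  "\<lbrakk>ls \<noteq> []; fst ` set ls \<subseteq> gens\<rbrakk> \<Longrightarrow> list_ev C gen_ev ls \<in> V (\<Sum>l\<leftarrow>ls. letter_degree l)"
proof (induction ls rule: list_nonempty_induct)
  case (single l)
  then show ?case using letter_ev_in_V[of l] by simp
next
  case (cons l ls)
  then show ?case using V_mult[OF letter_ev_in_V[of l], of "list_ev C gen_ev ls"]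
    by (simp add: list_ev_Cons[OF gen_ev])
qed

lemma j_single_in_V: "w \<in> gen_words gens \<Longrightarrow> j (Poly_Mapping.single w c) \<in> V (word_degree w)"
  using list_ev_in_V[of "letters w"] V_sub(4) by (simp add: j_single gen_words_def word_degree_def)

text \<open>
  Membership in a subspace can be tested on words, because \<open>j\<close> evaluates a combination of words term
  by term.
\<close>

lemma j_in_csubspace:
  assumes f: "f \<in> carrier F" and W: "csubspace C W"
    and w: "\<And>w c. w \<in> Poly_Mapping.keys f \<Longrightarrow> j (Poly_Mapping.single w c) \<in> W"
  shows "j f \<in> W"
proof -
  have "j f = (\<Oplus>w\<in>Poly_Mapping.keys f. Poly_Mapping.lookup f w \<odot> list_ev C gen_ev (letters w))"
    using f by (simp add: j_eq lin_ev_def)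
  moreover have "Poly_Mapping.lookup f w \<odot> list_ev C gen_ev (letters w) \<in> W"
    if "w \<in> Poly_Mapping.keys f" for w
    using w[OF that, of "Poly_Mapping.lookup f w"] that f by (auto simp: F_carrier j_single)
  ultimately show ?thesis by (auto intro: csubspace_finsum[OF W])
qed

lemma j_in_V:
  assumes f: "f \<in> carrier F" and "\<And>w. w \<in> Poly_Mapping.keys f \<Longrightarrow> word_degree w = n"
  shows "j f \<in> V n"
proof (rule j_in_csubspace[OF f V_csubspace])
  fix w c assume "w \<in> Poly_Mapping.keys f"
  then show "j (Poly_Mapping.single w c) \<in> V n"
    using j_single_in_V[of w c] f assms(2)[of w] by (auto simp: F_carrier)
qed

lemma homogeneous_part_closed: "f \<in> carrier F \<Longrightarrow> homogeneous_part n f \<in> carrier F"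
  by (auto simp: F_carrier keys_homogeneous_part)

lemma j_homogeneous_part: "f \<in> carrier F \<Longrightarrow> j (homogeneous_part n f) \<in> V n"
  by (rule j_in_V) (auto simp: homogeneous_part_closed keys_homogeneous_part)

lemma j_split:
  assumes f: "f \<in> carrier F"
  obtains D x where "finite D" "n \<notin> D" "x \<in> Pi D V" "j f = j (homogeneous_part n f) \<oplus> finsum C x D"
proof
  let ?D = "word_degree ` Poly_Mapping.keys f - {n}" and ?x = "\<lambda>d. j (homogeneous_part d f)"
  show fin: "finite ?D" and "n \<notin> ?D" by auto
  show x: "?x \<in> Pi ?D V" using f by (auto simp: j_homogeneous_part)
  have nonmem: "homogeneous_part n f = 0" if "n \<notin> word_degree ` Poly_Mapping.keys f"
    using that by (intro poly_mapping_eqI) (auto simp: lookup_homogeneous_part in_keys_iff)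
  have "f = (\<Sum>d\<in>insert n ?D. homogeneous_part d f)"
    using sum_homogeneous_parts[of f] nonmem
    by (cases "n \<in> word_degree ` Poly_Mapping.keys f") (auto simp: insert_absorb)
  also have "\<dots> = finsum F (\<lambda>d. homogeneous_part d f) (insert n ?D)"
    unfolding ck_free_algebra_def
    by (rule free_finsum[symmetric]) (use f homogeneous_part_closed in \<open>auto simp: ck_free_algebra_def\<close>)
  finally have "j f = finsum C ?x (insert n ?D)"
    using star_hom_finsum[OF star_algebra_F star_algebra_axioms j_hom, of "insert n ?D" "\<lambda>d. homogeneous_part d f"]
      f homogeneous_part_closed by auto
  also have "\<dots> = ?x n \<oplus> finsum C ?x ?D"
    using f j_homogeneous_part V_closed by (intro finsum_insert) auto
  finally show "j f = ?x n \<oplus> finsum C ?x ?D" .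
qed

text \<open>
  Taking a homogeneous component does not increase the norm. The components of degree \<open>d \<noteq> n\<close> are
  removed one at a time: if \<open>z\<close> has modulus one and \<open>z\<^sup>d\<^sup>-\<^sup>n = -1\<close>, then the average of the identity
  and \<open>z\<^sup>-\<^sup>n \<gamma>\<^sub>z\<close> is contractive, fixes the component of degree \<open>n\<close>, kills the one of degree \<open>d\<close>, and
  multiplies every other component by a scalar. Finitely many such averages replace the integral over
  the circle.
\<close>

lemma V_norm_le_sum:
  assumes "finite D" "n \<notin> D" "y \<in> V n" "x \<in> Pi D V"
  shows "cnorm C y \<le> cnorm C (y \<oplus> finsum C x D)"
  using assms
proof (induction D arbitrary: x rule: finite_induct)
  case empty
  then show ?case using V_closed by simp
next
  case (insert d D)
  define z where "z = cis (pi / of_int (d - n))"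
  have z1: "cmod z = 1" by (simp add: z_def)
  define T where "T a = (1/2) \<odot> (a \<oplus> z powi (- n) \<odot> \<gamma> z a)" for a
  note g = star_hom_props[OF gauge_hom[OF z1]]
  have Tc: "T a \<in> carrier C" if "a \<in> carrier C" for a
    using that g by (simp add: T_def smult_closed)
  have Tadd: "T (a \<oplus> b) = T a \<oplus> T b" if "a \<in> carrier C" "b \<in> carrier C" for a b
    using that g by (simp add: T_def smult_closed smult_r_distr a_ac)
  have Tnorm: "cnorm C (T a) \<le> cnorm C a" if "a \<in> carrier C" for a
  proof -
    have "cnorm C (a \<oplus> z powi (- n) \<odot> \<gamma> z a) \<le> cnorm C a + cnorm C (z powi (- n) \<odot> \<gamma> z a)"
      using that g by (intro seminorm_add) (auto simp: smult_closed)
    also have "\<dots> \<le> cnorm C a + cnorm C a"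
      using that g gauge_contractive[OF z1 that] by (simp add: seminorm_smult norm_power_int z1)
    finally show ?thesis
      using that g by (simp add: T_def seminorm_smult smult_closed)
  qed
  have TV: "T a = ((1 + z powi (m - n)) / 2) \<odot> a" if "a \<in> V m" for a m
  proof -
    have a: "a \<in> carrier C" "\<gamma> z a = z powi m \<odot> a" using that z1 by (auto simp: V_iff)
    have "z \<noteq> 0" using z1 by auto
    then have zz: "z powi (- n) * z powi m = z powi (m - n)"
      by (simp add: power_int_add[symmetric])
    have "T a = (1/2) \<odot> (1 \<odot> a \<oplus> z powi (m - n) \<odot> a)"
      using a by (simp add: T_def smult_one smult_assoc[symmetric] zz)
    then show ?thesis using a by (simp add: smult_l_distr[symmetric] smult_assoc[symmetric])
  qed
  \<comment> \<open>The choice of \<open>z\<close> makes the scalar of degree \<open>d\<close> vanish.\<close>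
  have "z powi (d - n) = -1"
  proof -
    have "z powi (d - n) = cis (of_int (d - n) * (pi / of_int (d - n)))"
      by (simp add: z_def cis_power_int)
    also have "\<dots> = -1" using insert.hyps insert.prems by (simp add: cis_pi)
    finally show ?thesis .
  qed
  then have Td: "T (x d) = \<zero>" using TV[of "x d" d] insert.prems V_closed by (auto simp: smult_zero_left)
  have Ty: "T y = y" using TV[of y n] insert.prems V_closed by (auto simp: smult_one)
  have xc: "x \<in> D \<rightarrow> carrier C" "x d \<in> carrier C" "y \<in> carrier C" using insert.prems V_closed by auto
  have Tsum: "T (finsum C x D) = finsum C (\<lambda>m. T (x m)) D"
    using insert.hyps(1) xc(1)
  proof (induction D rule: finite_induct)
    case empty
    then show ?case using g TV[of \<zero> 0] V_sub(2) by (simp add: smult_zero_right)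
  next
    case (insert i D)
    then have "x i \<in> carrier C" "x \<in> D \<rightarrow> carrier C" "(\<lambda>m. T (x m)) \<in> D \<rightarrow> carrier C" using Tc by auto
    then show ?case using insert Tadd Tc by simp
  qed
  have "T (y \<oplus> finsum C x (insert d D)) = T y \<oplus> (T (x d) \<oplus> T (finsum C x D))"
    using insert.hyps xc by (simp add: Tadd)
  also have "\<dots> = y \<oplus> finsum C (\<lambda>m. T (x m)) D"
    using xc Tc by (simp add: Tsum Td Ty finsum_closed Pi_iff)
  finally have eq: "T (y \<oplus> finsum C x (insert d D)) = y \<oplus> finsum C (\<lambda>m. T (x m)) D" .
  have "(\<lambda>m. T (x m)) \<in> Pi D V"
    using TV insert.prems V_sub(4) by (auto simp: Pi_iff)
  then have "cnorm C y \<le> cnorm C (y \<oplus> finsum C (\<lambda>m. T (x m)) D)"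
    using insert.IH insert.prems by auto
  also have "\<dots> \<le> cnorm C (y \<oplus> finsum C x (insert d D))"
    unfolding eq[symmetric] using xc insert.hyps by (intro Tnorm) auto
  finally show ?case .
qed

text \<open>
  Approximate an element \<open>a\<close> of degree \<open>n\<close> by a combination of words. Passing to the component of
  degree \<open>n\<close> of the difference shows that the words of degree \<open>n\<close> in it approximate \<open>a\<close> at least as
  well.
\<close>

lemma V_dense:
  "V n \<subseteq> cclosure C (j ` {f \<in> carrier F. \<forall>w\<in>Poly_Mapping.keys f. word_degree w = n})"
proof
  fix a assume a: "a \<in> V n"
  show "a \<in> cclosure C (j ` {f \<in> carrier F. \<forall>w\<in>Poly_Mapping.keys f. word_degree w = n})"
  proof (rule cclosureI)
    show "j ` {f \<in> carrier F. \<forall>w\<in>Poly_Mapping.keys f. word_degree w = n} \<subseteq> carrier C" using j(1) by auto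
    show ac: "a \<in> carrier C" using a V_closed by blast
    fix \<epsilon> :: real assume "\<epsilon> > 0"
    then obtain f where f: "f \<in> carrier F" "cnorm C (a \<ominus> j f) < \<epsilon>" using j_dense[OF ac] by blast
    let ?h = "homogeneous_part n f"
    obtain D x where D: "finite D" "n \<notin> D" "x \<in> Pi D V" "j f = j ?h \<oplus> finsum C x D"
      using j_split[OF f(1)] .
    have h: "j ?h \<in> V n" using f(1) by (rule j_homogeneous_part)
    define y where "y d = (-1) \<odot> x d" for d
    have y: "y \<in> Pi D V" using D(3) V_sub(4) by (auto simp: y_def Pi_iff)
    have sum: "finsum C x D \<in> carrier C" using D(3) V_closed by (intro finsum_closed) auto
    have ysum: "finsum C y D = (-1) \<odot> finsum C x D"
      using D(1,3)
    proof (induction D rule: finite_induct)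
      case empty
      then show ?case by (simp add: smult_zero_right)
    next
      case (insert i D)
      then have c: "x i \<in> carrier C" "x \<in> D \<rightarrow> carrier C" "y \<in> D \<rightarrow> carrier C" "y i \<in> carrier C"
        using V_closed by (auto simp: y_def Pi_iff intro!: smult_closed)
      then have "finsum C y (insert i D) = y i \<oplus> finsum C y D"
        using insert.hyps by (intro finsum_insert) auto
      also have "\<dots> = y i \<oplus> (-1) \<odot> finsum C x D" using insert by simp
      also have "y i = (-1) \<odot> x i" by (simp add: y_def)
      finally show ?case using insert.hyps c by (simp add: smult_r_distr)
    qed
    have ah: "a \<ominus> j ?h \<in> V n"
      using a h ac V_closed V_sub(3,4) by (simp add: diff_eq_smult)
    have "cnorm C (a \<ominus> j ?h) \<le> cnorm C (a \<ominus> j ?h \<oplus> finsum C y D)"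
      by (rule V_norm_le_sum[OF D(1,2) ah y])
    also have "a \<ominus> j ?h \<oplus> finsum C y D = a \<ominus> j f"
      using ac h V_closed[OF h] sum D(4) f(1) j(1)
      by (simp add: ysum diff_eq_smult smult_r_distr smult_closed a_assoc)
    finally show "\<exists>b\<in>j ` {f \<in> carrier F. \<forall>w\<in>Poly_Mapping.keys f. word_degree w = n}. cnorm C (a \<ominus> b) < \<epsilon>"
      using f homogeneous_part_closed[OF f(1)] by (intro bexI[of _ "j ?h"]) (auto simp: keys_homogeneous_part)
  qed
qed

text \<open>
  By \<open>V_norm_le_sum\<close> each summand of a vanishing sum has norm at most zero.
\<close>

lemma V_independent: "independent_subspaces C UNIV V"
  unfolding independent_subspaces_def
proof (intro allI impI ballI)
  fix D x n assume D: "finite D \<and> D \<subseteq> UNIV \<and> x \<in> Pi D V \<and> finsum C x D = \<zero>" and n: "n \<in> D"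
  have x: "x n \<in> V n" "x \<in> Pi (D - {n}) V" using D n by auto
  have "finsum C x (insert n (D - {n})) = x n \<oplus> finsum C x (D - {n})"
    using D x V_closed by (intro finsum_insert) auto
  then have "x n \<oplus> finsum C x (D - {n}) = \<zero>" using D n by (simp add: insert_absorb)
  then have "cnorm C (x n) \<le> 0"
    using V_norm_le_sum[of "D - {n}" n "x n" x] D x by (simp add: seminorm_zero)
  then show "x n = \<zero>" using V_closed[OF x(1)] seminorm_nonneg by (intro norm_eq_0) force+
qed

lemma V_cclosed: "closedin (ctopology C) (V n)"
  unfolding closedin_iff_cclosure[OF V_subset]
proof
  fix a assume a: "a \<in> cclosure C (V n)"
  have ac: "a \<in> carrier C" using a cclosure_subset_carrier by blast
  have "\<gamma> z a = z powi n \<odot> a" if z: "cmod z = 1" for z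
  proof (rule eqI_norm)
    note g = star_hom_props[OF gauge_hom[OF z]]
    show c: "\<gamma> z a \<in> carrier C" "z powi n \<odot> a \<in> carrier C" using ac g by (auto simp: smult_closed)
    show "cnorm C (\<gamma> z a \<ominus> z powi n \<odot> a) \<le> 0"
    proof (rule field_le_epsilon)
      fix \<epsilon> :: real assume "\<epsilon> > 0"
      then have "\<epsilon> / 2 > 0" by simp
      then obtain b where b: "b \<in> V n" "cnorm C (a \<ominus> b) < \<epsilon> / 2"
        using cclosureE[OF a V_subset] by blast
      have bc: "b \<in> carrier C" "\<gamma> z b = z powi n \<odot> b" using b z by (auto simp: V_iff)
      have "cnorm C (\<gamma> z a \<ominus> z powi n \<odot> a) \<le> cnorm C (\<gamma> z a \<ominus> \<gamma> z b) + cnorm C (z powi n \<odot> b \<ominus> z powi n \<odot> a)"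
        using seminorm_triangle[of "\<gamma> z a" "\<gamma> z b" "z powi n \<odot> a"] c bc by (simp add: smult_closed)
      also have "\<gamma> z a \<ominus> \<gamma> z b = \<gamma> z (a \<ominus> b)"
        using star_hom_diff[OF star_algebra_axioms star_algebra_axioms gauge_hom[OF z] ac bc(1)] by simp
      also have "cnorm C (\<gamma> z (a \<ominus> b)) \<le> cnorm C (a \<ominus> b)"
        using ac bc by (intro gauge_contractive[OF z]) simp
      also have "cnorm C (z powi n \<odot> b \<ominus> z powi n \<odot> a) = cnorm C (a \<ominus> b)"
        using ac bc z by (simp add: smult_diff[symmetric] seminorm_smult norm_power_int seminorm_diff_commute)
      finally show "cnorm C (\<gamma> z a \<ominus> z powi n \<odot> a) \<le> 0 + \<epsilon>" using b(2) by simp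
    qed
  qed
  then show "a \<in> V n" using ac by (simp add: V_iff)
qed

lemma V_total: "cclosure C (csubspace C hull (\<Union>n. V n)) = carrier C"
proof (rule equalityI[OF cclosure_subset_carrier], rule subsetI, rule cclosureI)
  have sub: "(\<Union>n. V n) \<subseteq> carrier C" using V_subset by auto
  note hull = csubspace_hull[OF sub]
  show "csubspace C hull (\<Union>n. V n) \<subseteq> carrier C" using csubspaceD(1)[OF hull] .
  fix a and \<epsilon> :: real assume a: "a \<in> carrier C" and "\<epsilon> > 0"
  then obtain f where f: "f \<in> carrier F" "cnorm C (a \<ominus> j f) < \<epsilon>" by (metis j_dense)
  have "j f \<in> csubspace C hull (\<Union>n. V n)"
    by (rule j_in_csubspace[OF f(1) hull], rule hull_inc) (use j_single_in_V f(1) F_carrier in blast)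
  then show "\<exists>y\<in>csubspace C hull (\<Union>n. V n). cnorm C (a \<ominus> y) < \<epsilon>" using f(2) by blast
qed

lemma graded: "graded_cstar_algebra integer_group C V"
  unfolding graded_cstar_algebra_def
proof (intro conjI ballI)
  show "prod_span C (V g) (V h) \<subseteq> V (g \<otimes>\<^bsub>integer_group\<^esub> h)" for g h
    using prod_span_least[OF V_csubspace V_mult] by (auto simp: integer_group_def)
qed (use V_csubspace V_cclosed V_independent V_star V_total cstar_algebra_axioms in
    \<open>auto simp: image_subset_iff\<close>)

lemma strongly_graded_iff:
  "strongly_graded_cstar_algebra integer_group C V \<longleftrightarrow>
    (\<forall>m n. V (m + n) \<subseteq> cclosure C (prod_span C (V m) (V n)))"
  by (simp add: strongly_graded_cstar_algebra_def graded)

end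


section \<open>Property (Y) implies that the grading is strong\<close>

text \<open>
  Edges are added at the source end, since this is where both an infinite path and the
  Cuntz--Krieger sum continue a path. With this rule the empty list is a path at every vertex, which
  is why the range \<open>v\<close> is recorded.
\<close>

inductive path_between :: "('v, 'e) pre_digraph \<Rightarrow> 'v \<Rightarrow> 'e list \<Rightarrow> 'v \<Rightarrow> bool" for E where
  Nil: "v \<in> verts E \<Longrightarrow> path_between E v [] v"
| snoc: "\<lbrakk>path_between E v es w; e \<in> arcs E; head E e = w\<rbrakk> \<Longrightarrow> path_between E v (es @ [e]) (tail E e)"

lemma finite_path_between:
  assumes wf: "wf_digraph E" and \<beta>: "\<beta> \<in> finite_paths E"
  shows "\<exists>v es. path_between E v es (path_source E \<beta>) \<and> length es = path_length \<beta>"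
proof -
  have "path_between E (head E (hd es)) es (tail E (last es))"
    if "es \<noteq> []" "set es \<subseteq> arcs E" "\<forall>i. Suc i < length es \<longrightarrow> tail E (es ! i) = head E (es ! Suc i)" for es
    using that
  proof (induction es rule: rev_nonempty_induct)
    case (single e)
    then show ?case
      using path_between.snoc[OF path_between.Nil, of "head E e" E e] wf by (auto simp: wf_digraph_def)
  next
    case (snoc e es)
    have 1: "tail E ((es @ [e]) ! i) = head E ((es @ [e]) ! Suc i)" if "Suc i < length (es @ [e])" for i
      using snoc.prems that by blast
    have "tail E (es ! i) = head E (es ! Suc i)" if "Suc i < length es" for i
      using 1[of i] that by (simp add: nth_append)
    then have "path_between E (head E (hd es)) es (tail E (last es))"
      using snoc.IH snoc.prems by simp
    moreover have "tail E (last es) = head E e"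
      using 1[of "length es - 1"] snoc.hyps by (simp add: nth_append last_conv_nth)
    ultimately show ?case using path_between.snoc[of E _ es] snoc by simp
  qed
  note edge_path = this
  show ?thesis
  proof (cases \<beta>)
    case (Vertex_Path v)
    then have "v \<in> verts E" using \<beta> by (auto simp: finite_paths_def)
    then show ?thesis using Vertex_Path path_between.Nil[of v E] by auto
  next
    case (Edge_Path es)
    then have "es \<noteq> []" "set es \<subseteq> arcs E" "\<forall>i. Suc i < length es \<longrightarrow> tail E (es ! i) = head E (es ! Suc i)"
      using \<beta> by (auto simp: finite_paths_def)
    then show ?thesis using edge_path[of es] Edge_Path by auto
  qed
qed

context graph_algebra
begin

definition path_isom :: "'v \<Rightarrow> 'e list \<Rightarrow> (nat \<Rightarrow> ('v, 'e) ck_gen star_word \<Rightarrow>\<^sub>0 complex) set" where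
  "path_isom v es = foldl (\<lambda>u e. u \<otimes> s e) (p v) es"

lemma path_isom:
  assumes "path_between E v es w"
  shows path_isom_in_V: "path_isom v es \<in> V (int (length es))"
    and path_isom_source: "w \<in> verts E" "path_isom v es \<otimes> p w = path_isom v es"
    and path_isom_adj: "star C (path_isom v es) \<otimes> path_isom v es = p w"
proof -
  have "path_isom v es \<in> V (int (length es)) \<and> w \<in> verts E \<and> path_isom v es \<otimes> p w = path_isom v es \<and>
    star C (path_isom v es) \<otimes> path_isom v es = p w"
    using assms
  proof induction
    case (Nil v)
    then show ?case by (simp add: path_isom_def p_in_V p_adj p_idem)
  next
    case (snoc v es w e)
    let ?u = "path_isom v es"
    have u: "?u \<in> carrier C" "path_isom v (es @ [e]) = ?u \<otimes> s e"
      using snoc V_closed by (auto simp: path_isom_def)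
    have e: "s e \<in> carrier C" "star C (s e) \<in> carrier C" "star C ?u \<in> carrier C"
      using snoc u by (auto simp: star_closed)
    have "star C (?u \<otimes> s e) \<otimes> (?u \<otimes> s e) = star C (s e) \<otimes> (star C ?u \<otimes> ?u \<otimes> s e)"
      using u e by (simp add: star_mult mult_assoc mult_closed)
    also have "\<dots> = p (tail E e)"
      using snoc p_s[of e] s_adj_s[of e] by simp
    finally show ?case
      using snoc u e V_mult[of ?u "int (length es)" "s e" 1] s_in_V[of e]
      by (auto simp: mult_assoc s_p add.commute)
  qed
  then show "path_isom v es \<in> V (int (length es))" "w \<in> verts E" "path_isom v es \<otimes> p w = path_isom v es"
    "star C (path_isom v es) \<otimes> path_isom v es = p w" by auto
qed

abbreviation "J n \<equiv> prod_span C (V n) (V (- n))"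

lemma J_csubspace: "csubspace C (J n)"
  by (rule csubspace_prod_span[OF V_subset V_subset])

text \<open>
  In \<open>p v = \<Sum>\<^sub>e s e (s e)\<^sup>*\<close> the projection at the source of \<open>e\<close> can be inserted between \<open>s e\<close> and
  \<open>(s e)\<^sup>*\<close>. If that projection is in the span for \<open>n\<close>, the two outer factors raise \<open>n\<close> by one.
\<close>

lemma p_in_J_nonneg:
  assumes rf: "row_finite E" and ns: "no_sources E" and v: "v \<in> verts E"
  shows "p v \<in> J (int n)"
  using v
proof (induction n arbitrary: v)
  case 0
  then show ?case using prod_spanI[of "p v" "V 0" "p v" "V 0"] by (simp add: p_in_V p_idem)
next
  case (Suc n)
  let ?R = "{e \<in> arcs E. head E e = v}"
  have R: "finite ?R" "?R \<noteq> {}" using rf ns Suc.prems by (auto simp: row_finite_def no_sources_def)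
  have "s e \<otimes> star C (s e) \<in> J (int (Suc n))" if "e \<in> ?R" for e
  proof -
    have e: "e \<in> arcs E" using that by simp
    have se: "s e \<in> V 1" "star C (s e) \<in> V (- 1)" using V_star[OF s_in_V[OF e]] s_in_V[OF e] by auto
    have "p (tail E e) \<in> J (int n)" using Suc.IH e by simp
    then have "s e \<otimes> p (tail E e) \<in> prod_span C (V (int (Suc n))) (V (- int n))"
      using V_mult[OF se(1), of _ "int n"] by (intro prod_span_mult_left V_subset) (auto simp: e V_closed)
    then have "s e \<otimes> p (tail E e) \<otimes> star C (s e) \<in> J (int (Suc n))"
    proof (rule prod_span_mult_right[OF V_subset V_subset V_subset, rotated 2])
      show "t \<otimes> star C (s e) \<in> V (- int (Suc n))" if "t \<in> V (- int n)" for t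
        using V_mult[OF that se(2)] by (simp add: algebra_simps)
    qed (simp add: e star_closed)
    then show ?thesis by (simp add: s_p e)
  qed
  then show ?case unfolding p_sum[OF Suc.prems R]
    by (intro csubspace_finsum J_csubspace R) auto
qed

text \<open>
  The two paths have the same source \<open>w\<close>, so \<open>p w = s\<^sub>\<beta>\<^sup>* s\<^sub>\<beta>\<close> can be inserted in
  \<open>s\<^sub>\<alpha> s\<^sub>\<alpha>\<^sup>*\<close>, which splits it into factors of degree \<open>-k\<close> and \<open>k\<close>.
\<close>

lemma path_projection_in_J_neg:
  assumes \<alpha>: "path_between E v es w" and \<beta>: "path_between E v' fs w" and len: "length fs = length es + k"
  shows "path_isom v es \<otimes> star C (path_isom v es) \<in> J (- int k)"
proof -
  let ?u = "path_isom v es" and ?b = "path_isom v' fs"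
  have u: "?u \<in> V (int (length es))" and b: "?b \<in> V (int (length fs))" using \<alpha> \<beta> path_isom_in_V by auto
  have c: "?u \<in> carrier C" "?b \<in> carrier C" "star C ?u \<in> carrier C" "star C ?b \<in> carrier C"
    using V_closed[OF u] V_closed[OF b] star_closed by auto
  have "?u \<otimes> star C ?u = ?u \<otimes> (star C ?b \<otimes> ?b) \<otimes> star C ?u"
    using path_isom_adj[OF \<beta>] path_isom_source[OF \<alpha>] by simp
  also have "\<dots> = (?u \<otimes> star C ?b) \<otimes> (?b \<otimes> star C ?u)" using c by (simp add: mult_assoc mult_closed)
  also have "\<dots> \<in> J (- int k)"
    using V_mult[OF u V_star[OF b]] V_mult[OF b V_star[OF u]] len by (intro prod_spanI) auto
  finally show ?thesis .
qed

text \<open>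
  An argument in the style of Koenig's lemma. The projection \<open>s\<^sub>\<alpha> s\<^sub>\<alpha>\<^sup>*\<close> is the finite sum of the
  projections of the paths that extend \<open>\<alpha>\<close> by one edge, and the span is a subspace. So if it misses
  \<open>s\<^sub>\<alpha> s\<^sub>\<alpha>\<^sup>*\<close>, it also misses the projection of some extension. Starting from \<open>p v\<close> this yields an
  infinite path that contradicts property (Y) by \<open>path_projection_in_J_neg\<close>.
\<close>

lemma p_in_J_neg:
  assumes rf: "row_finite E" and ns: "no_sources E" and Y: "property_Y E" and v: "v \<in> verts E"
  shows "p v \<in> J (- int k)"
proof (rule ccontr)
  assume v_bad: "p v \<notin> J (- int k)"
  define bad where
    "bad es \<longleftrightarrow> (\<exists>w. path_between E v es w) \<and> path_isom v es \<otimes> star C (path_isom v es) \<notin> J (- int k)" for es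
  have "bad []" using v v_bad path_between.Nil[OF v] by (auto simp: bad_def path_isom_def p_adj p_idem)
  have step: "\<exists>e. bad (es @ [e])" if "bad es" for es
  proof (rule ccontr)
    assume no: "\<nexists>e. bad (es @ [e])"
    let ?u = "path_isom v es"
    obtain w where w: "path_between E v es w" and nJ: "?u \<otimes> star C ?u \<notin> J (- int k)"
      using \<open>bad es\<close> unfolding bad_def by blast
    let ?R = "{e \<in> arcs E. head E e = w}"
    note pw = path_isom_source[OF w]
    have R: "finite ?R" "?R \<noteq> {}" using rf ns pw(1) by (auto simp: row_finite_def no_sources_def)
    have u: "?u \<in> carrier C" "star C ?u \<in> carrier C" using V_closed[OF path_isom_in_V[OF w]] star_closed by auto
    have mem: "?u \<otimes> (s e \<otimes> star C (s e)) \<otimes> star C ?u \<in> J (- int k)" if e: "e \<in> ?R" for e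
    proof -
      have "path_between E v (es @ [e]) (tail E e)" using e w by (auto intro: path_between.snoc)
      then have "path_isom v (es @ [e]) \<otimes> star C (path_isom v (es @ [e])) \<in> J (- int k)"
        using no by (auto simp: bad_def)
      then show ?thesis using e u
        by (simp add: path_isom_def star_mult mult_assoc mult_closed star_closed)
    qed
    \<comment> \<open>The elements whose compression by the path isometry lies in the span form a subspace.\<close>
    have "csubspace C {a \<in> carrier C. ?u \<otimes> a \<otimes> star C ?u \<in> J (- int k)}"
      using csubspaceD[OF J_csubspace[of "- int k"]] u
      by (auto simp: csubspace_def mult_l_distr mult_r_distr mult_closed smult_mult_left smult_mult_right
          smult_closed mult_zero_left mult_zero_right)
    then have "p w \<in> {a \<in> carrier C. ?u \<otimes> a \<otimes> star C ?u \<in> J (- int k)}"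
      unfolding p_sum[OF pw(1) R] using mem by (intro csubspace_finsum R) (auto simp: mult_closed star_closed)
    then show False using nJ pw(2) by simp
  qed
  have "\<exists>f. \<forall>n. (bad (f n) \<and> (n = 0 \<longrightarrow> f n = [])) \<and> (\<exists>e. f (Suc n) = f n @ [e])"
  proof (rule dependent_nat_choice)
    show "\<exists>es. bad es \<and> (0 = (0::nat) \<longrightarrow> es = [])" using \<open>bad []\<close> by blast
    show "\<exists>es'. (bad es' \<and> (Suc n = 0 \<longrightarrow> es' = [])) \<and> (\<exists>e. es' = es @ [e])"
      if "bad es \<and> (n = 0 \<longrightarrow> es = [])" for es and n :: nat
      using step[of es] that by blast
  qed
  then obtain f where f0: "f 0 = []" and f: "\<And>n. bad (f n)" and fS: "\<And>n. \<exists>e. f (Suc n) = f n @ [e]"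
    by metis
  define x where "x n = last (f (Suc n))" for n
  have fx: "f (Suc n) = f n @ [x n]" for n using fS[of n] by (auto simp: x_def)
  have f_eq: "f n = map x [0..<n]" for n by (induction n) (auto simp: f0 fx)
  have path: "\<exists>w. path_between E v (f n) w" for n using f by (simp add: bad_def)
  have last_arc: "e \<in> arcs E \<and> w = tail E e \<and> path_between E v es (head E e)"
    if "path_between E v (es @ [e]) w" for es e w
    using that by cases auto
  have xn: "x n \<in> arcs E \<and> path_between E v (f n) (head E (x n)) \<and> path_between E v (f (Suc n)) (tail E (x n))" for n
    using path[of "Suc n"] last_arc unfolding fx by blast
  have end_unique: "w = w'" if "path_between E v es w" "path_between E v es w'" for es w w'
  proof (cases es rule: rev_cases)
    case Nil
    have "u = v" if "path_between E v [] u" for u using that by cases auto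
    then show ?thesis using that Nil by metis
  next
    case (snoc es' e)
    then show ?thesis using last_arc[of es' e w] last_arc[of es' e w'] that by simp
  qed
  have "x \<in> infinite_paths E"
    using xn end_unique unfolding infinite_paths_def by blast
  then obtain \<alpha> \<beta> where ab: "\<alpha> \<in> initial_segments E x" "\<beta> \<in> finite_paths E"
    "path_source E \<alpha> = path_source E \<beta>" "int (path_length \<beta>) - int (path_length \<alpha>) = int k"
    using Y unfolding property_Y_def by blast
  have "\<exists>n. path_length \<alpha> = n \<and> path_between E v (f n) (path_source E \<alpha>)"
  proof -
    have "\<alpha> = Vertex_Path (head E (x 0)) \<or> (\<exists>n\<ge>1. \<alpha> = Edge_Path (map x [0..<n]))"
      using ab(1) by (auto simp: initial_segments_def)
    moreover have "\<exists>m. n = Suc m" if "n \<ge> 1" for n :: nat using that by (cases n) auto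
    ultimately consider "\<alpha> = Vertex_Path (head E (x 0))" | n where "\<alpha> = Edge_Path (map x [0..<Suc n])"
      by blast
    then show ?thesis
    proof cases
      case 1
      then show ?thesis using xn[of 0] by (intro exI[of _ 0]) (simp add: f0)
    next
      case (2 n)
      then show ?thesis using xn[of n] by (intro exI[of _ "Suc n"]) (simp add: f_eq)
    qed
  qed
  then obtain n where n: "path_length \<alpha> = n" "path_between E v (f n) (path_source E \<alpha>)" by blast
  obtain v' fs where "path_between E v' fs (path_source E \<alpha>)" "length fs = path_length \<beta>"
    using finite_path_between[OF wf ab(2)] ab(3) by auto
  then have "path_isom v (f n) \<otimes> star C (path_isom v (f n)) \<in> J (- int k)"
    using ab(4) n by (intro path_projection_in_J_neg) (auto simp: f_eq)
  then show False using f[of n] by (simp add: bad_def)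
qed

lemma letter_ev_absorb:
  assumes "fst l \<in> gens"
  shows "\<exists>v\<in>verts E. p v \<otimes> letter_ev C gen_ev l = letter_ev C gen_ev l"
proof -
  consider v where "v \<in> verts E" "letter_ev C gen_ev l = p v"
    | e where "e \<in> arcs E" "letter_ev C gen_ev l = s e"
    | e where "e \<in> arcs E" "letter_ev C gen_ev l = star C (s e)"
    using assms by (cases "snd l") (auto simp: letter_ev_def p_adj)
  then show ?thesis
  proof cases
    case (1 v)
    then show ?thesis using p_idem by auto
  next
    case (2 e)
    then show ?thesis using p_s[of e] by (intro bexI[of _ "head E e"]) auto
  next
    case (3 e)
    then show ?thesis using p_adj_s[of e] by (intro bexI[of _ "tail E e"]) auto
  qed
qed

text \<open>
  A word \<open>w\<close> of degree \<open>m + n\<close> satisfies \<open>w = p v \<cdot> w\<close> for some vertex \<open>v\<close>, and the factor of degree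
  \<open>-m\<close> in the products that make up \<open>p v\<close> turns \<open>w\<close> into an element of degree \<open>n\<close>.
\<close>

lemma strongly_graded_if_p_in_J:
  assumes pJ: "\<And>v n. v \<in> verts E \<Longrightarrow> p v \<in> J n"
  shows "V (m + n) \<subseteq> cclosure C (prod_span C (V m) (V n))"
proof -
  let ?P = "prod_span C (V m) (V n)"
  note sub = csubspace_prod_span[OF V_subset V_subset, of m n]
  have "j f \<in> ?P" if f: "f \<in> carrier F" "\<forall>w\<in>Poly_Mapping.keys f. word_degree w = m + n" for f
  proof (rule j_in_csubspace[OF f(1) sub])
    fix w c assume w: "w \<in> Poly_Mapping.keys f"
    have wg: "w \<in> gen_words gens" using w f by (auto simp: F_carrier)
    then obtain l ls where l: "letters w = l # ls" and gl: "fst l \<in> gens" "fst ` set ls \<subseteq> gens"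
      by (cases "letters w") (auto simp: gen_words_def)
    obtain v where v: "v \<in> verts E" "p v \<otimes> letter_ev C gen_ev l = letter_ev C gen_ev l"
      using letter_ev_absorb[OF gl(1)] by blast
    let ?a = "list_ev C gen_ev (letters w)"
    have aV: "?a \<in> V (m + n)"
      using list_ev_in_V[of "letters w"] w wg f by (auto simp: gen_words_def word_degree_def)
    have "p v \<otimes> ?a = ?a"
      using v gl letter_ev_closed[OF gen_ev gl(1)] list_ev_closed[OF gen_ev gl(2)]
      by (cases "ls = []") (simp_all add: l list_ev_Cons[OF gen_ev] mult_assoc[symmetric])
    moreover have "p v \<otimes> ?a \<in> ?P"
    proof (rule prod_span_mult_right[OF V_subset V_subset V_subset V_closed[OF aV]])
      show "p v \<in> J m" using pJ v by simp
      show "t \<otimes> ?a \<in> V n" if "t \<in> V (- m)" for t using V_mult[OF that aV] by simp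
    qed
    ultimately show "j (Poly_Mapping.single w c) \<in> ?P"
      using csubspaceD(4)[OF sub] wg by (simp add: j_single)
  qed
  then show ?thesis
    using V_dense[of "m + n"] cclosure_mono[of "j ` {f \<in> carrier F. \<forall>w\<in>Poly_Mapping.keys f. word_degree w = m + n}" ?P]
    by blast
qed

theorem strongly_graded_if_property_Y:
  assumes "row_finite E" "no_sources E" "property_Y E"
  shows "strongly_graded_cstar_algebra integer_group C V"
proof -
  have "p v \<in> J n" if "v \<in> verts E" for v n
  proof (cases "n \<ge> 0")
    case True
    then show ?thesis using p_in_J_nonneg[OF assms(1,2) that, of "nat n"] by simp
  next
    case False
    then show ?thesis using p_in_J_neg[OF assms that, of "nat (- n)"] by simp
  qed
  then show ?thesis using strongly_graded_if_p_in_J by (simp add: strongly_graded_iff)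
qed

end


section \<open>Adjointable operators on finitely supported functions\<close>

abbreviation "fscale c \<equiv> Poly_Mapping.map ((*) (c::complex))"

definition ip :: "('x \<Rightarrow>\<^sub>0 complex) \<Rightarrow> ('x \<Rightarrow>\<^sub>0 complex) \<Rightarrow> complex" where
  "ip \<xi> \<eta> = (\<Sum>x\<in>Poly_Mapping.keys \<xi>. Poly_Mapping.lookup \<xi> x * cnj (Poly_Mapping.lookup \<eta> x))"

definition l2 :: "('x \<Rightarrow>\<^sub>0 complex) \<Rightarrow> real" where
  "l2 \<xi> = L2_set (\<lambda>x. cmod (Poly_Mapping.lookup \<xi> x)) (Poly_Mapping.keys \<xi>)"

declare lookup_smult [simp]

lemma ip_superset:
  assumes "finite S" "Poly_Mapping.keys \<xi> \<subseteq> S"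
  shows "ip \<xi> \<eta> = (\<Sum>x\<in>S. Poly_Mapping.lookup \<xi> x * cnj (Poly_Mapping.lookup \<eta> x))"
  unfolding ip_def by (rule sum.mono_neutral_left) (use assms in \<open>auto simp: in_keys_iff\<close>)

lemma l2_superset:
  assumes "finite S" "Poly_Mapping.keys \<xi> \<subseteq> S"
  shows "l2 \<xi> = L2_set (\<lambda>x. cmod (Poly_Mapping.lookup \<xi> x)) S"
  unfolding l2_def L2_set_def
  by (rule arg_cong[where f = sqrt], rule sum.mono_neutral_left) (use assms in \<open>auto simp: in_keys_iff\<close>)

lemma ip_cnj: "cnj (ip \<xi> \<eta>) = ip \<eta> \<xi>"
  using ip_superset[of "Poly_Mapping.keys \<xi> \<union> Poly_Mapping.keys \<eta>" \<xi> \<eta>]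
    ip_superset[of "Poly_Mapping.keys \<xi> \<union> Poly_Mapping.keys \<eta>" \<eta> \<xi>]
  by (simp add: mult.commute)

lemma ip_single: "ip (Poly_Mapping.single x 1) \<eta> = cnj (Poly_Mapping.lookup \<eta> x)"
  by (simp add: ip_def)

lemma ip_single_right: "ip \<xi> (Poly_Mapping.single x 1) = Poly_Mapping.lookup \<xi> x"
  using ip_cnj[of "Poly_Mapping.single x 1" \<xi>] by (simp add: ip_single)

lemma ip_ext: "(\<And>\<eta>. ip \<xi> \<eta> = ip \<xi>' \<eta>) \<Longrightarrow> \<xi> = \<xi>'"
  by (metis ip_single_right poly_mapping_eqI)

lemma ip_add_left: "ip (\<xi> + \<xi>') \<eta> = ip \<xi> \<eta> + ip \<xi>' \<eta>"
proof -
  let ?S = "Poly_Mapping.keys \<xi> \<union> Poly_Mapping.keys \<xi>'"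
  show ?thesis
    using Poly_Mapping.keys_add[of \<xi> \<xi>']
    by (simp add: ip_superset[of ?S] lookup_add sum.distrib distrib_right)
qed

lemma ip_add_right: "ip \<eta> (\<xi> + \<xi>') = ip \<eta> \<xi> + ip \<eta> \<xi>'"
  by (metis complex_cnj_add ip_add_left ip_cnj)

lemma ip_fscale_left: "ip (fscale c \<xi>) \<eta> = c * ip \<xi> \<eta>"
proof -
  have "Poly_Mapping.keys (fscale c \<xi>) \<subseteq> Poly_Mapping.keys \<xi>" by (auto simp: in_keys_iff)
  then show ?thesis by (simp add: ip_superset[of "Poly_Mapping.keys \<xi>"] sum_distrib_left mult.assoc)
qed

lemma ip_fscale_right: "ip \<eta> (fscale c \<xi>) = cnj c * ip \<eta> \<xi>"
  by (metis complex_cnj_mult ip_fscale_left ip_cnj)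

lemma ip_self: "ip \<xi> \<xi> = of_real ((l2 \<xi>)\<^sup>2)"
  by (simp add: ip_def l2_def L2_set_def sum_nonneg complex_norm_square[symmetric])

lemma l2_nonneg [simp]: "0 \<le> l2 \<xi>"
  by (simp add: l2_def L2_set_nonneg)

lemma l2_single [simp]: "l2 (Poly_Mapping.single x 1) = 1"
  by (simp add: l2_def)

lemma l2_add: "l2 (\<xi> + \<eta>) \<le> l2 \<xi> + l2 \<eta>"
proof -
  let ?S = "Poly_Mapping.keys \<xi> \<union> Poly_Mapping.keys \<eta>"
  have "l2 (\<xi> + \<eta>) = L2_set (\<lambda>x. cmod (Poly_Mapping.lookup \<xi> x + Poly_Mapping.lookup \<eta> x)) ?S"
    using Poly_Mapping.keys_add[of \<xi> \<eta>] by (simp add: l2_superset[of ?S] lookup_add)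
  also have "\<dots> \<le> L2_set (\<lambda>x. cmod (Poly_Mapping.lookup \<xi> x) + cmod (Poly_Mapping.lookup \<eta> x)) ?S"
    by (intro L2_set_mono norm_triangle_ineq) auto
  also have "\<dots> \<le> l2 \<xi> + l2 \<eta>"
    by (simp add: l2_superset[of ?S] L2_set_triangle_ineq)
  finally show ?thesis .
qed

lemma l2_fscale: "l2 (fscale c \<xi>) = cmod c * l2 \<xi>"
proof -
  have "Poly_Mapping.keys (fscale c \<xi>) \<subseteq> Poly_Mapping.keys \<xi>" by (auto simp: in_keys_iff)
  then show ?thesis by (simp add: l2_superset[of "Poly_Mapping.keys \<xi>"] norm_mult L2_set_right_distrib)
qed

lemma ip_Cauchy_Schwarz: "cmod (ip \<xi> \<eta>) \<le> l2 \<xi> * l2 \<eta>"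
proof -
  let ?S = "Poly_Mapping.keys \<xi> \<union> Poly_Mapping.keys \<eta>"
  have "cmod (ip \<xi> \<eta>) \<le> (\<Sum>x\<in>?S. \<bar>cmod (Poly_Mapping.lookup \<xi> x)\<bar> * \<bar>cmod (Poly_Mapping.lookup \<eta> x)\<bar>)"
    by (subst ip_superset[of ?S]) (auto intro!: sum_norm_le simp: norm_mult)
  also have "\<dots> \<le> l2 \<xi> * l2 \<eta>"
    by (simp only: l2_superset[of ?S] L2_set_mult_ineq finite_Un finite_keys sup_ge1 sup_ge2)
  finally show ?thesis .
qed

type_synonym 'x op = "('x \<Rightarrow>\<^sub>0 complex) \<Rightarrow> ('x \<Rightarrow>\<^sub>0 complex)"

definition l2_bounded :: "'x op \<Rightarrow> bool" where
  "l2_bounded T \<longleftrightarrow> (\<exists>K\<ge>0. \<forall>\<xi>. l2 (T \<xi>) \<le> K * l2 \<xi>)"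

text \<open>
  An operator is stored together with its adjoint. Then the involution is the exchange of the two
  components, and it is defined although the space of functions is not complete.
\<close>

definition adj_ops :: "('x op \<times> 'x op) star_alg" where
  "adj_ops =
     \<lparr>carrier = {P. (\<forall>\<xi> \<eta>. ip (fst P \<xi>) \<eta> = ip \<xi> (snd P \<eta>)) \<and> l2_bounded (fst P) \<and> l2_bounded (snd P)},
      mult = (\<lambda>P Q. (\<lambda>\<xi>. fst P (fst Q \<xi>), \<lambda>\<xi>. snd Q (snd P \<xi>))), one = undefined,
      zero = (\<lambda>\<xi>. 0, \<lambda>\<xi>. 0),
      add = (\<lambda>P Q. (\<lambda>\<xi>. fst P \<xi> + fst Q \<xi>, \<lambda>\<xi>. snd P \<xi> + snd Q \<xi>)),
      smult = (\<lambda>c P. (\<lambda>\<xi>. fscale c (fst P \<xi>), \<lambda>\<xi>. fscale (cnj c) (snd P \<xi>))),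
      star = (\<lambda>P. (snd P, fst P))\<rparr>"

lemma adj_ops_simps [simp]:
  "P \<otimes>\<^bsub>adj_ops\<^esub> Q = (\<lambda>\<xi>. fst P (fst Q \<xi>), \<lambda>\<xi>. snd Q (snd P \<xi>))"
  "\<zero>\<^bsub>adj_ops\<^esub> = (\<lambda>\<xi>. 0, \<lambda>\<xi>. 0)"
  "P \<oplus>\<^bsub>adj_ops\<^esub> Q = (\<lambda>\<xi>. fst P \<xi> + fst Q \<xi>, \<lambda>\<xi>. snd P \<xi> + snd Q \<xi>)"
  "c \<odot>\<^bsub>adj_ops\<^esub> P = (\<lambda>\<xi>. fscale c (fst P \<xi>), \<lambda>\<xi>. fscale (cnj c) (snd P \<xi>))"
  "star adj_ops P = (snd P, fst P)"
  by (simp_all add: adj_ops_def)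

lemma adj_ops_carrier:
  "P \<in> carrier adj_ops \<longleftrightarrow>
    (\<forall>\<xi> \<eta>. ip (fst P \<xi>) \<eta> = ip \<xi> (snd P \<eta>)) \<and> l2_bounded (fst P) \<and> l2_bounded (snd P)"
  by (simp add: adj_ops_def)

text \<open>
  Linearity follows from the existence of an adjoint, since the inner product is non-degenerate.
\<close>

lemma adj_ops_linear:
  assumes "P \<in> carrier adj_ops"
  shows "fst P (\<xi> + \<eta>) = fst P \<xi> + fst P \<eta>" "fst P (fscale c \<xi>) = fscale c (fst P \<xi>)" "fst P 0 = 0"
    "snd P (\<xi> + \<eta>) = snd P \<xi> + snd P \<eta>" "snd P (fscale c \<xi>) = fscale c (snd P \<xi>)" "snd P 0 = 0"
proof -
  have adj: "ip (fst P \<xi>) \<eta> = ip \<xi> (snd P \<eta>)" for \<xi> \<eta> using assms by (simp add: adj_ops_carrier)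
  have adj': "ip (snd P \<xi>) \<eta> = ip \<xi> (fst P \<eta>)" for \<xi> \<eta> by (metis adj ip_cnj)
  have ip0: "ip 0 \<eta> = 0" for \<eta> :: "'a \<Rightarrow>\<^sub>0 complex" by (simp add: ip_def)
  show "fst P (\<xi> + \<eta>) = fst P \<xi> + fst P \<eta>" "fst P (fscale c \<xi>) = fscale c (fst P \<xi>)" "fst P 0 = 0"
    "snd P (\<xi> + \<eta>) = snd P \<xi> + snd P \<eta>" "snd P (fscale c \<xi>) = fscale c (snd P \<xi>)" "snd P 0 = 0"
    by (rule ip_ext, simp add: adj adj' ip_add_left ip_fscale_left ip0)+
qed

lemma l2_bounded_add:
  assumes "l2_bounded T" "l2_bounded T'"
  shows "l2_bounded (\<lambda>\<xi>. T \<xi> + T' \<xi>)"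
proof -
  obtain K K' where K: "K \<ge> 0" "\<And>\<xi>. l2 (T \<xi>) \<le> K * l2 \<xi>" "K' \<ge> 0" "\<And>\<xi>. l2 (T' \<xi>) \<le> K' * l2 \<xi>"
    using assms unfolding l2_bounded_def by blast
  have "l2 (T \<xi> + T' \<xi>) \<le> (K + K') * l2 \<xi>" for \<xi>
    using l2_add[of "T \<xi>" "T' \<xi>"] K(2)[of \<xi>] K(4)[of \<xi>] by (simp add: distrib_right)
  then show ?thesis unfolding l2_bounded_def using K by (intro exI[of _ "K + K'"]) auto
qed

lemma l2_bounded_comp:
  assumes "l2_bounded T" "l2_bounded T'"
  shows "l2_bounded (\<lambda>\<xi>. T (T' \<xi>))"
proof -
  obtain K K' where K: "K \<ge> 0" "\<And>\<xi>. l2 (T \<xi>) \<le> K * l2 \<xi>" "K' \<ge> 0" "\<And>\<xi>. l2 (T' \<xi>) \<le> K' * l2 \<xi>"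
    using assms unfolding l2_bounded_def by blast
  have "l2 (T (T' \<xi>)) \<le> (K * K') * l2 \<xi>" for \<xi>
    using K(2)[of "T' \<xi>"] mult_left_mono[OF K(4)[of \<xi>] K(1)] by (simp add: mult.assoc)
  then show ?thesis unfolding l2_bounded_def using K by (intro exI[of _ "K * K'"]) auto
qed

lemma l2_bounded_fscale:
  assumes "l2_bounded T"
  shows "l2_bounded (\<lambda>\<xi>. fscale c (T \<xi>))"
proof -
  obtain K where K: "K \<ge> 0" "\<And>\<xi>. l2 (T \<xi>) \<le> K * l2 \<xi>"
    using assms unfolding l2_bounded_def by blast
  have "l2 (fscale c (T \<xi>)) \<le> (cmod c * K) * l2 \<xi>" for \<xi>
    using mult_left_mono[OF K(2)[of \<xi>], of "cmod c"] by (simp add: l2_fscale mult.assoc)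
  then show ?thesis unfolding l2_bounded_def using K by (intro exI[of _ "cmod c * K"]) auto
qed

lemma l2_bounded_zero: "l2_bounded (\<lambda>\<xi>. 0)"
  unfolding l2_bounded_def by (auto simp: l2_def intro: exI[of _ 0])

lemma adj_ops_closed:
  assumes "P \<in> carrier adj_ops"
  shows adj_ops_star_closed: "star adj_ops P \<in> carrier adj_ops"
    and adj_ops_smult_closed: "c \<odot>\<^bsub>adj_ops\<^esub> P \<in> carrier adj_ops"
    and adj_ops_add_closed: "Q \<in> carrier adj_ops \<Longrightarrow> P \<oplus>\<^bsub>adj_ops\<^esub> Q \<in> carrier adj_ops"
    and adj_ops_mult_closed: "Q \<in> carrier adj_ops \<Longrightarrow> P \<otimes>\<^bsub>adj_ops\<^esub> Q \<in> carrier adj_ops"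
proof -
  have "ip (snd P \<xi>) \<eta> = ip \<xi> (fst P \<eta>)" for \<xi> \<eta>
    using assms by (metis adj_ops_carrier ip_cnj)
  then show "star adj_ops P \<in> carrier adj_ops"
    using assms by (simp add: adj_ops_carrier)
  show "c \<odot>\<^bsub>adj_ops\<^esub> P \<in> carrier adj_ops"
    using assms by (simp add: adj_ops_carrier ip_fscale_left ip_fscale_right l2_bounded_fscale)
  show "P \<oplus>\<^bsub>adj_ops\<^esub> Q \<in> carrier adj_ops" if "Q \<in> carrier adj_ops"
    using assms that by (simp add: adj_ops_carrier ip_add_left ip_add_right l2_bounded_add)
  show "P \<otimes>\<^bsub>adj_ops\<^esub> Q \<in> carrier adj_ops" if "Q \<in> carrier adj_ops"
    using assms that by (simp add: adj_ops_carrier l2_bounded_comp)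
qed

lemma fscale_distribs:
  "fscale c (\<xi> + \<eta>) = fscale c \<xi> + fscale c \<eta>" "fscale (c + d) \<xi> = fscale c \<xi> + fscale d \<xi>"
  "fscale (c * d) \<xi> = fscale c (fscale d \<xi>)" "fscale 1 \<xi> = \<xi>" "fscale c 0 = 0"
  by (rule poly_mapping_eqI, simp add: lookup_add algebra_simps)+

lemma abelian_group_adj_ops: "abelian_group (adj_ops :: ('x op \<times> 'x op) star_alg)"
proof (rule abelian_groupI)
  fix P :: "'x op \<times> 'x op" assume P: "P \<in> carrier adj_ops"
  have "(-1) \<odot>\<^bsub>adj_ops\<^esub> P \<oplus>\<^bsub>adj_ops\<^esub> P = \<zero>\<^bsub>adj_ops\<^esub>"
    by (auto intro!: poly_mapping_eqI simp: lookup_add)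
  then show "\<exists>Q\<in>carrier adj_ops. Q \<oplus>\<^bsub>adj_ops\<^esub> P = \<zero>\<^bsub>adj_ops\<^esub>" using adj_ops_smult_closed[OF P] by blast
next
  show "\<zero>\<^bsub>adj_ops\<^esub> \<in> carrier (adj_ops :: ('x op \<times> 'x op) star_alg)"
    by (simp add: adj_ops_carrier l2_bounded_zero) (simp add: ip_def)
next
  show "P \<oplus>\<^bsub>adj_ops\<^esub> Q \<in> carrier adj_ops"
    if "P \<in> carrier adj_ops" "Q \<in> carrier adj_ops" for P Q :: "'x op \<times> 'x op"
    by (rule adj_ops_add_closed[OF that])
qed (simp_all add: ac_simps)

lemma star_algebra_adj_ops: "star_algebra (adj_ops :: ('x op \<times> 'x op) star_alg)"
proof (rule star_algebra.intro[OF abelian_group_adj_ops], unfold_locales, goal_cases)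
  case 1 then show ?case by (rule adj_ops_smult_closed)
next
  case 6 then show ?case by (rule adj_ops_mult_closed)
next
  case 12 then show ?case by (rule adj_ops_star_closed)
qed (simp_all add: fscale_distribs adj_ops_linear)

definition opnorm :: "'x op \<times> 'x op \<Rightarrow> real" where
  "opnorm P = Inf {K. K \<ge> 0 \<and> (\<forall>\<xi>. l2 (fst P \<xi>) \<le> K * l2 \<xi>)}"

lemma opnorm_least:
  assumes "K \<ge> 0" "\<And>\<xi>. l2 (fst P \<xi>) \<le> K * l2 \<xi>"
  shows "opnorm P \<le> K"
  unfolding opnorm_def by (rule cInf_lower) (use assms in \<open>auto intro: bdd_belowI[of _ 0]\<close>)

lemma opnorm_bound:
  assumes "P \<in> carrier adj_ops"
  shows "l2 (fst P \<xi>) \<le> opnorm P * l2 \<xi>" "0 \<le> opnorm P"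
proof -
  obtain K where K: "K \<ge> 0" "\<And>\<xi>. l2 (fst P \<xi>) \<le> K * l2 \<xi>"
    using assms by (auto simp: adj_ops_carrier l2_bounded_def)
  then have ne: "{K. K \<ge> 0 \<and> (\<forall>\<xi>. l2 (fst P \<xi>) \<le> K * l2 \<xi>)} \<noteq> {}" by blast
  show "0 \<le> opnorm P" unfolding opnorm_def by (rule cInf_greatest[OF ne]) auto
  show "l2 (fst P \<xi>) \<le> opnorm P * l2 \<xi>"
  proof (cases "l2 \<xi> = 0")
    case True
    then show ?thesis using K(2)[of \<xi>] by simp
  next
    case False
    then have pos: "l2 \<xi> > 0" using l2_nonneg[of \<xi>] by linarith
    have "l2 (fst P \<xi>) / l2 \<xi> \<le> opnorm P"
      unfolding opnorm_def by (rule cInf_greatest[OF ne]) (use pos in \<open>auto simp: field_simps\<close>)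
    then show ?thesis using pos by (simp add: field_simps)
  qed
qed

lemma opnorm_mult:
  assumes "P \<in> carrier adj_ops" "Q \<in> carrier adj_ops"
  shows "opnorm (P \<otimes>\<^bsub>adj_ops\<^esub> Q) \<le> opnorm P * opnorm Q"
proof (rule opnorm_least)
  fix \<xi>
  have "fst (P \<otimes>\<^bsub>adj_ops\<^esub> Q) \<xi> = fst P (fst Q \<xi>)" by simp
  then show "l2 (fst (P \<otimes>\<^bsub>adj_ops\<^esub> Q) \<xi>) \<le> opnorm P * opnorm Q * l2 \<xi>"
    using opnorm_bound(1)[OF assms(1), of "fst Q \<xi>"]
      mult_left_mono[OF opnorm_bound(1)[OF assms(2), of \<xi>] opnorm_bound(2)[OF assms(1)]]
    by (simp add: mult.assoc)
qed (simp add: opnorm_bound(2)[OF assms(1)] opnorm_bound(2)[OF assms(2)])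

lemma opnorm_add:
  assumes "P \<in> carrier adj_ops" "Q \<in> carrier adj_ops"
  shows "opnorm (P \<oplus>\<^bsub>adj_ops\<^esub> Q) \<le> opnorm P + opnorm Q"
proof (rule opnorm_least)
  fix \<xi>
  have "fst (P \<oplus>\<^bsub>adj_ops\<^esub> Q) \<xi> = fst P \<xi> + fst Q \<xi>" by simp
  then show "l2 (fst (P \<oplus>\<^bsub>adj_ops\<^esub> Q) \<xi>) \<le> (opnorm P + opnorm Q) * l2 \<xi>"
    using l2_add[of "fst P \<xi>" "fst Q \<xi>"] opnorm_bound(1)[OF assms(1), of \<xi>] opnorm_bound(1)[OF assms(2), of \<xi>]
    by (simp add: distrib_right)
qed (simp add: opnorm_bound(2)[OF assms(1)] opnorm_bound(2)[OF assms(2)])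

lemma opnorm_smult:
  fixes P :: "'x op \<times> 'x op"
  assumes P: "P \<in> carrier adj_ops"
  shows "opnorm (c \<odot>\<^bsub>adj_ops\<^esub> P) = cmod c * opnorm P"
proof -
  interpret star_algebra "adj_ops :: ('x op \<times> 'x op) star_alg" by (rule star_algebra_adj_ops)
  have le: "opnorm (c \<odot>\<^bsub>adj_ops\<^esub> P) \<le> cmod c * opnorm P" if P: "P \<in> carrier adj_ops" for c and P :: "'x op \<times> 'x op"
  proof (rule opnorm_least)
    fix \<xi>
    have "fst (c \<odot>\<^bsub>adj_ops\<^esub> P) \<xi> = fscale c (fst P \<xi>)" by simp
    then show "l2 (fst (c \<odot>\<^bsub>adj_ops\<^esub> P) \<xi>) \<le> cmod c * opnorm P * l2 \<xi>"
      using mult_left_mono[OF opnorm_bound(1)[OF P, of \<xi>], of "cmod c"] by (simp add: l2_fscale mult.assoc)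
  qed (simp add: opnorm_bound(2)[OF P])
  show ?thesis
  proof (cases "c = 0")
    case True
    then show ?thesis using le[OF P, of c] opnorm_bound(2)[OF smult_closed[OF P, of c]] by simp
  next
    case False
    have "opnorm (inverse c \<odot>\<^bsub>adj_ops\<^esub> (c \<odot>\<^bsub>adj_ops\<^esub> P)) \<le> cmod (inverse c) * opnorm (c \<odot>\<^bsub>adj_ops\<^esub> P)"
      by (rule le[OF smult_closed[OF P]])
    then have "cmod c * opnorm P \<le> opnorm (c \<odot>\<^bsub>adj_ops\<^esub> P)"
      using False P by (simp add: smult_assoc[symmetric] smult_one norm_divide field_simps del: adj_ops_simps)
    then show ?thesis using le[OF P, of c] by simp
  qed
qed

text \<open>
  Both inequalities come from the Cauchy--Schwarz inequality: applied to
  \<open>\<langle>T S \<eta>, \<eta>\<rangle> = \<parallel>S \<eta>\<parallel>\<^sup>2\<close> it bounds the adjoint \<open>S\<close> by the norm of \<open>T\<close>, and applied to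
  \<open>\<langle>\<xi>, S T \<xi>\<rangle> = \<parallel>T \<xi>\<parallel>\<^sup>2\<close> it bounds \<open>T\<close> by the square root of the norm of \<open>S T\<close>.
\<close>

lemma opnorm_star:
  assumes P: "P \<in> carrier adj_ops"
  shows "opnorm (star adj_ops P \<otimes>\<^bsub>adj_ops\<^esub> P) = (opnorm P)\<^sup>2"
proof -
  let ?T = "fst P" and ?S = "snd P"
  have adj: "ip (?T \<xi>) \<eta> = ip \<xi> (?S \<eta>)" for \<xi> \<eta> using P by (simp add: adj_ops_carrier)
  have Q: "star adj_ops P \<in> carrier adj_ops" using P by (rule adj_ops_star_closed)
  have QP: "star adj_ops P \<otimes>\<^bsub>adj_ops\<^esub> P \<in> carrier adj_ops" by (rule adj_ops_mult_closed[OF Q P])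
  have "opnorm (star adj_ops P) \<le> opnorm P"
  proof (rule opnorm_least[OF opnorm_bound(2)[OF P]])
    fix \<eta>
    have "(l2 (?S \<eta>))\<^sup>2 = cmod (ip (?T (?S \<eta>)) \<eta>)" by (simp add: adj ip_self norm_power)
    also have "\<dots> \<le> l2 (?T (?S \<eta>)) * l2 \<eta>" by (rule ip_Cauchy_Schwarz)
    also have "\<dots> \<le> opnorm P * l2 (?S \<eta>) * l2 \<eta>"
      using opnorm_bound(1)[OF P, of "snd P \<eta>"] by (intro mult_right_mono) auto
    finally have "l2 (?S \<eta>) * l2 (?S \<eta>) \<le> (opnorm P * l2 \<eta>) * l2 (?S \<eta>)" by (simp add: power2_eq_square mult_ac)
    then have "l2 (?S \<eta>) \<le> opnorm P * l2 \<eta>"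
      using opnorm_bound(2)[OF P] mult_right_le_imp_le[of "l2 (snd P \<eta>)" "l2 (snd P \<eta>)" "opnorm P * l2 \<eta>"]
        less_eq_real_def[of 0 "l2 (snd P \<eta>)"] by auto
    then show "l2 (fst (star adj_ops P) \<eta>) \<le> opnorm P * l2 \<eta>" by simp
  qed
  then have "opnorm (star adj_ops P) * opnorm P \<le> opnorm P * opnorm P"
    using opnorm_bound(2)[OF P] by (rule mult_right_mono)
  then have "opnorm (star adj_ops P \<otimes>\<^bsub>adj_ops\<^esub> P) \<le> (opnorm P)\<^sup>2"
    using opnorm_mult[OF Q P] by (simp add: power2_eq_square)
  moreover have "opnorm P \<le> sqrt (opnorm (star adj_ops P \<otimes>\<^bsub>adj_ops\<^esub> P))"
  proof (rule opnorm_least)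
    fix \<xi>
    have "(l2 (?T \<xi>))\<^sup>2 = cmod (ip \<xi> (?S (?T \<xi>)))" by (simp add: adj[symmetric] ip_self norm_power)
    also have "\<dots> \<le> l2 \<xi> * l2 (?S (?T \<xi>))" by (rule ip_Cauchy_Schwarz)
    also have "\<dots> \<le> l2 \<xi> * (opnorm (star adj_ops P \<otimes>\<^bsub>adj_ops\<^esub> P) * l2 \<xi>)"
      using opnorm_bound(1)[OF QP, of \<xi>] by (intro mult_left_mono) auto
    also have "\<dots> = (sqrt (opnorm (star adj_ops P \<otimes>\<^bsub>adj_ops\<^esub> P)) * l2 \<xi>)\<^sup>2"
      using opnorm_bound(2)[OF QP] by (simp add: power_mult_distrib power2_eq_square[of "l2 \<xi>"])
    finally show "l2 (fst P \<xi>) \<le> sqrt (opnorm (star adj_ops P \<otimes>\<^bsub>adj_ops\<^esub> P)) * l2 \<xi>"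
      by (rule power2_le_imp_le) (simp add: opnorm_bound(2)[OF QP] del: adj_ops_simps)
  qed (use opnorm_bound(2)[OF QP] in auto)
  then have "(opnorm P)\<^sup>2 \<le> opnorm (star adj_ops P \<otimes>\<^bsub>adj_ops\<^esub> P)"
    using opnorm_bound(2)[OF QP] opnorm_bound(2)[OF P] by (metis power_mono real_sqrt_pow2)
  ultimately show ?thesis by simp
qed

lemma cstar_seminorm_adj_ops: "cstar_seminorm (adj_ops :: ('x op \<times> 'x op) star_alg) opnorm"
  by (rule cstar_seminorm.intro[OF star_algebra_adj_ops], unfold_locales)
    (simp_all add: opnorm_bound(2) opnorm_add opnorm_mult opnorm_smult opnorm_star del: adj_ops_simps)

lemma finsum_adj_ops:
  assumes "finite F" "f \<in> F \<rightarrow> carrier (adj_ops :: ('x op \<times> 'x op) star_alg)"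
  shows "finsum adj_ops f F = (\<lambda>\<xi>. \<Sum>i\<in>F. fst (f i) \<xi>, \<lambda>\<xi>. \<Sum>i\<in>F. snd (f i) \<xi>)"
proof -
  interpret star_algebra "adj_ops :: ('x op \<times> 'x op) star_alg" by (rule star_algebra_adj_ops)
  show ?thesis using assms
  proof (induction F rule: finite_induct)
    case (insert i F)
    then have "finsum adj_ops f (insert i F) = f i \<oplus>\<^bsub>adj_ops\<^esub> finsum adj_ops f F" by (intro finsum_insert) auto
    then show ?case using insert by (simp add: Pi_iff)
  qed simp
qed


section \<open>Operators induced by partial bijections\<close>

definition mutually_inverse :: "('x \<rightharpoonup> 'y) \<Rightarrow> ('y \<rightharpoonup> 'x) \<Rightarrow> bool" where
  "mutually_inverse \<theta> \<theta>' \<longleftrightarrow> (\<forall>x y. \<theta> x = Some y \<longleftrightarrow> \<theta>' y = Some x)"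

text \<open>
  Composition with a partial map, extended by zero. For a partial injection \<open>\<theta>\<close> with inverse \<open>\<theta>'\<close> this
  moves the basis vector at \<open>x\<close> to the one at \<open>\<theta>' x\<close>, so the assignment reverses the order of
  composition. Finiteness of the support of the result rests on injectivity.
\<close>

definition pull :: "('x \<rightharpoonup> 'x) \<Rightarrow> 'x op" where
  "pull \<theta> \<xi> = Poly_Mapping.Abs_poly_mapping
     (\<lambda>y. case \<theta> y of None \<Rightarrow> 0 | Some x \<Rightarrow> Poly_Mapping.lookup \<xi> x)"

lemma mutually_inverse_sym: "mutually_inverse \<theta> \<theta>' \<Longrightarrow> mutually_inverse \<theta>' \<theta>"
  by (auto simp: mutually_inverse_def)

lemma mutually_inverse_comp:
  "\<lbrakk>mutually_inverse a a'; mutually_inverse b b'\<rbrakk> \<Longrightarrow> mutually_inverse (b \<circ>\<^sub>m a) (a' \<circ>\<^sub>m b')"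
  unfolding mutually_inverse_def by (auto simp: map_comp_Some_iff)

context
  fixes \<theta> \<theta>' :: "'x \<rightharpoonup> 'x"
  assumes inv: "mutually_inverse \<theta> \<theta>'"
begin

lemma lookup_pull:
  "Poly_Mapping.lookup (pull \<theta> \<xi>) y = (case \<theta> y of None \<Rightarrow> 0 | Some x \<Rightarrow> Poly_Mapping.lookup \<xi> x)"
proof -
  have "{y. (case \<theta> y of None \<Rightarrow> 0 | Some x \<Rightarrow> Poly_Mapping.lookup \<xi> x) \<noteq> 0}
      \<subseteq> (\<lambda>x. the (\<theta>' x)) ` Poly_Mapping.keys \<xi>"
    using inv by (force simp: mutually_inverse_def in_keys_iff image_iff split: option.splits)
  then have "finite {y. (case \<theta> y of None \<Rightarrow> 0 | Some x \<Rightarrow> Poly_Mapping.lookup \<xi> x) \<noteq> 0}"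
    by (rule finite_subset) simp
  then show ?thesis by (simp add: pull_def Abs_poly_mapping_inverse)
qed

lemma keys_pull: "Poly_Mapping.keys (pull \<theta> \<xi>) = {y. \<exists>x\<in>Poly_Mapping.keys \<xi>. \<theta> y = Some x}"
  by (auto simp: in_keys_iff lookup_pull split: option.splits)

lemma pull_zero: "pull \<theta> 0 = 0"
  by (rule poly_mapping_eqI) (simp add: lookup_pull split: option.splits)

lemma pull_single:
  "pull \<theta> (Poly_Mapping.single x c) = (case \<theta>' x of None \<Rightarrow> 0 | Some y \<Rightarrow> Poly_Mapping.single y c)"
proof (rule poly_mapping_eqI)
  fix y
  have iff: "\<theta> y = Some x \<longleftrightarrow> \<theta>' x = Some y" using inv by (simp add: mutually_inverse_def)
  show "Poly_Mapping.lookup (pull \<theta> (Poly_Mapping.single x c)) y =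
      Poly_Mapping.lookup (case \<theta>' x of None \<Rightarrow> 0 | Some y \<Rightarrow> Poly_Mapping.single y c) y"
  proof (cases "\<theta>' x = Some y")
    case True
    then show ?thesis using iff by (simp add: lookup_pull)
  next
    case False
    then have "\<theta> y \<noteq> Some x" using iff by simp
    then show ?thesis using False by (auto simp: lookup_pull lookup_single when_def split: option.splits)
  qed
qed

lemma sum_keys_pull:
  fixes g :: "'x \<Rightarrow> complex \<Rightarrow> 'b :: comm_monoid_add"
  shows "(\<Sum>y\<in>Poly_Mapping.keys (pull \<theta> \<xi>). g y (Poly_Mapping.lookup (pull \<theta> \<xi>) y)) =
    (\<Sum>x\<in>{x \<in> Poly_Mapping.keys \<xi>. \<theta>' x \<noteq> None}. g (the (\<theta>' x)) (Poly_Mapping.lookup \<xi> x))"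
proof -
  have pre: "\<theta>' (the (\<theta> y)) = Some y \<and> \<theta> y = Some (the (\<theta> y)) \<and> the (\<theta> y) \<in> Poly_Mapping.keys \<xi>"
    if y: "y \<in> Poly_Mapping.keys (pull \<theta> \<xi>)" for y
  proof -
    obtain x where x: "x \<in> Poly_Mapping.keys \<xi>" "\<theta> y = Some x" using y by (auto simp: keys_pull)
    then have "\<theta>' x = Some y" using inv by (simp add: mutually_inverse_def)
    then show ?thesis using x by simp
  qed
  have img: "the (\<theta>' x) \<in> Poly_Mapping.keys (pull \<theta> \<xi>) \<and> the (\<theta> (the (\<theta>' x))) = x"
    if x: "x \<in> Poly_Mapping.keys \<xi>" "\<theta>' x \<noteq> None" for x
  proof -
    obtain y where y: "\<theta>' x = Some y" using x by auto
    then have "\<theta> y = Some x" using inv by (simp add: mutually_inverse_def)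
    then show ?thesis using x y by (auto simp: keys_pull)
  qed
  show ?thesis
  proof (rule sum.reindex_bij_witness[where i = "\<lambda>x. the (\<theta>' x)" and j = "\<lambda>y. the (\<theta> y)"])
    fix y assume y: "y \<in> Poly_Mapping.keys (pull \<theta> \<xi>)"
    show "the (\<theta>' (the (\<theta> y))) = y" using pre[OF y] by simp
    show "the (\<theta> y) \<in> {x \<in> Poly_Mapping.keys \<xi>. \<theta>' x \<noteq> None}" using pre[OF y] by simp
    have "Poly_Mapping.lookup (pull \<theta> \<xi>) y = Poly_Mapping.lookup \<xi> (the (\<theta> y))"
      using pre[OF y] by (cases "\<theta> y") (auto simp: lookup_pull)
    then show "g (the (\<theta>' (the (\<theta> y)))) (Poly_Mapping.lookup \<xi> (the (\<theta> y))) =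
        g y (Poly_Mapping.lookup (pull \<theta> \<xi>) y)"
      using pre[OF y] by simp
  qed (use img in auto)
qed

lemma ip_pull: "ip (pull \<theta> \<xi>) \<eta> =
    (\<Sum>x\<in>{x \<in> Poly_Mapping.keys \<xi>. \<theta>' x \<noteq> None}. Poly_Mapping.lookup \<xi> x * cnj (Poly_Mapping.lookup \<eta> (the (\<theta>' x))))"
  unfolding ip_def by (rule sum_keys_pull[of "\<lambda>y c. c * cnj (Poly_Mapping.lookup \<eta> y)"])

lemma l2_pull: "l2 (pull \<theta> \<xi>) \<le> l2 \<xi>"
proof -
  have "(\<Sum>y\<in>Poly_Mapping.keys (pull \<theta> \<xi>). (cmod (Poly_Mapping.lookup (pull \<theta> \<xi>) y))\<^sup>2) =
      (\<Sum>x\<in>{x \<in> Poly_Mapping.keys \<xi>. \<theta>' x \<noteq> None}. (cmod (Poly_Mapping.lookup \<xi> x))\<^sup>2)"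
    by (rule sum_keys_pull)
  also have "\<dots> \<le> (\<Sum>x\<in>Poly_Mapping.keys \<xi>. (cmod (Poly_Mapping.lookup \<xi> x))\<^sup>2)"
    by (rule sum_mono2) auto
  finally show ?thesis by (simp add: l2_def L2_set_def)
qed

end

definition partial_bij_op :: "('x \<rightharpoonup> 'x) \<Rightarrow> ('x \<rightharpoonup> 'x) \<Rightarrow> 'x op \<times> 'x op" where
  "partial_bij_op \<theta> \<theta>' = (pull \<theta>, pull \<theta>')"

text \<open>
  Both sides are sums over the pairs matched by the partial bijection.
\<close>

lemma ip_pull_adjoint:
  assumes inv: "mutually_inverse \<theta> \<theta>'"
  shows "ip (pull \<theta> \<xi>) \<eta> = ip \<xi> (pull \<theta>' \<eta>)"
proof -
  have "ip \<xi> (pull \<theta>' \<eta>) = (\<Sum>x\<in>{x \<in> Poly_Mapping.keys \<xi>. \<theta>' x \<noteq> None}.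
      Poly_Mapping.lookup \<xi> x * cnj (Poly_Mapping.lookup \<eta> (the (\<theta>' x))))"
    unfolding ip_def
    by (rule sum.mono_neutral_cong_right)
      (auto simp: lookup_pull[OF mutually_inverse_sym[OF inv]])
  then show ?thesis by (simp add: ip_pull[OF inv])
qed

lemma partial_bij_op_closed:
  assumes "mutually_inverse \<theta> \<theta>'"
  shows "partial_bij_op \<theta> \<theta>' \<in> carrier adj_ops"
proof -
  have "l2_bounded (pull \<theta>)" if "mutually_inverse \<theta> \<theta>'" for \<theta> \<theta>' :: "'a \<rightharpoonup> 'a"
    unfolding l2_bounded_def using l2_pull[OF that] by (intro exI[of _ 1]) auto
  then show ?thesis
    using assms mutually_inverse_sym[OF assms] ip_pull_adjoint[OF assms]
    by (simp add: adj_ops_carrier partial_bij_op_def)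
qed

lemma pull_comp:
  assumes "mutually_inverse a a'" "mutually_inverse b b'"
  shows "pull a (pull b \<xi>) = pull (b \<circ>\<^sub>m a) \<xi>"
proof (rule poly_mapping_eqI)
  show "Poly_Mapping.lookup (pull a (pull b \<xi>)) y = Poly_Mapping.lookup (pull (b \<circ>\<^sub>m a) \<xi>) y" for y
    unfolding lookup_pull[OF assms(1)] lookup_pull[OF assms(2)] lookup_pull[OF mutually_inverse_comp[OF assms]]
    by (simp add: map_comp_def split: option.splits)
qed

lemma partial_bij_op_mult:
  assumes "mutually_inverse a a'" "mutually_inverse b b'"
  shows "partial_bij_op a a' \<otimes>\<^bsub>adj_ops\<^esub> partial_bij_op b b' = partial_bij_op (b \<circ>\<^sub>m a) (a' \<circ>\<^sub>m b')"
  using assms mutually_inverse_sym[OF assms(1)] mutually_inverse_sym[OF assms(2)]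
  by (auto simp: partial_bij_op_def pull_comp)

lemma partial_bij_op_star: "star adj_ops (partial_bij_op a a') = partial_bij_op a' a"
  by (simp add: partial_bij_op_def)

lemma partial_bij_op_empty: "partial_bij_op Map.empty Map.empty = \<zero>\<^bsub>adj_ops\<^esub>"
  by (auto simp: partial_bij_op_def mutually_inverse_def intro!: ext poly_mapping_eqI lookup_pull[THEN trans])


section \<open>Representations on branching systems\<close>

text \<open>
  A set of path-like objects on which the edges act by prepending. The axioms mirror the
  Cuntz--Krieger relations: a first edge is guaranteed over those vertices at which the
  Cuntz--Krieger sum is imposed. So finite paths that stop at any other vertex are admitted.
\<close>

locale branching_system =
  fixes E :: "('v, 'e) pre_digraph" and X :: "'x set" and rg :: "'x \<Rightarrow> 'v" and \<sigma> :: "'e \<Rightarrow> 'x \<Rightarrow> 'x"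
  assumes wf: "wf_digraph E"
    and prepend_closed: "\<lbrakk>e \<in> arcs E; x \<in> X; rg x = tail E e\<rbrakk> \<Longrightarrow> \<sigma> e x \<in> X"
    and prepend_range: "\<lbrakk>e \<in> arcs E; x \<in> X; rg x = tail E e\<rbrakk> \<Longrightarrow> rg (\<sigma> e x) = head E e"
    and prepend_inj: "\<sigma> e x = \<sigma> f y \<Longrightarrow> e = f \<and> x = y"
    and prepend_surj: "\<lbrakk>x \<in> X; finite {e \<in> arcs E. head E e = rg x}; {e \<in> arcs E. head E e = rg x} \<noteq> {}\<rbrakk> \<Longrightarrow>
        \<exists>e\<in>arcs E. \<exists>y\<in>X. rg y = tail E e \<and> x = \<sigma> e y"
begin

definition cyl :: "'v \<Rightarrow> 'x \<rightharpoonup> 'x" where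
  "cyl v x = (if x \<in> X \<and> rg x = v then Some x else None)"

definition fwd :: "'e \<Rightarrow> 'x \<rightharpoonup> 'x" where
  "fwd e x = (if x \<in> X \<and> rg x = tail E e then Some (\<sigma> e x) else None)"

definition bwd :: "'e \<Rightarrow> 'x \<rightharpoonup> 'x" where
  "bwd e y = (if \<exists>x. fwd e x = Some y then Some (THE x. fwd e x = Some y) else None)"

definition rep_proj :: "'v \<Rightarrow> 'x op \<times> 'x op" where
  "rep_proj v = partial_bij_op (cyl v) (cyl v)"

definition rep_isom :: "'e \<Rightarrow> 'x op \<times> 'x op" where
  "rep_isom e = partial_bij_op (bwd e) (fwd e)"

lemma fwd_inj: "\<lbrakk>fwd e x = Some z; fwd f y = Some z\<rbrakk> \<Longrightarrow> e = f \<and> x = y"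
  by (auto simp: fwd_def dest: prepend_inj split: if_splits)

lemma inv_cyl: "mutually_inverse (cyl v) (cyl v)"
  by (auto simp: mutually_inverse_def cyl_def)

lemma bwd_Some_iff: "bwd e y = Some x \<longleftrightarrow> fwd e x = Some y"
proof -
  have "(THE x. fwd e x = Some y) = x" if "fwd e x = Some y" for x
    using that fwd_inj by blast
  then show ?thesis by (auto simp: bwd_def)
qed

lemma inv_bwd: "mutually_inverse (bwd e) (fwd e)"
  by (auto simp: mutually_inverse_def bwd_Some_iff)

lemma bwd_fwd: "(bwd e \<circ>\<^sub>m fwd e) = cyl (tail E e)"
proof
  fix x
  have "bwd e (\<sigma> e x) = Some x" if "x \<in> X" "rg x = tail E e"
    using that by (simp add: bwd_Some_iff fwd_def)
  then show "(bwd e \<circ>\<^sub>m fwd e) x = cyl (tail E e) x" by (simp add: map_comp_def cyl_def fwd_def)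
qed

lemma fwd_bwd: "(fwd e \<circ>\<^sub>m bwd e) y = (if \<exists>x. fwd e x = Some y then Some y else None)"
proof (cases "bwd e y")
  case None
  then have "\<nexists>x. fwd e x = Some y" by (metis bwd_Some_iff option.distinct(1))
  then show ?thesis using None by simp
next
  case (Some x)
  then have "fwd e x = Some y" by (simp add: bwd_Some_iff)
  then show ?thesis using Some by auto
qed

lemma inv_fwd_bwd: "mutually_inverse (fwd e \<circ>\<^sub>m bwd e) (fwd e \<circ>\<^sub>m bwd e)"
  by (rule mutually_inverse_comp[OF inv_bwd mutually_inverse_sym[OF inv_bwd]])

lemma rep_range_proj: "rep_isom e \<otimes>\<^bsub>adj_ops\<^esub> star adj_ops (rep_isom e) =
    partial_bij_op (fwd e \<circ>\<^sub>m bwd e) (fwd e \<circ>\<^sub>m bwd e)"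
  unfolding rep_isom_def partial_bij_op_star
  by (rule partial_bij_op_mult[OF inv_bwd mutually_inverse_sym[OF inv_bwd]])

text \<open>
  Every relation except the Cuntz--Krieger sum is an identity between compositions of partial maps.
  The sum says that each point over a vertex at which it is imposed lies in the range of exactly one
  edge: at least one by \<open>prepend_surj\<close>, at most one by \<open>prepend_inj\<close>.
\<close>

lemma ck_family_rep: "ck_family E adj_ops rep_proj rep_isom"
proof -
  have pc: "rep_proj v \<in> carrier adj_ops" for v
    unfolding rep_proj_def by (rule partial_bij_op_closed[OF inv_cyl])
  have sc: "rep_isom e \<in> carrier adj_ops" for e
    unfolding rep_isom_def by (rule partial_bij_op_closed[OF inv_bwd])
  have fwd_head: "z \<in> X \<and> rg z = head E e" if "e \<in> arcs E" "fwd e x = Some z" for e x z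
    using that prepend_closed prepend_range by (auto simp: fwd_def split: if_splits)
  have disjoint: "((fwd f \<circ>\<^sub>m bwd f) \<circ>\<^sub>m (fwd e \<circ>\<^sub>m bwd e)) y = None" if "e \<noteq> f" for e f y
  proof -
    have "\<not> ((\<exists>x. fwd e x = Some y) \<and> (\<exists>x. fwd f x = Some y))" using fwd_inj that by blast
    then show ?thesis by (auto simp: map_comp_def[of "fwd f \<circ>\<^sub>m bwd f"] fwd_bwd)
  qed
  have "a = b" if "(a, b) \<in> ck_equations E adj_ops rep_proj rep_isom" for a b
    using that
  proof cases
    case (proj_adjoint v)
    then show ?thesis by (simp only: rep_proj_def partial_bij_op_star)
  next
    case (proj_idem v)
    have "cyl v \<circ>\<^sub>m cyl v = cyl v" by (auto simp: cyl_def map_comp_def)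
    then show ?thesis using proj_idem by (simp only: rep_proj_def partial_bij_op_mult[OF inv_cyl inv_cyl])
  next
    case (proj_orth v w)
    have "cyl w \<circ>\<^sub>m cyl v = Map.empty" "cyl v \<circ>\<^sub>m cyl w = Map.empty"
      using proj_orth by (auto simp: cyl_def map_comp_def)
    then show ?thesis using proj_orth
      by (simp only: rep_proj_def partial_bij_op_mult[OF inv_cyl inv_cyl] partial_bij_op_empty)
  next
    case (partial_isom e)
    have "bwd e \<circ>\<^sub>m (fwd e \<circ>\<^sub>m bwd e) = bwd e"
    proof
      show "(bwd e \<circ>\<^sub>m (fwd e \<circ>\<^sub>m bwd e)) y = bwd e y" for y
        by (cases "bwd e y") (auto simp: map_comp_def bwd_Some_iff split: option.splits)
    qed
    moreover have "(fwd e \<circ>\<^sub>m bwd e) \<circ>\<^sub>m fwd e = fwd e"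
    proof
      show "((fwd e \<circ>\<^sub>m bwd e) \<circ>\<^sub>m fwd e) x = fwd e x" for x
        by (cases "fwd e x") (auto simp: map_comp_def bwd_Some_iff[symmetric] split: option.splits)
    qed
    ultimately show ?thesis using partial_isom
      by (simp only: rep_range_proj) (simp only: rep_isom_def partial_bij_op_mult[OF inv_fwd_bwd inv_bwd])
  next
    case (range_orth e f)
    have "(fwd f \<circ>\<^sub>m bwd f) \<circ>\<^sub>m (fwd e \<circ>\<^sub>m bwd e) = Map.empty" "(fwd e \<circ>\<^sub>m bwd e) \<circ>\<^sub>m (fwd f \<circ>\<^sub>m bwd f) = Map.empty"
      using disjoint[OF range_orth(5)] disjoint[OF range_orth(5)[symmetric]] by (auto simp: fun_eq_iff)
    then show ?thesis using range_orth
      by (simp only: rep_range_proj partial_bij_op_mult[OF inv_fwd_bwd inv_fwd_bwd] partial_bij_op_empty)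
  next
    case (source_proj e)
    have "star adj_ops (rep_isom e) \<otimes>\<^bsub>adj_ops\<^esub> rep_isom e = rep_proj (tail E e)"
      unfolding rep_isom_def partial_bij_op_star rep_proj_def
      by (simp only: partial_bij_op_mult[OF mutually_inverse_sym[OF inv_bwd] inv_bwd] bwd_fwd)
    then show ?thesis using source_proj by simp
  next
    case (range_proj e)
    have mem: "y \<in> X \<and> rg y = head E e" if "\<exists>x. fwd e x = Some y" for y
      using fwd_head[OF range_proj(3)] that by blast
    have "((fwd e \<circ>\<^sub>m bwd e) \<circ>\<^sub>m cyl (head E e)) y = (fwd e \<circ>\<^sub>m bwd e) y" for y
      using mem[of y] by (auto simp: map_comp_def[of "fwd e \<circ>\<^sub>m bwd e"] fwd_bwd cyl_def)
    moreover have "(cyl (head E e) \<circ>\<^sub>m (fwd e \<circ>\<^sub>m bwd e)) y = (fwd e \<circ>\<^sub>m bwd e) y" for y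
      using mem[of y] by (auto simp: map_comp_def[of "cyl (head E e)"] fwd_bwd cyl_def)
    ultimately have "(fwd e \<circ>\<^sub>m bwd e) \<circ>\<^sub>m cyl (head E e) = fwd e \<circ>\<^sub>m bwd e"
        "cyl (head E e) \<circ>\<^sub>m (fwd e \<circ>\<^sub>m bwd e) = fwd e \<circ>\<^sub>m bwd e"
      by blast+
    then show ?thesis using range_proj
      by (simp only: rep_range_proj) (simp only: rep_proj_def partial_bij_op_mult[OF inv_cyl inv_fwd_bwd])
  next
    case (ck_sum v)
    let ?R = "{e \<in> arcs E. head E e = v}"
    have R: "finite ?R" "?R \<noteq> {}" using ck_sum by (auto simp: fun_eq_iff)
    have "pull (cyl v) \<xi> = (\<Sum>e\<in>?R. pull (fwd e \<circ>\<^sub>m bwd e) \<xi>)" for \<xi> :: "'x \<Rightarrow>\<^sub>0 complex"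
    proof (rule poly_mapping_eqI)
      fix y
      have "Poly_Mapping.lookup (\<Sum>e\<in>?R. pull (fwd e \<circ>\<^sub>m bwd e) \<xi>) y =
          (\<Sum>e\<in>?R. if \<exists>x. fwd e x = Some y then Poly_Mapping.lookup \<xi> y else 0)"
        by (auto simp: lookup_sum lookup_pull[OF inv_fwd_bwd] fwd_bwd intro!: sum.cong)
      also have "\<dots> = Poly_Mapping.lookup (pull (cyl v) \<xi>) y"
      proof (cases "y \<in> X \<and> rg y = v")
        case True
        then obtain e x where e: "e \<in> arcs E" "x \<in> X" "rg x = tail E e" "y = \<sigma> e x"
          using prepend_surj[of y] R by auto
        then have ey: "fwd e x = Some y" by (simp add: fwd_def)
        have "e \<in> ?R" using fwd_head[OF e(1) ey] e(1) True by simp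
        moreover have "(\<exists>x. fwd f x = Some y) \<longleftrightarrow> f = e" for f using ey fwd_inj by blast
        ultimately show ?thesis using R True by (simp add: lookup_pull[OF inv_cyl] cyl_def)
      next
        case False
        then have "\<nexists>x. fwd e x = Some y" if "e \<in> ?R" for e using that fwd_head by blast
        then show ?thesis using False by (auto simp: lookup_pull[OF inv_cyl] cyl_def)
      qed
      finally show "Poly_Mapping.lookup (pull (cyl v) \<xi>) y =
          Poly_Mapping.lookup (\<Sum>e\<in>?R. pull (fwd e \<circ>\<^sub>m bwd e) \<xi>) y" by simp
    qed
    moreover have rc: "(\<lambda>e. partial_bij_op (fwd e \<circ>\<^sub>m bwd e) (fwd e \<circ>\<^sub>m bwd e)) \<in> ?R \<rightarrow> carrier adj_ops"
      by (simp add: partial_bij_op_closed[OF inv_fwd_bwd])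
    then have "finsum adj_ops (\<lambda>e. partial_bij_op (fwd e \<circ>\<^sub>m bwd e) (fwd e \<circ>\<^sub>m bwd e)) ?R =
       (\<lambda>\<xi>. \<Sum>e\<in>?R. pull (fwd e \<circ>\<^sub>m bwd e) \<xi>, \<lambda>\<xi>. \<Sum>e\<in>?R. pull (fwd e \<circ>\<^sub>m bwd e) \<xi>)"
      unfolding finsum_adj_ops[OF R(1) rc] by (simp add: partial_bij_op_def)
    ultimately show ?thesis using ck_sum
      by (simp only: rep_range_proj) (simp add: rep_proj_def partial_bij_op_def fun_eq_iff)
  qed
  then show ?thesis using pc sc by (auto simp: ck_family_def)
qed

definition rep :: "(('v, 'e) ck_gen star_word \<Rightarrow>\<^sub>0 complex) \<Rightarrow> 'x op \<times> 'x op" where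
  "rep = lin_ev adj_ops (case_ck_gen rep_proj rep_isom)"

lemma rep_gen: "case_ck_gen rep_proj rep_isom \<in> (Proj_Gen ` verts E \<union> Isom_Gen ` arcs E) \<rightarrow> carrier adj_ops"
  using ck_family_rep by (auto simp: ck_family_def)

lemma rep_hom: "rep \<in> star_hom (ck_free_algebra E) adj_ops"
  unfolding rep_def ck_free_algebra_def by (rule star_algebra.lin_ev_hom[OF star_algebra_adj_ops rep_gen])

lemma rep_free_proj: "v \<in> verts E \<Longrightarrow> rep (free_gen (Proj_Gen v)) = rep_proj v"
  and rep_free_isom: "e \<in> arcs E \<Longrightarrow> rep (free_gen (Isom_Gen e)) = rep_isom e"
  using star_algebra.lin_ev_gen[OF star_algebra_adj_ops rep_gen] by (auto simp: rep_def)

text \<open>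
  The operator norm pulls back to one of the C*-seminorms over which the universal seminorm is the
  supremum.
\<close>

lemma opnorm_rep_le:
  assumes "f \<in> carrier (ck_free_algebra E)"
  shows "opnorm (rep f) \<le> ck_seminorm E f"
proof -
  let ?F = "ck_free_algebra E"
  interpret B: cstar_seminorm "adj_ops :: ('x op \<times> 'x op) star_alg" opnorm by (rule cstar_seminorm_adj_ops)
  have "(\<lambda>f. opnorm (rep f)) \<in> admissible ?F (ck_relations E)"
    unfolding admissible_def
  proof (intro CollectI conjI ballI)
    show "cstar_seminorm ?F (\<lambda>f. opnorm (rep f))"
      by (rule star_hom_pullback_seminorm[OF star_algebra_ck_free B.cstar_seminorm_axioms rep_hom])
    fix z assume z: "z \<in> ck_relations E"
    obtain a b where ab: "z = (a, b)" by (cases z)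
    have c: "a \<in> carrier ?F" "b \<in> carrier ?F" using ck_relations_closed[OF wf] z ab by auto
    have "(rep a, rep b) \<in> ck_equations E adj_ops rep_proj rep_isom"
      by (rule ck_equations_hom[OF wf star_algebra_ck_free B.star_algebra_axioms rep_hom ck_free_gen_carrier])
        (use rep_free_proj rep_free_isom z ab in auto)
    then have "rep a = rep b" using ck_family_rep by (auto simp: ck_family_def)
    then have "rep (a \<ominus>\<^bsub>?F\<^esub> b) = \<zero>\<^bsub>adj_ops\<^esub>"
      using star_hom_diff[OF star_algebra_ck_free B.star_algebra_axioms rep_hom c] star_hom_props(1)[OF rep_hom c(2)]
      by (simp only: B.diff_zero_iff)
    then show "case z of (a, b) \<Rightarrow> opnorm (rep (a \<ominus>\<^bsub>?F\<^esub> b)) = 0"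
      using B.seminorm_zero by (simp add: ab)
  qed
  then show ?thesis
    unfolding ck_seminorm_def
    using star_algebra.universal_seminorm_upper[OF star_algebra_ck_free ck_seminorm_bounded[OF wf assms]] by blast
qed

text \<open>
  \<open>R d y\<close> stands for any relation that holds whenever \<open>y\<close> can be reached from \<open>x0\<close> by adding and
  removing first edges, where \<open>d\<close> is the number of additions minus the number of removals. A word acts
  on the basis vector at \<open>x0\<close> by performing such steps, its letters being applied from right to left.
\<close>

lemma rep_list_orbit:
  fixes R :: "int \<Rightarrow> 'x \<Rightarrow> bool"
  assumes base: "R 0 x0"
    and up: "\<And>d e y. \<lbrakk>R d y; e \<in> arcs E; y \<in> X; rg y = tail E e\<rbrakk> \<Longrightarrow> R (d + 1) (\<sigma> e y)"
    and down: "\<And>d e y. \<lbrakk>R d (\<sigma> e y); e \<in> arcs E; y \<in> X; rg y = tail E e\<rbrakk> \<Longrightarrow> R (d - 1) y"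
    and ls: "ls \<noteq> []" "fst ` set ls \<subseteq> Proj_Gen ` verts E \<union> Isom_Gen ` arcs E"
  defines "\<delta> y \<equiv> (Poly_Mapping.single y 1 :: 'x \<Rightarrow>\<^sub>0 complex)"
  shows "fst (list_ev adj_ops (case_ck_gen rep_proj rep_isom) ls) (\<delta> x0) \<in>
    insert 0 (\<delta> ` {y. R (\<Sum>l\<leftarrow>ls. letter_degree l) y})"
proof -
  let ?q = "case_ck_gen rep_proj rep_isom"
  have letter: "fst (letter_ev adj_ops ?q l) \<xi> \<in> insert 0 (\<delta> ` {y. R (letter_degree l + d) y})"
    if l: "fst l \<in> Proj_Gen ` verts E \<union> Isom_Gen ` arcs E" and \<xi>: "\<xi> \<in> insert 0 (\<delta> ` {y. R d y})" for l \<xi> d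
  proof -
    consider (P) v where "letter_ev adj_ops ?q l = rep_proj v" "letter_degree l = 0"
      | (S) e where "e \<in> arcs E" "letter_ev adj_ops ?q l = rep_isom e" "letter_degree l = 1"
      | (S') e where "e \<in> arcs E" "letter_ev adj_ops ?q l = star adj_ops (rep_isom e)" "letter_degree l = -1"
      using l by (cases "snd l") (auto simp: letter_ev_def letter_degree_def rep_proj_def partial_bij_op_def)
    then show ?thesis
    proof cases
      case P
      then show ?thesis using \<xi>
        by (auto simp: rep_proj_def partial_bij_op_def pull_zero[OF inv_cyl] pull_single[OF inv_cyl] \<delta>_def cyl_def)
    next
      case S
      then show ?thesis using \<xi> up[of d _ e]
        by (auto simp: rep_isom_def partial_bij_op_def pull_zero[OF inv_bwd] pull_single[OF inv_bwd] \<delta>_def fwd_def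
            add.commute)
    next
      case S'
      show ?thesis
      proof (cases "\<xi> = 0")
        case True
        then show ?thesis using S' by (simp add: rep_isom_def partial_bij_op_def pull_zero[OF mutually_inverse_sym[OF inv_bwd]])
      next
        case False
        then obtain y where y: "R d y" "\<xi> = \<delta> y" using \<xi> by auto
        show ?thesis
        proof (cases "bwd e y")
          case None
          then show ?thesis using S' y
            by (simp add: rep_isom_def partial_bij_op_def \<delta>_def pull_single[OF mutually_inverse_sym[OF inv_bwd]])
        next
          case (Some x)
          then have "x \<in> X" "rg x = tail E e" "y = \<sigma> e x" by (auto simp: bwd_Some_iff fwd_def split: if_splits)
          then have "R (d - 1) x" using down[of d e x] y S' by simp
          then show ?thesis using S' y Some
            by (simp add: rep_isom_def partial_bij_op_def \<delta>_def pull_single[OF mutually_inverse_sym[OF inv_bwd]])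
        qed
      qed
    qed
  qed
  show ?thesis using ls
  proof (induction ls rule: list_nonempty_induct)
    case (single l)
    then show ?case using letter[of l "\<delta> x0" 0] base by auto
  next
    case (cons l ls)
    then show ?case
      using letter[of l "fst (list_ev adj_ops ?q ls) (\<delta> x0)" "\<Sum>l\<leftarrow>ls. letter_degree l"]
      by (simp add: star_algebra.list_ev_Cons[OF star_algebra_adj_ops rep_gen])
  qed
qed

end

locale graph_representation = graph_algebra E C + branching_system E X rg \<sigma>
  for E :: "('v, 'e) pre_digraph"
    and C :: "(nat \<Rightarrow> ('v, 'e) ck_gen star_word \<Rightarrow>\<^sub>0 complex) set cstar_alg" (structure)
    and X :: "'x set" and rg :: "'x \<Rightarrow> 'v" and \<sigma> :: "'e \<Rightarrow> 'x \<Rightarrow> 'x"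
begin

text \<open>
  If nothing can be reached from \<open>x0\<close> in degree \<open>n\<close>, then the words of degree \<open>n\<close> annihilate the
  basis vector at \<open>x0\<close>. The closure of the elements that annihilate it is a closed left ideal, which
  therefore contains the closed span of the products of elements of degrees \<open>-n\<close> and \<open>n\<close>. A strong
  grading would put the projection at the range of \<open>x0\<close> into this ideal, but that projection fixes the
  vector.
\<close>

theorem not_strongly_graded_if_annihilated:
  fixes R :: "int \<Rightarrow> 'x \<Rightarrow> bool"
  assumes x0: "x0 \<in> X" "rg x0 \<in> verts E"
    and base: "R 0 x0"
    and up: "\<And>d e y. \<lbrakk>R d y; e \<in> arcs E; y \<in> X; rg y = tail E e\<rbrakk> \<Longrightarrow> R (d + 1) (\<sigma> e y)"
    and down: "\<And>d e y. \<lbrakk>R d (\<sigma> e y); e \<in> arcs E; y \<in> X; rg y = tail E e\<rbrakk> \<Longrightarrow> R (d - 1) y"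
    and none: "\<And>y. \<not> R n y"
  shows "\<not> strongly_graded_cstar_algebra integer_group C V"
proof
  assume strong: "strongly_graded_cstar_algebra integer_group C V"
  define \<delta> where "\<delta> = (Poly_Mapping.single x0 1 :: 'x \<Rightarrow>\<^sub>0 complex)"
  interpret B: cstar_seminorm "adj_ops :: ('x op \<times> 'x op) star_alg" opnorm by (rule cstar_seminorm_adj_ops)
  interpret F: star_algebra F by (rule star_algebra_F)
  note r = star_hom_props[OF rep_hom]
  \<comment> \<open>Annihilation is expressed on the free algebra, where the representation acts by operators on
    functions of finite support; \<open>opnorm_rep_le\<close> carries the final estimate over.\<close>
  define K where "K = {f \<in> carrier F. fst (rep f) \<delta> = 0}"
  have KF: "j ` K \<subseteq> carrier C" using j(1) by (auto simp: K_def)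
  have K0: "\<zero>\<^bsub>F\<^esub> \<in> K" using star_hom_zero[OF star_algebra_F B.star_algebra_axioms rep_hom] by (simp add: K_def)
  have sub: "csubspace C (j ` K)"
    unfolding csubspace_def
  proof (intro conjI ballI allI)
    show "\<zero> \<in> j ` K" using K0 star_hom_zero[OF star_algebra_F star_algebra_axioms j_hom] by (metis imageI)
    show "x \<oplus> y \<in> j ` K" if xy: "x \<in> j ` K" "y \<in> j ` K" for x y
    proof -
      obtain f g where fg: "f \<in> K" "g \<in> K" "x = j f" "y = j g" using xy by blast
      then have "f \<oplus>\<^bsub>F\<^esub> g \<in> K" by (auto simp: K_def r(2))
      then show ?thesis using fg j(2)[of f g] by (auto simp: K_def intro!: image_eqI)
    qed
    show "c \<odot> x \<in> j ` K" if x: "x \<in> j ` K" for c x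
    proof -
      obtain f where f: "f \<in> K" "x = j f" using x by blast
      then have "c \<odot>\<^bsub>F\<^esub> f \<in> K" by (auto simp: K_def r(3) F.smult_closed fscale_distribs)
      then show ?thesis using f j(3)[of f c] by (auto simp: K_def intro!: image_eqI)
    qed
  qed (rule KF)
  have ideal: "b \<otimes> a \<in> cclosure C (j ` K)" if b: "b \<in> carrier C" and a: "a \<in> cclosure C (j ` K)" for a b
  proof (rule cclosure_mult[where S = "j ` carrier F"])
    show "b \<in> cclosure C (j ` carrier F)"
      using j(1) b j_dense[OF b] by (intro cclosureI) (auto, metis)
    show "a \<in> cclosure C (j ` K)" by (rule a)
    show "u \<otimes> w \<in> j ` K" if uw: "u \<in> j ` carrier F" "w \<in> j ` K" for u w
    proof -
      obtain f g where fg: "f \<in> carrier F" "g \<in> K" "u = j f" "w = j g" using uw by blast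
      then have "f \<otimes>\<^bsub>F\<^esub> g \<in> K"
        using adj_ops_linear(3)[OF r(1)[OF fg(1)]] by (auto simp: K_def r(4) F.mult_closed)
      then show ?thesis using fg j(4)[of f g] by (auto simp: K_def intro!: image_eqI)
    qed
  qed (use j(1) KF in auto)
  have "V n \<subseteq> cclosure C (j ` K)"
  proof -
    have "f \<in> K" if f: "f \<in> carrier F" "\<forall>w\<in>Poly_Mapping.keys f. word_degree w = n" for f
    proof -
      let ?q = "case_ck_gen rep_proj rep_isom"
      have keys: "letters w \<noteq> []" "fst ` set (letters w) \<subseteq> gens" "(\<Sum>l\<leftarrow>letters w. letter_degree l) = n"
        if "w \<in> Poly_Mapping.keys f" for w
        using that f by (auto simp: F_carrier gen_words_def word_degree_def)
      have zero: "fst (list_ev adj_ops ?q (letters w)) \<delta> = 0" if "w \<in> Poly_Mapping.keys f" for w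
      proof -
        have "fst (list_ev adj_ops ?q (letters w)) (Poly_Mapping.single x0 1) \<in>
            insert 0 ((\<lambda>y. Poly_Mapping.single y 1) ` {y. R (\<Sum>l\<leftarrow>letters w. letter_degree l) y})"
          by (rule rep_list_orbit[where R = R]) (fact base up down keys(1,2)[OF that])+
        then show ?thesis using keys(3)[OF that] none by (simp add: \<delta>_def)
      qed
      have c: "(\<lambda>w. Poly_Mapping.lookup f w \<odot>\<^bsub>adj_ops\<^esub> list_ev adj_ops ?q (letters w)) \<in>
          Poly_Mapping.keys f \<rightarrow> carrier adj_ops"
        by (rule funcsetI) (intro adj_ops_smult_closed B.list_ev_closed[OF rep_gen] keys(2))
      have "fst (rep f) \<delta> = 0"
        unfolding rep_def lin_ev_def finsum_adj_ops[OF finite_keys c]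
        by (simp add: zero fscale_distribs)
      then show ?thesis using f by (simp add: K_def)
    qed
    then have "j ` {f \<in> carrier F. \<forall>w\<in>Poly_Mapping.keys f. word_degree w = n} \<subseteq> j ` K" by auto
    then show ?thesis using V_dense[of n] cclosure_mono by (meson order_trans)
  qed
  then have "prod_span C (V (- n)) (V n) \<subseteq> cclosure C (j ` K)"
    using ideal V_closed by (intro prod_span_least csubspace_cclosure sub) blast
  then have "cclosure C (prod_span C (V (- n)) (V n)) \<subseteq> cclosure C (j ` K)"
    using cclosure_mono[of _ "cclosure C (j ` K)"] by simp
  moreover have "V 0 \<subseteq> cclosure C (prod_span C (V (- n)) (V n))"
    using strong unfolding strongly_graded_iff by (metis add.left_inverse)
  ultimately have "p (rg x0) \<in> cclosure C (j ` K)" using p_in_V[OF x0(2)] by blast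
  then obtain f where f: "f \<in> K" "cnorm C (p (rg x0) \<ominus> j f) < 1"
    using cclosureE[OF _ KF, of "p (rg x0)" 1] by auto
  let ?g = "free_gen (Proj_Gen (rg x0))"
  have g: "?g \<in> carrier F" by (rule ck_free_gen_carrier(1)[OF x0(2)])
  have fF: "f \<in> carrier F" "fst (rep f) \<delta> = 0" using f by (auto simp: K_def)
  have "opnorm (rep (?g \<ominus>\<^bsub>F\<^esub> f)) \<le> ck_seminorm E (?g \<ominus>\<^bsub>F\<^esub> f)" using g fF by (intro opnorm_rep_le) simp
  also have "\<dots> = cnorm C (p (rg x0) \<ominus> j f)"
    using g fF j_norm[of "?g \<ominus>\<^bsub>F\<^esub> f"] by (simp add: graph_proj_def j_diff)
  finally have small: "opnorm (rep (?g \<ominus>\<^bsub>F\<^esub> f)) < 1" using f(2) by simp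
  have "fst (rep (?g \<ominus>\<^bsub>F\<^esub> f)) \<delta> = fst (rep ?g) \<delta>"
    using g fF r(1)[OF fF(1)] r(1)[OF g]
    by (simp add: star_hom_diff[OF star_algebra_F B.star_algebra_axioms rep_hom] B.diff_eq_smult fscale_distribs)
  also have "\<dots> = \<delta>"
    using x0 by (simp add: rep_free_proj rep_proj_def partial_bij_op_def \<delta>_def pull_single[OF inv_cyl] cyl_def)
  finally have "l2 \<delta> \<le> opnorm (rep (?g \<ominus>\<^bsub>F\<^esub> f)) * l2 \<delta>"
    using opnorm_bound(1)[OF r(1), of "?g \<ominus>\<^bsub>F\<^esub> f" \<delta>] g fF by simp
  then show False using small by (simp add: \<delta>_def)
qed

end


section \<open>Obstructions to a strong grading\<close>

text \<open>
  Paths with source \<open>v\<close>, the empty list being the path of length zero. They form a branching system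
  when \<open>v\<close> is a source or receives infinitely many edges, because the path that has no first edge then
  lies over a vertex without a Cuntz--Krieger sum.
\<close>

inductive_set paths_with_source :: "('v, 'e) pre_digraph \<Rightarrow> 'v \<Rightarrow> 'e list set" for E v where
  Nil: "[] \<in> paths_with_source E v"
| Cons: "\<lbrakk>es \<in> paths_with_source E v; e \<in> arcs E; tail E e = (case es of [] \<Rightarrow> v | f # fs \<Rightarrow> head E f)\<rbrakk> \<Longrightarrow>
    e # es \<in> paths_with_source E v"

lemma branching_system_paths_with_source:
  assumes wf: "wf_digraph E"
    and sing: "infinite {e \<in> arcs E. head E e = v} \<or> {e \<in> arcs E. head E e = v} = {}"
  shows "branching_system E (paths_with_source E v) (\<lambda>es. case es of [] \<Rightarrow> v | e # _ \<Rightarrow> head E e) (#)"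
proof (rule branching_system.intro)
  let ?rg = "\<lambda>es. case es of [] \<Rightarrow> v | e # _ \<Rightarrow> head E e"
  show "e # es \<in> paths_with_source E v" if "e \<in> arcs E" "es \<in> paths_with_source E v" "?rg es = tail E e" for e es
    using that by (intro paths_with_source.Cons) simp_all
  show "\<exists>e\<in>arcs E. \<exists>fs\<in>paths_with_source E v. ?rg fs = tail E e \<and> es = e # fs"
    if es: "es \<in> paths_with_source E v"
      and fin: "finite {e \<in> arcs E. head E e = ?rg es}" "{e \<in> arcs E. head E e = ?rg es} \<noteq> {}" for es
    using es
  proof cases
    case Nil
    then have "?rg es = v" by simp
    then show ?thesis using sing fin by metis
  next
    case (Cons fs e)
    then show ?thesis by (intro bexI[of _ e] bexI[of _ fs]) simp_all
  qed
qed (use wf in simp_all)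

lemma branching_system_infinite_paths:
  assumes wf: "wf_digraph E"
  shows "branching_system E (infinite_paths E) (\<lambda>x. head E (x 0)) (\<lambda>e x. case_nat e x)"
proof
  fix x
  assume x: "x \<in> infinite_paths E"
  have split: "x = case_nat (x 0) (\<lambda>n. x (Suc n))" by (auto simp: fun_eq_iff split: nat.split)
  have tl: "(\<lambda>n. x (Suc n)) \<in> infinite_paths E" and "x 0 \<in> arcs E" and "head E (x (Suc 0)) = tail E (x 0)"
    using x by (auto simp: infinite_paths_def)
  then show "\<exists>e\<in>arcs E. \<exists>y\<in>infinite_paths E. head E (y 0) = tail E e \<and> x = case_nat e y"
    by (intro bexI[OF _ \<open>x 0 \<in> arcs E\<close>] bexI[OF _ tl] conjI split) simp
next
  fix e f and x y :: "nat \<Rightarrow> 'b"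
  assume eq: "case_nat e x = case_nat f y"
  show "e = f \<and> x = y"
    using fun_cong[OF eq, of 0] fun_cong[OF eq, of "Suc _"] by (auto simp: fun_eq_iff)
qed (use wf in \<open>auto simp: wf_digraph_def infinite_paths_def split: nat.split\<close>)

definition segment :: "('v, 'e) pre_digraph \<Rightarrow> (nat \<Rightarrow> 'e) \<Rightarrow> nat \<Rightarrow> ('v, 'e) fpath" where
  "segment E x n = (if n = 0 then Vertex_Path (head E (x 0)) else Edge_Path (map x [0..<n]))"

lemma path_length_segment: "path_length (segment E x n) = n"
  by (simp add: segment_def)

lemma segment_initial: "segment E x n \<in> initial_segments E x"
  by (auto simp: segment_def initial_segments_def)

lemma segment_finite_path:
  assumes "wf_digraph E" "x \<in> infinite_paths E"
  shows "segment E x n \<in> finite_paths E"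
proof (cases "n = 0")
  case True
  then show ?thesis using assms by (auto simp: segment_def finite_paths_def infinite_paths_def wf_digraph_def)
next
  case False
  have "Edge_Path (map x [0..<n]) \<in> finite_paths E"
    unfolding finite_paths_def using False assms(2) by (intro UnI2 imageI) (auto simp: infinite_paths_def)
  then show ?thesis using False by (simp add: segment_def)
qed

lemma path_source_segment:
  assumes "x \<in> infinite_paths E"
  shows "path_source E (segment E x n) = head E (x n)"
  using assms by (cases n) (auto simp: segment_def infinite_paths_def)

context graph_algebra
begin

text \<open>
  Prepending or removing an edge changes the length of a path by one, so nothing can be reached in
  degree \<open>-1\<close> from the path of length zero.
\<close>

lemma regular_if_strongly_graded:
  assumes strong: "strongly_graded_cstar_algebra integer_group C V" and v: "v \<in> verts E"
  shows "finite {e \<in> arcs E. head E e = v} \<and> {e \<in> arcs E. head E e = v} \<noteq> {}"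
proof (rule ccontr)
  assume "\<not> ?thesis"
  then have sing: "infinite {e \<in> arcs E. head E e = v} \<or> {e \<in> arcs E. head E e = v} = {}" by blast
  interpret R: graph_representation E C "paths_with_source E v" "\<lambda>es. case es of [] \<Rightarrow> v | e # _ \<Rightarrow> head E e" "(#)"
    by (rule graph_representation.intro[OF graph_algebra_axioms branching_system_paths_with_source[OF wf sing]])
  have "\<not> strongly_graded_cstar_algebra integer_group C V"
  proof (rule R.not_strongly_graded_if_annihilated[where R = "\<lambda>d es. int (length es) = d" and n = "- 1"])
    show "[] \<in> paths_with_source E v" by (rule paths_with_source.Nil)
  qed (use v in auto)
  then show False using strong by blast
qed

text \<open>
  What can be reached from \<open>x\<close> in degree \<open>k\<close> is an infinite path \<open>y\<close> that agrees with \<open>x\<close> after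
  deleting the first \<open>l\<close> edges of \<open>y\<close> and the first \<open>i\<close> edges of \<open>x\<close>, where \<open>l - i = k\<close>. The deleted
  segments are then the paths that property (Y) asks for.
\<close>

lemma property_Y_if_strongly_graded:
  assumes strong: "strongly_graded_cstar_algebra integer_group C V"
  shows "property_Y E"
  unfolding property_Y_def
proof (intro ballI allI, rule ccontr)
  fix x k
  assume x: "x \<in> infinite_paths E"
    and no: "\<not> (\<exists>\<alpha>\<in>initial_segments E x. \<exists>\<beta>\<in>finite_paths E. path_source E \<alpha> = path_source E \<beta> \<and>
      int (path_length \<beta>) - int (path_length \<alpha>) = int k)"
  define R where "R d y \<longleftrightarrow> y \<in> infinite_paths E \<and> (\<exists>i l. int l - int i = d \<and> (\<forall>n. y (l + n) = x (i + n)))" for d y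
  interpret B: graph_representation E C "infinite_paths E" "\<lambda>x. head E (x 0)" "\<lambda>e x. case_nat e x"
    by (rule graph_representation.intro[OF graph_algebra_axioms branching_system_infinite_paths[OF wf]])
  have "\<not> strongly_graded_cstar_algebra integer_group C V"
  proof (rule B.not_strongly_graded_if_annihilated[where R = R and n = "int k"])
    show "x \<in> infinite_paths E" by (rule x)
    show "head E (x 0) \<in> verts E" using x by (simp add: infinite_paths_def)
    show "R 0 x" unfolding R_def using x by (intro conjI exI[of _ 0]) auto
    show "R (d + 1) (case_nat e y)"
      if y: "R d y" "e \<in> arcs E" "y \<in> infinite_paths E" "head E (y 0) = tail E e" for d e y
    proof -
      obtain i l where "int l - int i = d" "\<And>n. y (l + n) = x (i + n)" using y by (auto simp: R_def)
      then show ?thesis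
        unfolding R_def using B.prepend_closed[OF y(2-4)] by (intro conjI exI[of _ i] exI[of _ "Suc l"]) auto
    qed
    show "R (d - 1) y"
      if y: "R d (case_nat e y)" "e \<in> arcs E" "y \<in> infinite_paths E" "head E (y 0) = tail E e" for d e y
    proof -
      obtain i l where il: "int l - int i = d" "\<And>n. case_nat e y (l + n) = x (i + n)" using y by (auto simp: R_def)
      show ?thesis
      proof (cases l)
        \<comment> \<open>No edge of \<open>case_nat e y\<close> is deleted, so its first edge \<open>e\<close> belongs to the common tail and has
          to be deleted from \<open>x\<close> instead.\<close>
        case 0
        then show ?thesis unfolding R_def using il y(3) il(2)[of "Suc _"]
          by (intro conjI exI[of _ "Suc i"] exI[of _ 0]) auto
      next
        case (Suc m)
        then show ?thesis unfolding R_def using il y(3) by (intro conjI exI[of _ i] exI[of _ m]) auto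
      qed
    qed
    show "\<not> R (int k) y" for y
    proof
      assume "R (int k) y"
      then obtain i l where y: "y \<in> infinite_paths E" and il: "int l - int i = int k" "y (l + 0) = x (i + 0)"
        unfolding R_def by blast
      have "path_source E (segment E x i) = path_source E (segment E y l)"
        using il(2) by (simp add: path_source_segment[OF x] path_source_segment[OF y])
      then show False
        using no segment_initial[of E x i] segment_finite_path[OF wf y, of l] il(1) path_length_segment by metis
    qed
  qed
  then show False using strong by blast
qed

end

theorem theorem1:
  fixes E :: "('v, 'e) pre_digraph"
  assumes "wf_digraph E"
  shows "strongly_graded_cstar_algebra integer_group (graph_cstar E) (gauge_component E)
    \<longleftrightarrow> row_finite E \<and> no_sources E \<and> property_Y E"
proof -
  interpret graph_algebra E "graph_cstar E"
    using cstar_algebra_graph_cstar[OF assms] assms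
    by (intro graph_algebra.intro graph_algebra_axioms.intro) auto
  show ?thesis
  proof
    assume strong: "strongly_graded_cstar_algebra integer_group (graph_cstar E) (gauge_component E)"
    show "row_finite E \<and> no_sources E \<and> property_Y E"
      using regular_if_strongly_graded[OF strong] property_Y_if_strongly_graded[OF strong]
      by (simp add: row_finite_def no_sources_def)
  qed (use strongly_graded_if_property_Y in blast)
qed

end
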